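(* Let $(F_n,\alpha_n,\rho_n)_{n\ge 1}$ be a sequence where $F_n:\mathcal T_n\to\mathbb R$ is a tree parameter that is $\alpha_n$-Lipschitz and $\rho_n$-superposable for some $\alpha_n>0$ and $\rho_n\geqslant 1$ (subscripts are suppressed below). Let $\boldsymbol T$ be a uniform random element of $\mathcal T_n$. Assume that for a fixed constant $\varepsilon>0$, \[ \frac{n\alpha^3}{(\operatorname{Var}[F(\boldsymbol T)])^{3/2}}+\frac{n^{1/4}\alpha\rho}{(\operatorname{Var}[F(\boldsymbol T)])^{1/2}}=O(n^{-\varepsilon})\quad (n\to\infty). \] Then $F(\boldsymbol T)$ is asymptotically normal, and moreover $\delta_{\rm K}[F(\boldsymbol T)]=O(n^{-\varepsilon'})$ for any $\varepsilon'\in(0,\varepsilon)$.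
   Context: $\mathcal T_n$ is the set of trees with vertex set $[n]=\{1,\dots,n\}$ (so $|\mathcal T_n|=n^{n-2}$); graphs are identified with their edge sets. For $T\in\mathcal T_n$, $d_T(i,j)$ is the number of edges on the path from $i$ to $j$ in $T$, and for $A,B\subseteq[n]$, $d_T(A,B)=\min_{u\in A,v\in B}d_T(u,v)$. Tree perturbation: if $ij\in T$ and $ik\notin T$, $S_i^{jk}T$ is the graph obtained from $T$ by deleting edge $ij$ and inserting edge $ik$. A parameter $F:\mathcal T_n\to\mathbb R$ is $\alpha$-Lipschitz if $|F(T)-F(S_i^{jk}T)|\le\alpha$ for all $T\in\mathcal T_n$ and all triples $(i,j,k)$ for which $S_i^{jk}T$ is a tree. $F$ is $\rho$-superposable if $F(S_i^{jk}S_a^{bc}T)-F(T)=(F(S_i^{jk}T)-F(T))+(F(S_a^{bc}T)-F(T))$ for all $T\in\mathcal T_n$ and all triples $(i,j,k),(a,b,c)$ such that $S_i^{jk}T$, $S_a^{bc}T$, $S_i^{jk}S_a^{bc}T$ are trees and $d_T(\{j,k\},\{b,c\})\ge\rho$. For a random variable $X$, $\delta_{\rm K}[X]=\sup_{t\in\mathbb R}|\mathbb P(X-\mathbb E X\le t(\operatorname{Var}X)^{1/2})-\Phi(t)|$ where $\Phi$ is the standard normal distribution function; $X=X_n$ is asymptotically normal if $\delta_{\rm K}[X_n]\to0$ as $n\to\infty$. Asymptotic notation refers to $n\to\infty$. *)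

theory Defs
  imports "HOL-Probability.Probability" "HOL-Library.Landau_Symbols"
begin

text \<open>
  A graph is identified with its edge set, an edge being a two-element set of vertices.
  The forest and tree predicates of the AFP entry Graph-Theory refer to directed cycles, so that
  a symmetric digraph with at least one edge is never a tree there; undirected trees are therefore
  defined here.
\<close>

type_synonym graph = "nat set set"

text \<open>Paths and cycles are given by their lists of (distinct) vertices.\<close>

definition is_path :: "graph \<Rightarrow> nat \<Rightarrow> nat \<Rightarrow> nat list \<Rightarrow> bool" where
  "is_path G u v p \<longleftrightarrow> p \<noteq> [] \<and> hd p = u \<and> last p = v \<and> distinct p \<and>
     successively (\<lambda>x y. {x, y} \<in> G) p"

definition is_cycle :: "graph \<Rightarrow> nat list \<Rightarrow> bool" where
  "is_cycle G p \<longleftrightarrow> 3 \<le> length p \<and> distinct p \<and>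
     successively (\<lambda>x y. {x, y} \<in> G) p \<and> {last p, hd p} \<in> G"

definition graphs_on :: "nat \<Rightarrow> graph set" where
  "graphs_on n = {G. G \<subseteq> {{u, v} | u v. u \<in> {1..n} \<and> v \<in> {1..n} \<and> u \<noteq> v}}"

definition trees :: "nat \<Rightarrow> graph set" where
  "trees n = {T \<in> graphs_on n.
     (\<forall>u\<in>{1..n}. \<forall>v\<in>{1..n}. \<exists>p. is_path T u v p) \<and> (\<nexists>p. is_cycle T p)}"

text \<open>A path with \<open>m\<close> edges has \<open>m + 1\<close> vertices. Only meaningful for vertices of a tree.\<close>

definition tree_dist :: "graph \<Rightarrow> nat \<Rightarrow> nat \<Rightarrow> nat" where
  "tree_dist T i j = length (THE p. is_path T i j p) - 1"

definition tree_set_dist :: "graph \<Rightarrow> nat set \<Rightarrow> nat set \<Rightarrow> nat" where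
  "tree_set_dist T A B = Min {tree_dist T u v | u v. u \<in> A \<and> v \<in> B}"

text \<open>
  \<open>perturb i j k T\<close> is $S_i^{jk}T$, which the mathematics defines only if $ij \in T$ and
  $ik \notin T$. This side condition is part of \<open>perturb_tree\<close>, which renders the phrase
  ``$S_i^{jk}T$ is a tree''. It also forces $i, j, k$ to be distinct vertices in $[n]$.
\<close>

definition perturb :: "nat \<Rightarrow> nat \<Rightarrow> nat \<Rightarrow> graph \<Rightarrow> graph" where
  "perturb i j k T = insert {i, k} (T - {{i, j}})"

definition perturb_tree :: "nat \<Rightarrow> nat \<Rightarrow> nat \<Rightarrow> nat \<Rightarrow> graph \<Rightarrow> bool" where
  "perturb_tree n i j k T \<longleftrightarrow> {i, j} \<in> T \<and> {i, k} \<notin> T \<and> perturb i j k T \<in> trees n"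

definition tree_lipschitz :: "nat \<Rightarrow> real \<Rightarrow> (graph \<Rightarrow> real) \<Rightarrow> bool" where
  "tree_lipschitz n \<alpha> F \<longleftrightarrow>
     (\<forall>T\<in>trees n. \<forall>i j k. perturb_tree n i j k T \<longrightarrow> \<bar>F T - F (perturb i j k T)\<bar> \<le> \<alpha>)"

definition superposable :: "nat \<Rightarrow> real \<Rightarrow> (graph \<Rightarrow> real) \<Rightarrow> bool" where
  "superposable n \<rho> F \<longleftrightarrow>
     (\<forall>T\<in>trees n. \<forall>i j k a b c.
        perturb_tree n i j k T \<and> perturb_tree n a b c T \<and>
        perturb_tree n i j k (perturb a b c T) \<and>
        \<rho> \<le> real (tree_set_dist T {j, k} {b, c}) \<longrightarrow>
        F (perturb i j k (perturb a b c T)) - F T =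
          (F (perturb i j k T) - F T) + (F (perturb a b c T) - F T))"

definition uniform_tree :: "nat \<Rightarrow> graph pmf" where
  "uniform_tree n = pmf_of_set (trees n)"

definition kolmogorov_dist :: "'a measure \<Rightarrow> ('a \<Rightarrow> real) \<Rightarrow> real" where
  "kolmogorov_dist M X =
     (SUP t::real. \<bar>measure M {\<omega> \<in> space M.
            X \<omega> - prob_space.expectation M X \<le> t * sqrt (prob_space.variance M X)} -
          cdf std_normal_distribution t\<bar>)"

definition asymptotically_normal :: "(nat \<Rightarrow> 'a measure) \<Rightarrow> (nat \<Rightarrow> 'a \<Rightarrow> real) \<Rightarrow> bool" where
  "asymptotically_normal M X \<longleftrightarrow> (\<lambda>n. kolmogorov_dist (M n) (X n)) \<longlonglongrightarrow> 0"

end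

(*
  A word of independent uniform letters w 1, ..., w N in [n], preceded by w 0 = 1, is coded as a tree
  by attaching every vertex to the letter before its first occurrence (Aldous-Broder on the complete
  graph). Up to the event that some vertex is not visited, which is negligible for N = n^(1 + delta),
  this tree is uniform, so F(T) becomes a function f of independent letters.

  Changing one letter costs at most three perturbations, so f is 3 alpha-Lipschitz in each letter, and
  by superposability the mixed second difference of f in two positions vanishes unless letters involved
  at the two positions are at distance less than rho in one of the trees concerned. Stein's method, with
  the martingale differences of f paired with its discrete derivatives, gives a bound on the Kolmogorov
  distance in terms of N alpha^3 and of the variances of two quadratic terms. By the Efron-Stein
  inequality, these variances are controlled by the number of close pairs of positions, hence by ball
  sizes in the tree. With high probability all balls of radius R have at most R^2 n^delta vertices, since
  the moments of ball sizes can be computed by counting rooted forests.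
*)
theory Submission
  imports Defs
begin

section \<open>Averages over independent letters\<close>

text \<open>The Kolmogorov distance forces indicators as test functions, and the solution of Stein's
  equation for an indicator has a kink, which leaves a remainder that is not quadratically small.
  The bound for this remainder is antisymmetric under exchanging the old and the new letter; summed
  over positions it becomes the second quadratic term, which is centred, so its variance suffices
  and no rate is lost. A martingale difference averages over all later letters, so its locality
  concerns conditional probabilities of closeness given a prefix. Two facts control them: nearness
  of visited vertices is decided by the prefix, and unvisited vertices are exchangeable. The
  exponents of the hypothesis come from scaling: with a the Lipschitz constant divided by the
  standard deviation, the cubic remainder is n a^3, and a quadratic term has variance about n a^4
  (rho^2)^2, with root (n^(1/4) a rho)^2. The word length n^(1+delta) and the slack n^delta in ball
  sizes cost a small power of n, hence the rate only for exponents below epsilon.\<close>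

definition avg :: "'a set \<Rightarrow> ('a \<Rightarrow> real) \<Rightarrow> real" where
  "avg A f = sum f A / real (card A)"

lemma avg_cong: "A = B \<Longrightarrow> (\<And>x. x \<in> B \<Longrightarrow> f x = g x) \<Longrightarrow> avg A f = avg B g"
  unfolding avg_def by (metis sum.cong)

lemma avg_add: "avg A (\<lambda>x. f x + g x) = avg A f + avg A g"
  by (simp add: avg_def sum.distrib add_divide_distrib)

lemma avg_diff: "avg A (\<lambda>x. f x - g x) = avg A f - avg A g"
  by (simp add: avg_def sum_subtractf diff_divide_distrib)

lemma avg_minus: "avg A (\<lambda>x. - f x) = - avg A f"
  by (simp add: avg_def sum_negf)

lemma avg_cmult: "avg A (\<lambda>x. c * f x) = c * avg A f"
  by (simp add: avg_def sum_distrib_left)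

lemma avg_multc: "avg A (\<lambda>x. f x * c) = avg A f * c"
  by (simp add: avg_def sum_distrib_right)

lemma avg_sum: "avg A (\<lambda>x. \<Sum>i\<in>I. f i x) = (\<Sum>i\<in>I. avg A (f i))"
  unfolding avg_def by (subst sum.swap) (simp add: sum_divide_distrib)

lemma avg_const: "finite A \<Longrightarrow> A \<noteq> {} \<Longrightarrow> avg A (\<lambda>_. c) = c"
  by (simp add: avg_def)

lemma avg_mono: "(\<And>x. x \<in> A \<Longrightarrow> f x \<le> g x) \<Longrightarrow> avg A f \<le> avg A g"
  unfolding avg_def by (intro divide_right_mono sum_mono) auto

lemma avg_nonneg: "(\<And>x. x \<in> A \<Longrightarrow> 0 \<le> f x) \<Longrightarrow> 0 \<le> avg A f"
  unfolding avg_def by (intro divide_nonneg_nonneg sum_nonneg) auto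

lemma avg_abs_le: "\<bar>avg A f\<bar> \<le> avg A (\<lambda>x. \<bar>f x\<bar>)"
  unfolding avg_def by (simp add: abs_divide divide_right_mono sum_abs)

lemma avg_swap: "avg A (\<lambda>x. avg B (f x)) = avg B (\<lambda>y. avg A (\<lambda>x. f x y))"
  unfolding avg_def
  by (simp add: sum_divide_distrib[symmetric] mult.commute) (subst sum.swap, simp)

lemma avg_le_const: "finite A \<Longrightarrow> A \<noteq> {} \<Longrightarrow> (\<And>x. x \<in> A \<Longrightarrow> f x \<le> c) \<Longrightarrow> avg A f \<le> c"
  using avg_mono[of A f "\<lambda>_. c"] by (simp add: avg_const)

lemma avg_reindex: "bij_betw h A B \<Longrightarrow> avg A (\<lambda>x. f (h x)) = avg B f"
  unfolding avg_def by (simp add: sum.reindex_bij_betw bij_betw_same_card)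

lemma avg_Times: "avg (A \<times> B) (\<lambda>(x, y). f x y) = avg A (\<lambda>x. avg B (f x))"
  unfolding avg_def by (simp add: sum.cartesian_product[symmetric] card_cartesian_product
      sum_divide_distrib[symmetric] mult.commute)

lemma avg_power2_le:
  assumes "finite A" "A \<noteq> {}"
  shows "(avg A f)\<^sup>2 \<le> avg A (\<lambda>x. (f x)\<^sup>2)"
proof -
  have "0 \<le> avg A (\<lambda>x. (f x - avg A f)\<^sup>2)"
    by (rule avg_nonneg) auto
  also have "\<dots> = avg A (\<lambda>x. ((f x)\<^sup>2 - (2 * avg A f) * f x) + (avg A f)\<^sup>2)"
    by (intro avg_cong refl) (simp add: power2_eq_square algebra_simps)
  also have "\<dots> = avg A (\<lambda>x. (f x)\<^sup>2) - (2 * avg A f) * avg A f + (avg A f)\<^sup>2"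
    by (simp only: avg_add avg_diff avg_cmult avg_const[OF assms])
  finally show ?thesis by (simp add: power2_eq_square)
qed

lemma avg_abs_le_sqrt:
  assumes "finite A" "A \<noteq> {}"
  shows "avg A (\<lambda>x. \<bar>f x\<bar>) \<le> sqrt (avg A (\<lambda>x. (f x)\<^sup>2))"
  using avg_power2_le[OF assms, of "\<lambda>x. \<bar>f x\<bar>"] real_le_rsqrt by auto

lemma avg_abs_mono:
  assumes "\<And>x. x \<in> A \<Longrightarrow> \<bar>f x\<bar> \<le> g x"
  shows "\<bar>avg A f\<bar> \<le> avg A g"
  using order_trans[OF avg_abs_le avg_mono] assms by metis

text \<open>A prefix of \<open>w\<close> continued by \<open>Y\<close>: averaging over
  \<open>Y\<close> is conditioning on the letters of \<open>w\<close> up to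
  \<open>j\<close>.\<close>

definition mix :: "nat \<Rightarrow> (nat \<Rightarrow> 'a) \<Rightarrow> (nat \<Rightarrow> 'a) \<Rightarrow> nat \<Rightarrow> 'a" where
  "mix j w Y = (\<lambda>i. if i \<le> j then w i else Y i)"

lemma mix_mix [simp]: "mix j (mix j w Y) (mix j Y w) = w"
  by (auto simp: mix_def)

lemma mix_apply: "mix j w Y i = (if i \<le> j then w i else Y i)"
  by (simp add: mix_def)

lemma mix_upd_left: "j \<ge> i \<Longrightarrow> mix j (w(i := y)) Y = (mix j w Y)(i := y)"
  by (auto simp: mix_def fun_eq_iff)

lemma mix_upd_left': "j < i \<Longrightarrow> mix j (w(i := y)) Y = mix j w Y"
  by (auto simp: mix_def fun_eq_iff)

lemma mix_upd_right: "1 \<le> j \<Longrightarrow> mix j (w(j := y)) Y = mix (j - 1) w (Y(j := y))"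
  by (auto simp: mix_def fun_eq_iff)

section \<open>The space of words: resampling, covariance identity, Efron-Stein inequality\<close>

locale word_space =
  fixes V :: "'a set" and d :: 'a and N :: nat
  assumes finite_V: "finite V" and d_V: "d \<in> V"
begin

text \<open>Positions outside \<open>{1..N}\<close> carry the default letter \<open>d\<close>, which
  makes the set finite and gives every word the same letter at 0. Uniform averages over it are
  expectations over independent letters.\<close>

definition words :: "(nat \<Rightarrow> 'a) set" where
  "words = PiE_dflt {1..N} d (\<lambda>_. V)"

lemma words_iff: "w \<in> words \<longleftrightarrow> (\<forall>i\<in>{1..N}. w i \<in> V) \<and> (\<forall>i. i \<notin> {1..N} \<longrightarrow> w i = d)"
  by (auto simp: words_def PiE_dflt_def)

lemma words_in_V: "w \<in> words \<Longrightarrow> w i \<in> V"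
  using d_V by (cases "i \<in> {1..N}") (auto simp: words_iff)

lemma words_0: "w \<in> words \<Longrightarrow> w 0 = d"
  by (auto simp: words_iff)

lemma V_nonempty: "V \<noteq> {}"
  using d_V by auto

lemma finite_words: "finite words"
  unfolding words_def by (intro finite_PiE_dflt) (auto simp: finite_V)

lemma words_nonempty: "words \<noteq> {}"
  unfolding words_def using V_nonempty by auto

lemma upd_words: "w \<in> words \<Longrightarrow> j \<in> {1..N} \<Longrightarrow> y \<in> V \<Longrightarrow> w(j := y) \<in> words"
  by (auto simp: words_iff)

lemma mix_words: "w \<in> words \<Longrightarrow> Y \<in> words \<Longrightarrow> mix j w Y \<in> words"
  by (auto simp: words_iff mix_def)

lemma mix_N: "w \<in> words \<Longrightarrow> Y \<in> words \<Longrightarrow> mix N w Y = w"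
  by (auto simp: words_iff mix_def fun_eq_iff)

lemma mix_0: "w \<in> words \<Longrightarrow> Y \<in> words \<Longrightarrow> mix 0 w Y = Y"
  by (auto simp: words_iff mix_def fun_eq_iff)

lemmas avgW_const = avg_const[OF finite_words words_nonempty]
lemmas avgV_const = avg_const[OF finite_V V_nonempty]

text \<open>Exchanging the letter at \<open>j\<close> with the independent letter \<open>y\<close>
  is an involution of \<open>words\<close> times \<open>V\<close>. This is the exchangeable pair
  behind all antisymmetry arguments.\<close>

lemma avg_resample:
  assumes "j \<in> {1..N}"
  shows "avg words (\<lambda>w. avg V (\<lambda>y. \<phi> w y)) = avg words (\<lambda>w. avg V (\<lambda>y. \<phi> (w(j := y)) (w j)))"
proof -
  have "bij_betw (\<lambda>(w, y). (w(j := y), w j)) (words \<times> V) (words \<times> V)"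
    by (rule bij_betw_byWitness[where f' = "\<lambda>(w, y). (w(j := y), w j)"])
      (use assms in \<open>auto simp: upd_words words_in_V\<close>)
  from avg_reindex[OF this, of "\<lambda>(w, y). \<phi> w y"] show ?thesis
    unfolding avg_Times[symmetric] by (simp add: case_prod_unfold)
qed

lemma avg_resample1:
  assumes "j \<in> {1..N}"
  shows "avg words \<phi> = avg words (\<lambda>w. avg V (\<lambda>y. \<phi> (w(j := y))))"
  using avg_resample[OF assms, of "\<lambda>w _. \<phi> w"] by (simp add: avgV_const)

lemma avg_mix:
  "avg words (\<lambda>w. avg words (\<lambda>Y. \<phi> w Y)) = avg words (\<lambda>w. avg words (\<lambda>Y. \<phi> (mix j w Y) (mix j Y w)))"
proof -
  have "bij_betw (\<lambda>(w, Y). (mix j w Y, mix j Y w)) (words \<times> words) (words \<times> words)"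
    by (rule bij_betw_byWitness[where f' = "\<lambda>(w, Y). (mix j w Y, mix j Y w)"])
      (auto simp: mix_words)
  from avg_reindex[OF this, of "\<lambda>(w, y). \<phi> w y"] show ?thesis
    unfolding avg_Times[symmetric] by (simp add: case_prod_unfold)
qed

lemma avg_mix1: "avg words \<phi> = avg words (\<lambda>w. avg words (\<lambda>Y. \<phi> (mix j w Y)))"
  using avg_mix[of "\<lambda>w _. \<phi> w" j] by (simp add: avgW_const)

text \<open>The conditional expectation of \<open>f\<close> given the letters up to
  \<open>j\<close>. Averaging \<open>dpre\<close> over the new letter yields the martingale
  difference.\<close>

definition pre :: "((nat \<Rightarrow> 'a) \<Rightarrow> real) \<Rightarrow> nat \<Rightarrow> (nat \<Rightarrow> 'a) \<Rightarrow> real" where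
  "pre f j w = avg words (\<lambda>Y. f (mix j w Y))"

definition dpre :: "((nat \<Rightarrow> 'a) \<Rightarrow> real) \<Rightarrow> nat \<Rightarrow> (nat \<Rightarrow> 'a) \<Rightarrow> 'a \<Rightarrow> real" where
  "dpre f j w y = pre f j w - pre f j (w(j := y))"

definition dlt :: "((nat \<Rightarrow> 'a) \<Rightarrow> real) \<Rightarrow> nat \<Rightarrow> (nat \<Rightarrow> 'a) \<Rightarrow> 'a \<Rightarrow> real" where
  "dlt f j w y = f w - f (w(j := y))"

lemma pre_N: "w \<in> words \<Longrightarrow> pre f N w = f w"
  unfolding pre_def by (subst avg_cong[OF refl, of _ _ "\<lambda>_. f w"]) (auto simp: mix_N avgW_const)

lemma pre_0: "w \<in> words \<Longrightarrow> pre f 0 w = avg words f"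
  unfolding pre_def by (rule avg_cong) (auto simp: mix_0)

lemma avg_pre:
  assumes "j \<in> {1..N}"
  shows "avg V (\<lambda>y. pre f j (w(j := y))) = pre f (j - 1) w"
proof -
  have "avg V (\<lambda>y. pre f j (w(j := y))) = avg words (\<lambda>Y. avg V (\<lambda>y. f (mix (j - 1) w (Y(j := y)))))"
    unfolding pre_def using assms by (subst avg_swap) (simp add: mix_upd_right)
  also have "\<dots> = pre f (j - 1) w"
    unfolding pre_def using avg_resample1[OF assms, of "\<lambda>Y. f (mix (j - 1) w Y)"] by simp
  finally show ?thesis .
qed

lemma dpre_eq_avg: "j \<in> {1..N} \<Longrightarrow> dpre f j w y = avg words (\<lambda>Y. dlt f j (mix j w Y) y)"
  unfolding dpre_def pre_def dlt_def by (simp add: avg_diff mix_upd_left)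

text \<open>\<open>f\<close> minus its mean is the sum of the martingale differences, each the
  average of \<open>dpre\<close> over a new letter. Exchanging the old with the new letter flips the
  sign of \<open>dpre\<close>, which turns \<open>G\<close> into half of
  \<open>dlt G\<close>.\<close>

lemma stein_identity:
  "avg words (\<lambda>w. f w * G w) = avg words f * avg words G +
     (\<Sum>j=1..N. avg words (\<lambda>w. avg V (\<lambda>y. dpre f j w y * dlt G j w y))) / 2"
proof -
  have *: "avg words (\<lambda>w. (pre f j w - pre f (j - 1) w) * G w) =
      avg words (\<lambda>w. avg V (\<lambda>y. dpre f j w y * dlt G j w y)) / 2" if j: "j \<in> {1..N}" for j
  proof -
    have a: "avg words (\<lambda>w. (pre f j w - pre f (j - 1) w) * G w) = avg words (\<lambda>w. avg V (\<lambda>y. dpre f j w y * G w))"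
      unfolding dpre_def by (simp add: avg_multc avg_diff avgV_const avg_pre[OF j])
    have "\<dots> = avg words (\<lambda>w. avg V (\<lambda>y. - (dpre f j w y * G (w(j := y)))))"
      by (subst avg_resample[OF j]) (simp add: dpre_def algebra_simps)
    then have "avg words (\<lambda>w. avg V (\<lambda>y. dpre f j w y * dlt G j w y)) =
        2 * avg words (\<lambda>w. avg V (\<lambda>y. dpre f j w y * G w))"
      unfolding dlt_def by (simp add: right_diff_distrib avg_diff avg_minus)
    then show ?thesis using a by simp
  qed
  have tel: "(\<Sum>j=1..N. pre f j w - pre f (j - 1) w) = pre f N w - pre f 0 w" for w
    using sum_telescope''[of 0 N "\<lambda>j. pre f j w"] by (simp add: sum.atLeast1_atMost_eq atLeast0LessThan)
  have "avg words (\<lambda>w. f w * G w) =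
      avg words (\<lambda>w. avg words f * G w + (\<Sum>j=1..N. (pre f j w - pre f (j - 1) w) * G w))"
    by (intro avg_cong refl) (simp only: sum_distrib_right[symmetric] tel pre_N pre_0, simp add: algebra_simps)
  also have "\<dots> = avg words f * avg words G + (\<Sum>j=1..N. avg words (\<lambda>w. (pre f j w - pre f (j - 1) w) * G w))"
    by (simp only: avg_add avg_cmult avg_sum)
  also have "(\<Sum>j=1..N. avg words (\<lambda>w. (pre f j w - pre f (j - 1) w) * G w)) =
      (\<Sum>j=1..N. avg words (\<lambda>w. avg V (\<lambda>y. dpre f j w y * dlt G j w y)) / 2)"
    by (rule sum.cong[OF refl *])
  finally show ?thesis by (simp add: sum_divide_distrib)
qed

lemma avg_dpre_sq_le:
  assumes j: "j \<in> {1..N}"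
  shows "avg words (\<lambda>w. avg V (\<lambda>y. (dpre f j w y)\<^sup>2)) \<le> avg words (\<lambda>w. avg V (\<lambda>y. (dlt f j w y)\<^sup>2))"
proof -
  have "avg words (\<lambda>w. avg V (\<lambda>y. (dpre f j w y)\<^sup>2)) \<le>
      avg words (\<lambda>w. avg V (\<lambda>y. avg words (\<lambda>Y. (dlt f j (mix j w Y) y)\<^sup>2)))"
    unfolding dpre_eq_avg[OF j] by (intro avg_mono avg_power2_le finite_words words_nonempty)
  also have "\<dots> = avg words (\<lambda>w. avg words (\<lambda>Y. avg V (\<lambda>y. (dlt f j (mix j w Y) y)\<^sup>2)))"
    by (subst avg_swap) simp
  also have "\<dots> = avg words (\<lambda>w. avg V (\<lambda>y. (dlt f j w y)\<^sup>2))"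
    by (rule avg_mix1[symmetric])
  finally show ?thesis .
qed

text \<open>The covariance identity with \<open>G = f\<close> expresses the variance by products of
  \<open>dpre\<close> and \<open>dlt\<close>. These are at most half the sum of the squares, and by
  Jensen the square of \<open>dpre\<close> is dominated by that of \<open>dlt\<close>.\<close>

lemma efron_stein:
  "avg words (\<lambda>w. (f w - avg words f)\<^sup>2) \<le> (\<Sum>a=1..N. avg words (\<lambda>w. avg V (\<lambda>c. (dlt f a w c)\<^sup>2))) / 2"
proof -
  have "avg words (\<lambda>w. (f w - avg words f)\<^sup>2) = avg words (\<lambda>w. (f w * f w - (2 * avg words f) * f w) + (avg words f)\<^sup>2)"
    by (intro avg_cong refl) (simp add: power2_eq_square algebra_simps)
  also have "\<dots> = avg words (\<lambda>w. f w * f w) - avg words f * avg words f"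
    by (simp only: avg_add avg_diff avg_cmult avgW_const) (simp add: power2_eq_square)
  also have "\<dots> = (\<Sum>j=1..N. avg words (\<lambda>w. avg V (\<lambda>y. dpre f j w y * dlt f j w y))) / 2"
    by (subst stein_identity) simp
  also have "\<dots> \<le> (\<Sum>a=1..N. avg words (\<lambda>w. avg V (\<lambda>c. (dlt f a w c)\<^sup>2))) / 2"
  proof (intro divide_right_mono sum_mono)
    fix j assume j: "j \<in> {1..N}"
    have "avg words (\<lambda>w. avg V (\<lambda>y. dpre f j w y * dlt f j w y)) \<le>
        avg words (\<lambda>w. avg V (\<lambda>y. ((dpre f j w y)\<^sup>2 + (dlt f j w y)\<^sup>2) / 2))"
    proof (intro avg_mono)
      fix w y
      show "dpre f j w y * dlt f j w y \<le> ((dpre f j w y)\<^sup>2 + (dlt f j w y)\<^sup>2) / 2"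
        using sum_squares_bound[of "dpre f j w y" "dlt f j w y"] by simp
    qed
    also have "\<dots> = (avg words (\<lambda>w. avg V (\<lambda>y. (dpre f j w y)\<^sup>2)) + avg words (\<lambda>w. avg V (\<lambda>y. (dlt f j w y)\<^sup>2))) / 2"
      by (simp only: avg_add divide_inverse avg_multc)
    also have "\<dots> \<le> avg words (\<lambda>w. avg V (\<lambda>c. (dlt f j w c)\<^sup>2))"
      using avg_dpre_sq_le[OF j, of f] by simp
    finally show "avg words (\<lambda>w. avg V (\<lambda>y. dpre f j w y * dlt f j w y)) \<le> avg words (\<lambda>w. avg V (\<lambda>c. (dlt f j w c)\<^sup>2))" .
  qed simp
  finally show ?thesis .
qed

end

section \<open>Stein's method for functions of independent letters\<close>

abbreviation Phi :: "real \<Rightarrow> real" where "Phi \<equiv> cdf std_normal_distribution"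
abbreviation phi :: "real \<Rightarrow> real" where "phi \<equiv> std_normal_density"

interpretation std_normal: real_distribution std_normal_distribution
  by (rule real_dist_normal_dist)

section \<open>Normal density, distribution function and Mills ratio\<close>

lemma phi_pos: "phi x > 0"
  by (simp add: normal_density_pos)

lemma phi_deriv: "(phi has_real_derivative - x * phi x) (at x)"
proof -
  define c where "c = 1 / sqrt (2 * pi)"
  have "phi = (\<lambda>x. c * exp (- x\<^sup>2 / 2))"
    by (simp add: fun_eq_iff std_normal_density_def c_def)
  then show ?thesis by (auto intro!: derivative_eq_intros)
qed

lemma continuous_phi: "continuous_on A phi"
  using phi_deriv by (meson DERIV_isCont continuous_at_imp_continuous_on)

lemma measure_std_normal_Ioc:
  assumes "a \<le> b" and F: "\<And>x. a \<le> x \<Longrightarrow> x \<le> b \<Longrightarrow> (F has_real_derivative phi x) (at x within {a..b})"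
  shows "measure std_normal_distribution {a<..b} = F b - F a"
proof -
  have F: "\<And>x. a \<le> x \<Longrightarrow> x \<le> b \<Longrightarrow> (F has_vector_derivative phi x) (at x within {a..b})"
    using F by (simp add: has_real_derivative_iff_has_vector_derivative)
  have int: "has_bochner_integral lborel (\<lambda>x. indicator {a..b} x *\<^sub>R phi x) (F b - F a)"
    by (rule has_bochner_integral_FTC_Icc[OF \<open>a \<le> b\<close> F continuous_phi])
  have "emeasure std_normal_distribution {a<..b} = (\<integral>\<^sup>+x. ennreal (phi x) * indicator {a<..b} x \<partial>lborel)"
    by (simp add: emeasure_density)
  also have "\<dots> = (\<integral>\<^sup>+x. ennreal (indicator {a..b} x *\<^sub>R phi x) \<partial>lborel)"
    by (intro nn_integral_cong_AE eventually_mono[OF AE_lborel_singleton[of a]])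
      (auto split: split_indicator)
  also have "\<dots> = ennreal (F b - F a)"
    using int by (subst nn_integral_eq_integral) (auto simp: has_bochner_integral_iff split: split_indicator)
  finally have e: "emeasure std_normal_distribution {a<..b} = ennreal (F b - F a)" .
  have "0 \<le> F b - F a"
    using int by (metis (no_types, lifting) has_bochner_integral_integral_eq integral_nonneg
        indicator_pos_le normal_density_nonneg real_scaleR_def mult_nonneg_nonneg Bochner_Integration.integral_nonneg)
  then show ?thesis using e by (simp add: measure_def)
qed

lemma Phi_deriv: "(Phi has_real_derivative phi x) (at x)"
proof -
  define F where "F = (\<lambda>u. integral {x - 1..u} phi)"
  have F: "(F has_real_derivative phi t) (at t within {x - 1..x + 1})" if "t \<in> {x - 1..x + 1}" for t
    unfolding F_def by (rule integral_has_real_derivative[OF continuous_phi that])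
  have eq: "Phi u = Phi (x - 1) + (F u - F (x - 1))" if "u \<in> {x - 1<..<x + 1}" for u
  proof -
    have "Phi u - Phi (x - 1) = measure std_normal_distribution {x - 1<..u}"
      using that by (intro std_normal.cdf_diff_eq) auto
    also have "\<dots> = F u - F (x - 1)"
      using that by (intro measure_std_normal_Ioc) (auto intro!: DERIV_subset[OF F])
    finally show ?thesis by simp
  qed
  have "(F has_real_derivative phi x) (at x)"
    using F[of x] by (simp add: at_within_Icc_at)
  then have "((\<lambda>u. Phi (x - 1) + (F u - F (x - 1))) has_real_derivative phi x) (at x)"
    by (auto intro!: derivative_eq_intros)
  then show ?thesis
    by (rule DERIV_cong_ev[THEN iffD1, rotated 3])
      (auto intro!: eventually_nhds_in_open[THEN eventually_mono, of "{x - 1<..<x + 1}"] simp: eq)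
qed

lemma Phi_mono: "x \<le> y \<Longrightarrow> Phi x \<le> Phi y"
  by (rule std_normal.cdf_nondecreasing)

lemma Phi_bounds: "0 \<le> Phi x" "Phi x \<le> 1"
  by (rule std_normal.cdf_nonneg std_normal.cdf_bounded_prob)+

lemma phi_tendsto_0: "(phi \<longlongrightarrow> 0) at_top" "(phi \<longlongrightarrow> 0) at_bot"
  unfolding std_normal_density_def by real_asymp+

text \<open>The difference of the two sides has derivative \<open>- phi x / x^2\<close>, hence
  decreases, and it tends to 0 at infinity.\<close>

lemma mills_upper:
  assumes "w > 0" shows "1 - Phi w \<le> phi w / w"
proof -
  define f where "f = (\<lambda>x. phi x / x - (1 - Phi x))"
  have "f x \<le> f w" if "x \<ge> w" for x
  proof (rule DERIV_nonpos_imp_nonincreasing[OF that])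
    fix u assume u: "w \<le> u" "u \<le> x"
    have "(f has_real_derivative (- u * phi u * u - phi u) / (u * u) - (0 - phi u)) (at u)"
      unfolding f_def using u assms by (auto intro!: derivative_eq_intros phi_deriv Phi_deriv)
    moreover have "(- u * phi u * u - phi u) / (u * u) - (0 - phi u) = - phi u / (u * u)"
      using u assms by (simp add: field_simps)
    ultimately show "\<exists>y. (f has_real_derivative y) (at u) \<and> y \<le> 0"
      using phi_pos[of u] by (intro exI[of _ "- phi u / (u * u)"]) (auto simp: divide_nonpos_pos)
  qed
  then have ev: "\<forall>\<^sub>F x in at_top. f x \<le> f w"
    using eventually_ge_at_top[of w] by (rule eventually_mono[rotated])
  have "((\<lambda>x. phi x * inverse x - (1 - Phi x)) \<longlongrightarrow> 0 * 0 - (1 - 1)) at_top"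
    by (intro tendsto_intros phi_tendsto_0 std_normal.cdf_lim_at_top_prob tendsto_inverse_0_at_top filterlim_ident)
  then have "(f \<longlongrightarrow> 0) at_top"
    by (simp add: f_def divide_inverse)
  then have "0 \<le> f w"
    using ev by (intro tendsto_le[OF _ tendsto_const]) auto
  then show ?thesis by (simp add: f_def)
qed

lemma mills_lower:
  assumes "w < 0" shows "Phi w \<le> phi w / (- w)"
proof -
  define f where "f = (\<lambda>x. phi x / (- x) - Phi x)"
  have "f x \<le> f w" if "x \<le> w" for x
  proof (rule DERIV_nonneg_imp_nondecreasing[OF that])
    fix u assume u: "x \<le> u" "u \<le> w"
    have "(f has_real_derivative (- u * phi u * (- u) + phi u) / ((- u) * (- u)) - phi u) (at u)"
      unfolding f_def using u assms
      by (auto intro!: derivative_eq_intros phi_deriv Phi_deriv simp: field_simps)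
    moreover have "(- u * phi u * (- u) + phi u) / ((- u) * (- u)) - phi u = phi u / (u * u)"
      using u assms by (simp add: field_simps)
    ultimately show "\<exists>y. (f has_real_derivative y) (at u) \<and> 0 \<le> y"
      using phi_pos[of u] by (intro exI[of _ "phi u / (u * u)"]) auto
  qed
  then have ev: "\<forall>\<^sub>F x in at_bot. f x \<le> f w"
    using eventually_le_at_bot[of w] by (rule eventually_mono[rotated])
  have "(inverse \<longlongrightarrow> (0::real)) at_bot" by real_asymp
  then have "((\<lambda>x. phi x * - inverse x - Phi x) \<longlongrightarrow> 0 * - 0 - 0) at_bot"
    by (intro tendsto_intros phi_tendsto_0 std_normal.cdf_lim_at_bot)
  then have "(f \<longlongrightarrow> 0) at_bot"
    by (simp add: f_def divide_inverse)
  then have "0 \<le> f w"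
    using ev by (intro tendsto_le[OF _ tendsto_const]) auto
  then show ?thesis by (simp add: f_def)
qed

text \<open>The classical bounded solution of the Stein equation
  \<open>f' w - w * f w = of_bool (w \<le> z) - Phi z\<close>, with \<open>1 / phi w\<close> for the
  usual \<open>sqrt (2 * pi) * exp (w^2 / 2)\<close>.\<close>

definition stein_sol :: "real \<Rightarrow> real \<Rightarrow> real" where
  "stein_sol z w = (if w \<le> z then Phi w * (1 - Phi z) else Phi z * (1 - Phi w)) / phi w"

lemma stein_sol_nonneg: "0 \<le> stein_sol z w"
  unfolding stein_sol_def using Phi_bounds phi_pos[of w] by (auto intro!: divide_nonneg_pos mult_nonneg_nonneg)

lemma stein_sol_le: "stein_sol z w \<le> Phi w * (1 - Phi w) / phi w"
  unfolding stein_sol_def using Phi_bounds[of z] Phi_bounds[of w] Phi_mono[of w z] Phi_mono[of z w] phi_pos[of w]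
  by (auto intro!: divide_right_mono mult_mono)

text \<open>Outside \<open>[-1, 1]\<close> the Mills ratio gives the bound 1. The 6 comes from the
  middle range, where \<open>1 / phi w\<close> is at most \<open>3 * 2\<close>.\<close>

lemma stein_sol_bounds: "stein_sol z w \<le> 6" "\<bar>w * stein_sol z w\<bar> \<le> 6"
proof -
  consider "w > 1" | "w < -1" | "\<bar>w\<bar> \<le> 1" by linarith
  then have "stein_sol z w \<le> 6 \<and> \<bar>w\<bar> * stein_sol z w \<le> 6"
  proof cases
    case 1
    have "Phi w * (1 - Phi w) \<le> 1 * (phi w / w)"
      using 1 mills_upper[of w] Phi_bounds[of w] by (intro mult_mono) auto
    then have "Phi w * (1 - Phi w) / phi w \<le> (phi w / w) / phi w"
      using phi_pos[of w] by (intro divide_right_mono) auto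
    then have "stein_sol z w \<le> 1 / w"
      using stein_sol_le[of z w] phi_pos[of w] by simp
    then have "stein_sol z w * w \<le> 1" using 1 by (simp add: field_simps)
    moreover have "stein_sol z w \<le> stein_sol z w * w" using 1 stein_sol_nonneg[of z w]
      by (simp add: mult_le_cancel_left1)
    ultimately show ?thesis using 1 by (simp add: mult.commute)
  next
    case 2
    have "Phi w * (1 - Phi w) \<le> (phi w / (-w)) * 1"
      using 2 mills_lower[of w] Phi_bounds[of w] by (intro mult_mono) auto
    then have "Phi w * (1 - Phi w) / phi w \<le> (phi w / (-w)) / phi w"
      using phi_pos[of w] by (intro divide_right_mono) auto
    then have "stein_sol z w \<le> 1 / (-w)"
      using stein_sol_le[of z w] phi_pos[of w] by simp
    then have "stein_sol z w * (-w) \<le> 1" using 2 by (simp add: field_simps)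
    moreover have "stein_sol z w * 1 \<le> stein_sol z w * (-w)" using 2 stein_sol_nonneg[of z w]
      by (intro mult_left_mono) auto
    ultimately show ?thesis using 2 by (simp add: mult.commute)
  next
    case 3
    have "w\<^sup>2 / 2 \<le> 1/2" using 3 by (simp add: abs_square_le_1)
    then have e: "exp (w\<^sup>2 / 2) \<le> 2"
      using exp_bound_half[of "w\<^sup>2/2"] by simp
    have s: "sqrt (2 * pi) \<le> 3"
      using pi_less_4 pi_approx by (intro real_le_lsqrt) auto
    have "stein_sol z w \<le> 1 / phi w"
      using stein_sol_le[of z w] Phi_bounds[of w] phi_pos[of w]
      by (auto intro!: order_trans[OF stein_sol_le] divide_right_mono mult_le_one)
    also have "1 / phi w = sqrt (2 * pi) * exp (w\<^sup>2 / 2)"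
      by (simp add: std_normal_density_def exp_minus field_simps)
    also have "\<dots> \<le> 3 * 2" using e s by (intro mult_mono) auto
    finally have a: "stein_sol z w \<le> 6" by simp
    have "\<bar>w\<bar> * stein_sol z w \<le> 1 * stein_sol z w"
      using 3 stein_sol_nonneg by (intro mult_right_mono) auto
    then show ?thesis using a by simp
  qed
  then show "stein_sol z w \<le> 6" "\<bar>w * stein_sol z w\<bar> \<le> 6"
    using stein_sol_nonneg[of z w] by (auto simp: abs_mult)
qed

text \<open>\<open>stein_sol z\<close> minus an antiderivative of
  \<open>of_bool (w \<le> z) - Phi z\<close>. By Stein's equation the derivative is
  \<open>w * stein_sol z w\<close>, even at the kink \<open>w = z\<close>, so the mean value theorem
  becomes applicable.\<close>

definition stein_smooth :: "real \<Rightarrow> real \<Rightarrow> real" where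
  "stein_smooth z w = stein_sol z w - min w z + Phi z * w"

lemma stein_smooth_deriv: "(stein_smooth z has_real_derivative w * stein_sol z w) (at w)"
proof -
  define g1 where "g1 = (\<lambda>w. Phi w * (1 - Phi z) / phi w - w + Phi z * w)"
  define g2 where "g2 = (\<lambda>w. Phi z * (1 - Phi w) / phi w - z + Phi z * w)"
  have d1: "(g1 has_real_derivative w * (Phi w * (1 - Phi z) / phi w)) (at w)" for w
    unfolding g1_def using phi_pos[of w]
    by (auto intro!: derivative_eq_intros phi_deriv Phi_deriv simp: field_simps power2_eq_square)
  have d2: "(g2 has_real_derivative w * (Phi z * (1 - Phi w) / phi w)) (at w)" for w
    unfolding g2_def using phi_pos[of w]
    by (auto intro!: derivative_eq_intros phi_deriv Phi_deriv simp: field_simps power2_eq_square)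
  have e1: "stein_smooth z w = g1 w" if "w \<le> z" for w
    using that by (simp add: stein_smooth_def stein_sol_def g1_def min_def)
  have e2: "stein_smooth z w = g2 w" if "w \<ge> z" for w
    using that by (cases "w = z") (auto simp: stein_smooth_def stein_sol_def g2_def min_def mult.commute)
  consider "w < z" | "w > z" | "w = z" by linarith
  then show ?thesis
  proof cases
    case 1
    then have "\<forall>\<^sub>F x in nhds w. g1 x = stein_smooth z x"
      by (intro eventually_nhds_in_open[THEN eventually_mono, of "{..<z}"]) (auto simp: e1)
    then show ?thesis using d1[of w] 1 by (simp add: DERIV_cong_ev stein_sol_def)
  next
    case 2
    then have "\<forall>\<^sub>F x in nhds w. g2 x = stein_smooth z x"
      by (intro eventually_nhds_in_open[THEN eventually_mono, of "{z<..}"]) (auto simp: e2)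
    then show ?thesis using d2[of w] 2 by (simp add: DERIV_cong_ev stein_sol_def)
  next
    case 3
    let ?D = "w * stein_sol z w"
    have l: "(stein_smooth z has_real_derivative ?D) (at w within {..w})"
      by (rule has_field_derivative_transform_within[where f = g1 and d = 1, OF DERIV_subset])
        (use 3 d1[of w] in \<open>auto simp: e1 stein_sol_def\<close>)
    have r: "(stein_smooth z has_real_derivative ?D) (at w within {w..})"
      by (rule has_field_derivative_transform_within[where f = g2 and d = 1, OF DERIV_subset])
        (use 3 d2[of w] in \<open>auto simp: e2 stein_sol_def algebra_simps\<close>)
    have "at w = sup (at w within {..w}) (at w within {w..})"
      by (subst at_within_union[symmetric]) (auto intro: arg_cong[where f = "at_within w"])
    then show ?thesis
      using l r unfolding has_field_derivative_iff by (simp add: filterlim_sup)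
  qed
qed

lemma stein_smooth_mvt:
  "\<exists>\<xi>. \<bar>\<xi> - w\<bar> \<le> \<bar>x - w\<bar> \<and> stein_smooth z w - stein_smooth z x = (w - x) * (\<xi> * stein_sol z \<xi>)"
proof -
  consider "x < w" | "w < x" | "x = w" by linarith
  then show ?thesis
  proof cases
    case 1
    from MVT2[OF 1, of "stein_smooth z" "\<lambda>\<xi>. \<xi> * stein_sol z \<xi>"] obtain \<xi> where
      "x < \<xi>" "\<xi> < w" "stein_smooth z w - stein_smooth z x = (w - x) * (\<xi> * stein_sol z \<xi>)"
      using stein_smooth_deriv by blast
    then show ?thesis by (intro exI[of _ \<xi>]) auto
  next
    case 2
    from MVT2[OF 2, of "stein_smooth z" "\<lambda>\<xi>. \<xi> * stein_sol z \<xi>"] obtain \<xi> where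
      "w < \<xi>" "\<xi> < x" "stein_smooth z x - stein_smooth z w = (x - w) * (\<xi> * stein_sol z \<xi>)"
      using stein_smooth_deriv by blast
    then show ?thesis by (intro exI[of _ \<xi>]) (auto simp: algebra_simps)
  qed auto
qed

text \<open>The slope 7 is 6 for the smooth part plus 1 for the piecewise linear part.\<close>

lemma stein_sol_lipschitz: "\<bar>stein_sol z w - stein_sol z x\<bar> \<le> 7 * \<bar>w - x\<bar>"
proof -
  obtain \<xi> where \<xi>: "stein_smooth z w - stein_smooth z x = (w - x) * (\<xi> * stein_sol z \<xi>)"
    using stein_smooth_mvt by blast
  have "\<bar>stein_smooth z w - stein_smooth z x\<bar> \<le> \<bar>w - x\<bar> * 6"
    unfolding \<xi> abs_mult[of "w - x"] by (intro mult_left_mono stein_sol_bounds) auto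
  moreover have "\<bar>(min w z - min x z) - Phi z * (w - x)\<bar> \<le> \<bar>w - x\<bar>"
  proof -
    have mono: "\<bar>(min w z - min x z) - Phi z * (w - x)\<bar> \<le> w - x" if "x \<le> w" for w x
    proof -
      define q where "q = Phi z * (w - x)"
      have "0 \<le> q" "q \<le> 1 * (w - x)"
        unfolding q_def using that Phi_bounds[of z] by (intro mult_right_mono mult_nonneg_nonneg; simp)+
      then show ?thesis unfolding q_def[symmetric] using that by (auto simp: min_def)
    qed
    show ?thesis
      using mono[of x w] mono[of w x] by (cases "x \<le> w") (auto simp: abs_if algebra_simps split: if_splits)
  qed
  moreover have "stein_sol z w - stein_sol z x = (stein_smooth z w - stein_smooth z x) +
      ((min w z - min x z) - Phi z * (w - x))"
    unfolding stein_smooth_def by (simp add: algebra_simps)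
  ultimately show ?thesis
    using abs_triangle_ineq[of "stein_smooth z w - stein_smooth z x" "(min w z - min x z) - Phi z * (w - x)"]
    by simp
qed

text \<open>The derivative of \<open>stein_sol z\<close> at \<open>w\<close>, with the value that makes Stein's equation hold at \<open>w = z\<close>.\<close>

definition stein_der :: "real \<Rightarrow> real \<Rightarrow> real" where
  "stein_der z w = w * stein_sol z w + of_bool (w \<le> z) - Phi z"

lemma stein_der_bound: "\<bar>stein_der z w\<bar> \<le> 7"
  unfolding stein_der_def using stein_sol_bounds(2)[of w z] Phi_bounds[of z] by (auto simp: abs_if split: if_splits)

text \<open>The second error term is not small, but it is monotone in the right way: its bound is
  antisymmetric under exchanging \<open>w\<close> and \<open>x\<close>, so that it becomes a centred quantity
  after averaging over an exchangeable pair.\<close>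

lemma stein_sol_expand:
  obtains e1 e2 where
    "stein_sol z w - stein_sol z x = (w - x) * stein_der z w + e1 + e2"
    "\<bar>e1\<bar> \<le> (6 + 7 * \<bar>w\<bar>) * (w - x)\<^sup>2"
    "0 \<le> e2" "e2 \<le> (w - x) * (of_bool (x \<le> z) - of_bool (w \<le> z))"
proof -
  obtain \<xi> where \<xi>: "\<bar>\<xi> - w\<bar> \<le> \<bar>x - w\<bar>"
    "stein_smooth z w - stein_smooth z x = (w - x) * (\<xi> * stein_sol z \<xi>)"
    using stein_smooth_mvt by blast
  \<comment> \<open>\<open>e1\<close> stems from the variation of the derivative of the smooth part,
    \<open>e2\<close> from the kink of \<open>min w z\<close>; \<open>e2\<close> vanishes unless
    \<open>z\<close> separates \<open>w\<close> and \<open>x\<close>.\<close>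
  define e1 where "e1 = (w - x) * (\<xi> * stein_sol z \<xi> - w * stein_sol z w)"
  define e2 where "e2 = (min w z - min x z) - (w - x) * of_bool (w \<le> z)"
  have "stein_sol z w - stein_sol z x = (w - x) * stein_der z w + e1 + e2"
    using \<xi>(2) unfolding e1_def e2_def stein_der_def stein_smooth_def by (simp add: algebra_simps)
  moreover have "\<bar>e1\<bar> \<le> (6 + 7 * \<bar>w\<bar>) * (w - x)\<^sup>2"
  proof -
    have "\<xi> * stein_sol z \<xi> - w * stein_sol z w =
        (\<xi> - w) * stein_sol z \<xi> + w * (stein_sol z \<xi> - stein_sol z w)"
      by (simp add: algebra_simps)
    also have "\<bar>\<dots>\<bar> \<le> \<bar>\<xi> - w\<bar> * 6 + \<bar>w\<bar> * (7 * \<bar>\<xi> - w\<bar>)"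
      using stein_sol_bounds(1)[of z \<xi>] stein_sol_nonneg[of z \<xi>] stein_sol_lipschitz[of z \<xi> w]
      by (intro order_trans[OF abs_triangle_ineq] add_mono) (auto simp: abs_mult intro!: mult_left_mono)
    also have "\<dots> \<le> (6 + 7 * \<bar>w\<bar>) * \<bar>x - w\<bar>"
      using \<xi>(1) mult_left_mono[OF \<xi>(1), of "6 + 7 * \<bar>w\<bar>"] by (simp add: algebra_simps)
    finally have "\<bar>e1\<bar> \<le> \<bar>w - x\<bar> * ((6 + 7 * \<bar>w\<bar>) * \<bar>x - w\<bar>)"
      unfolding e1_def abs_mult[of "w - x"] by (intro mult_left_mono) auto
    also have "\<dots> = (6 + 7 * \<bar>w\<bar>) * (w - x)\<^sup>2"
      by (simp only: power2_eq_square abs_minus_commute[of x w] mult.left_commute abs_mult_self_eq)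
    finally show ?thesis .
  qed
  moreover have "0 \<le> e2" "e2 \<le> (w - x) * (of_bool (x \<le> z) - of_bool (w \<le> z))"
    unfolding e2_def by (auto simp: min_def)
  ultimately show ?thesis by (rule that)
qed

section \<open>Normal approximation through two quadratic terms\<close>

context word_space
begin

text \<open>Its mean is twice the variance of \<open>f\<close>. For standardised \<open>f\<close>,
  the concentration of \<open>qvar f / 2\<close> at 1 is what yields normality.\<close>

definition qvar :: "((nat \<Rightarrow> 'a) \<Rightarrow> real) \<Rightarrow> (nat \<Rightarrow> 'a) \<Rightarrow> real" where
  "qvar f w = (\<Sum>j=1..N. avg V (\<lambda>y. dpre f j w y * dlt f j w y))"

text \<open>Collects the bounds for the kink terms; exchanging letters changes the sign of each
  summand, so it is centred.\<close>

definition qvar_abs :: "((nat \<Rightarrow> 'a) \<Rightarrow> real) \<Rightarrow> (nat \<Rightarrow> 'a) \<Rightarrow> real" where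
  "qvar_abs f w = (\<Sum>j=1..N. avg V (\<lambda>y. \<bar>dpre f j w y\<bar> * dlt f j w y))"

lemma avg_qvar: "avg words (qvar f) = 2 * (avg words (\<lambda>w. f w * f w) - avg words f * avg words f)"
  unfolding qvar_def by (subst stein_identity) (simp add: avg_sum)

lemma avg_antisym:
  assumes "j \<in> {1..N}"
  shows "avg words (\<lambda>w. avg V (\<lambda>y. \<bar>dpre f j w y\<bar> * dlt f j w y * h (w(j := y)))) =
    - avg words (\<lambda>w. avg V (\<lambda>y. \<bar>dpre f j w y\<bar> * dlt f j w y * h w))"
  by (subst avg_resample[OF assms])
    (simp add: dpre_def dlt_def abs_minus_commute algebra_simps flip: avg_minus)

lemma avg_qvar_abs: "avg words (qvar_abs f) = 0"
proof -
  have "avg words (\<lambda>w. avg V (\<lambda>y. \<bar>dpre f j w y\<bar> * dlt f j w y)) = 0" if "j \<in> {1..N}" for j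
    using avg_antisym[OF that, of f "\<lambda>_. 1"] by simp
  then show ?thesis unfolding qvar_abs_def avg_sum by simp
qed

lemma dpre_bound:
  assumes "j \<in> {1..N}" "w \<in> words" "y \<in> V"
    and "\<And>w. w \<in> words \<Longrightarrow> \<bar>dlt f j w y\<bar> \<le> A"
  shows "\<bar>dpre f j w y\<bar> \<le> A"
  unfolding dpre_eq_avg[OF assms(1)] using assms
  by (intro order_trans[OF avg_abs_le] avg_le_const finite_words words_nonempty) (auto simp: mix_words)

text \<open>The covariance identity is applied to \<open>G = stein_sol z\<close> composed with
  \<open>f\<close>, and each \<open>dlt G\<close> is expanded. The linear part gives
  \<open>1 - qvar f / 2\<close> times a bounded derivative, \<open>e1\<close> gives the cubic term,
  and the antisymmetric bound for \<open>e2\<close> collapses to the average of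
  \<open>- 2 * qvar_abs f w * h w\<close>.\<close>

theorem normal_approximation:
  assumes A: "\<And>j w y. j \<in> {1..N} \<Longrightarrow> w \<in> words \<Longrightarrow> y \<in> V \<Longrightarrow> \<bar>dlt f j w y\<bar> \<le> A"
  shows "\<bar>avg words (\<lambda>w. of_bool (f w \<le> z)) - Phi z\<bar> \<le>
    6 * \<bar>avg words f\<bar> + 7 * avg words (\<lambda>w. \<bar>1 - qvar f w / 2\<bar>) + avg words (\<lambda>w. \<bar>qvar_abs f w\<bar>) +
    real N * A ^ 3 * (6 + 7 * avg words (\<lambda>w. \<bar>f w\<bar>))"
proof -
  define G where "G = (\<lambda>w. stein_sol z (f w))"
  define D where "D = (\<lambda>w. stein_der z (f w))"
  define h where "h = (\<lambda>w. of_bool (f w \<le> z) :: real)"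
  define r where "r = (\<lambda>j w y. dpre f j w y * (dlt G j w y - dlt f j w y * D w))"
  have eq1: "avg words (\<lambda>w. of_bool (f w \<le> z)) - Phi z = avg words (\<lambda>w. D w - f w * G w)"
  proof -
    have "avg words (\<lambda>w. D w - f w * G w) = avg words (\<lambda>w. of_bool (f w \<le> z) - Phi z)"
      unfolding D_def G_def stein_der_def by (intro avg_cong) auto
    then show ?thesis by (simp add: avg_diff avgW_const)
  qed
  have "(\<Sum>j=1..N. avg words (\<lambda>w. avg V (\<lambda>y. dpre f j w y * dlt G j w y))) =
      (\<Sum>j=1..N. avg words (\<lambda>w. avg V (\<lambda>y. dpre f j w y * dlt f j w y) * D w) +
        avg words (\<lambda>w. avg V (\<lambda>y. r j w y)))"
    unfolding r_def avg_add[symmetric] avg_multc[symmetric]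
    by (intro sum.cong refl avg_cong) (auto simp: algebra_simps)
  also have "\<dots> = avg words (\<lambda>w. qvar f w * D w) + (\<Sum>j=1..N. avg words (\<lambda>w. avg V (\<lambda>y. r j w y)))"
    unfolding qvar_def sum_distrib_right avg_sum sum.distrib ..
  finally have eq2: "avg words (\<lambda>w. D w - f w * G w) =
      avg words (\<lambda>w. (1 - qvar f w / 2) * D w) - avg words f * avg words G
      - (\<Sum>j=1..N. avg words (\<lambda>w. avg V (\<lambda>y. r j w y))) / 2"
    by (simp add: avg_diff stein_identity left_diff_distrib add_divide_distrib
        avg_multc[of _ _ "inverse 2", folded divide_inverse])
  have b1: "\<bar>avg words (\<lambda>w. (1 - qvar f w / 2) * D w)\<bar> \<le> 7 * avg words (\<lambda>w. \<bar>1 - qvar f w / 2\<bar>)"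
    unfolding avg_cmult[symmetric] D_def
    by (intro avg_abs_mono) (use stein_der_bound[of z] in \<open>auto simp: abs_mult mult.commute[of 7] intro!: mult_left_mono\<close>)
  have "\<bar>avg words G\<bar> \<le> 6"
    unfolding G_def using stein_sol_bounds(1)[of z] stein_sol_nonneg[of z]
    by (intro order_trans[OF avg_abs_le] avg_le_const finite_words words_nonempty) auto
  then have b2: "\<bar>avg words f * avg words G\<bar> \<le> 6 * \<bar>avg words f\<bar>"
    by (simp add: abs_mult mult.commute[of 6] mult_left_mono)
  have b3: "\<bar>avg words (\<lambda>w. avg V (\<lambda>y. r j w y))\<bar> \<le>
      A ^ 3 * (6 + 7 * avg words (\<lambda>w. \<bar>f w\<bar>)) - 2 * avg words (\<lambda>w. avg V (\<lambda>y. \<bar>dpre f j w y\<bar> * dlt f j w y) * h w)"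
    if j: "j \<in> {1..N}" for j
  proof -
    have "\<bar>r j w y\<bar> \<le> A ^ 3 * (6 + 7 * \<bar>f w\<bar>) + \<bar>dpre f j w y\<bar> * dlt f j w y * (h (w(j := y)) - h w)"
      if w: "w \<in> words" and y: "y \<in> V" for w y
    proof -
      obtain e1 e2 where e: "dlt G j w y = dlt f j w y * D w + e1 + e2"
        "\<bar>e1\<bar> \<le> (6 + 7 * \<bar>f w\<bar>) * (dlt f j w y)\<^sup>2"
        "0 \<le> e2" "e2 \<le> dlt f j w y * (h (w(j := y)) - h w)"
        unfolding dlt_def G_def D_def h_def by (rule stein_sol_expand)
      have A0: "0 \<le> A" using A[OF j w y] by linarith
      have d: "\<bar>dpre f j w y\<bar> \<le> A" using dpre_bound[OF j w y] A[OF j _ y] by blast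
      have "\<bar>e1\<bar> \<le> (6 + 7 * \<bar>f w\<bar>) * A\<^sup>2"
        using e(2) A[OF j w y] by (elim order_trans) (auto intro!: mult_left_mono abs_le_square_iff[THEN iffD1])
      then have "\<bar>dpre f j w y\<bar> * \<bar>e1\<bar> \<le> A * ((6 + 7 * \<bar>f w\<bar>) * A\<^sup>2)"
        using d A0 by (intro mult_mono) auto
      moreover have "\<bar>dpre f j w y\<bar> * \<bar>e2\<bar> \<le> \<bar>dpre f j w y\<bar> * (dlt f j w y * (h (w(j := y)) - h w))"
        using e(3,4) by (intro mult_left_mono) auto
      moreover have "\<bar>r j w y\<bar> \<le> \<bar>dpre f j w y\<bar> * \<bar>e1\<bar> + \<bar>dpre f j w y\<bar> * \<bar>e2\<bar>"
        unfolding r_def e(1) abs_mult distrib_left[symmetric] by (intro mult_left_mono) auto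
      ultimately show ?thesis
        by (simp add: algebra_simps power3_eq_cube power2_eq_square)
    qed
    then have "\<bar>avg words (\<lambda>w. avg V (\<lambda>y. r j w y))\<bar> \<le>
        avg words (\<lambda>w. avg V (\<lambda>y. A ^ 3 * (6 + 7 * \<bar>f w\<bar>) + \<bar>dpre f j w y\<bar> * dlt f j w y * (h (w(j := y)) - h w)))"
      by (intro avg_abs_mono) auto
    also have "\<dots> = A ^ 3 * (6 + 7 * avg words (\<lambda>w. \<bar>f w\<bar>)) +
        (avg words (\<lambda>w. avg V (\<lambda>y. \<bar>dpre f j w y\<bar> * dlt f j w y * h (w(j := y)))) -
        avg words (\<lambda>w. avg V (\<lambda>y. \<bar>dpre f j w y\<bar> * dlt f j w y * h w)))"
      by (simp add: right_diff_distrib avg_add avg_diff avgV_const avgW_const avg_cmult)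
    also have "\<dots> = A ^ 3 * (6 + 7 * avg words (\<lambda>w. \<bar>f w\<bar>)) -
        2 * avg words (\<lambda>w. avg V (\<lambda>y. \<bar>dpre f j w y\<bar> * dlt f j w y) * h w)"
      unfolding avg_antisym[OF j] by (simp add: avg_multc)
    finally show ?thesis .
  qed
  have "\<bar>\<Sum>j=1..N. avg words (\<lambda>w. avg V (\<lambda>y. r j w y))\<bar> \<le>
      (\<Sum>j=1..N. A ^ 3 * (6 + 7 * avg words (\<lambda>w. \<bar>f w\<bar>)) -
        2 * avg words (\<lambda>w. avg V (\<lambda>y. \<bar>dpre f j w y\<bar> * dlt f j w y) * h w))"
    by (intro order_trans[OF sum_abs] sum_mono b3)
  also have "\<dots> = real N * A ^ 3 * (6 + 7 * avg words (\<lambda>w. \<bar>f w\<bar>)) - 2 * avg words (\<lambda>w. qvar_abs f w * h w)"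
    unfolding qvar_abs_def sum_distrib_right avg_sum sum_subtractf sum_distrib_left[symmetric] by simp
  finally have b4: "\<bar>\<Sum>j=1..N. avg words (\<lambda>w. avg V (\<lambda>y. r j w y))\<bar> \<le>
      real N * A ^ 3 * (6 + 7 * avg words (\<lambda>w. \<bar>f w\<bar>)) - 2 * avg words (\<lambda>w. qvar_abs f w * h w)" .
  have b5: "\<bar>avg words (\<lambda>w. qvar_abs f w * h w)\<bar> \<le> avg words (\<lambda>w. \<bar>qvar_abs f w\<bar>)"
    by (intro avg_abs_mono) (auto simp: abs_mult h_def)
  have b6: "0 \<le> real N * A ^ 3 * (6 + 7 * avg words (\<lambda>w. \<bar>f w\<bar>))"
  proof (cases "N = 0")
    case False
    obtain w where "w \<in> words" using words_nonempty by auto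
    then have "0 \<le> A" using A[of 1 w d] False d_V by simp
    then show ?thesis by (intro mult_nonneg_nonneg add_nonneg_nonneg avg_nonneg) auto
  qed simp
  show ?thesis
    unfolding eq1 eq2 using b1 b2 b4 b5 b6 abs_ge_zero[of "\<Sum>j=1..N. avg words (\<lambda>w. avg V (\<lambda>y. r j w y))"]
    by (simp add: abs_le_iff field_simps) linarith
qed

end

section \<open>Trees as parent functions\<close>

text \<open>Parent functions orient a graph: fixed points are roots or lie outside, and every other
  vertex contributes one edge.\<close>

definition edges :: "(nat \<Rightarrow> nat) \<Rightarrow> graph" where
  "edges g = {{v, g v} | v. g v \<noteq> v}"

text \<open>Spanning forests of \<open>V\<close> oriented towards the root set \<open>S\<close>;
  being the identity outside \<open>V\<close> makes the encoding unique. Trees are the case of a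
  single root.\<close>

definition forest :: "nat set \<Rightarrow> nat set \<Rightarrow> (nat \<Rightarrow> nat) set" where
  "forest V S = {g. (\<forall>v\<in>V. g v \<in> V) \<and> (\<forall>v. v \<notin> V \<longrightarrow> g v = v) \<and> (\<forall>s\<in>S. g s = s) \<and>
     (\<forall>v\<in>V. \<exists>k. (g ^^ k) v \<in> S)}"

definition depth :: "(nat \<Rightarrow> nat) \<Rightarrow> nat set \<Rightarrow> nat \<Rightarrow> nat" where
  "depth g S v = (LEAST k. (g ^^ k) v \<in> S)"

lemma edges_iff: "{u, v} \<in> edges g \<longleftrightarrow> u \<noteq> v \<and> (g u = v \<or> g v = u)"
  unfolding edges_def by (auto simp: doubleton_eq_iff)

lemma forest_rank:
  assumes g: "g \<in> forest V S" and v: "v \<in> V" "v \<notin> S"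
  shows "depth g S (g v) < depth g S v" "g v \<noteq> v"
proof -
  obtain k where k: "(g ^^ k) v \<in> S" using g v by (auto simp: forest_def)
  have *: "(g ^^ depth g S v) v \<in> S"
    unfolding depth_def by (rule LeastI[of _ k]) (rule k)
  then have "depth g S v \<noteq> 0" using v by (intro notI) auto
  then obtain m where m: "depth g S v = Suc m" by (cases "depth g S v") auto
  then have "(g ^^ m) (g v) \<in> S" using * by (simp add: funpow_swap1)
  then have "depth g S (g v) \<le> m" unfolding depth_def by (rule Least_le)
  then show "depth g S (g v) < depth g S v" using m by simp
  then show "g v \<noteq> v" by auto
qed

text \<open>A natural number that drops along parents rules out cycles. The surgeries on parent
  functions below are justified by exhibiting such a rank.\<close>

lemma forestI_rank:
  fixes rk :: "nat \<Rightarrow> nat"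
  assumes "S \<subseteq> V" "\<And>s. s \<in> S \<Longrightarrow> g s = s" "\<And>v. v \<notin> V \<Longrightarrow> g v = v"
    and rk: "\<And>v. v \<in> V \<Longrightarrow> v \<notin> S \<Longrightarrow> g v \<in> V \<and> rk (g v) < rk v"
  shows "g \<in> forest V S"
proof -
  have "\<exists>k. (g ^^ k) v \<in> S" if "v \<in> V" for v
    using that
  proof (induction "rk v" arbitrary: v rule: less_induct)
    case less
    show ?case
    proof (cases "v \<in> S")
      case True then show ?thesis by (intro exI[of _ 0]) auto
    next
      case False
      then obtain k where "(g ^^ k) (g v) \<in> S" using less rk by blast
      then show ?thesis by (intro exI[of _ "Suc k"]) (simp add: funpow_swap1)
    qed
  qed
  moreover have "g v \<in> V" if "v \<in> V" for v
    using that rk[of v] assms(1,2) by (cases "v \<in> S") auto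
  ultimately show ?thesis using assms by (auto simp: forest_def)
qed

text \<open>Ensures that an edge \<open>{v, g v}\<close> is contributed by one vertex only, so that
  deleting it removes exactly one parent.\<close>

lemma forest_no_2cycle:
  assumes "g \<in> forest V S" "v \<in> V" "v \<notin> S" shows "g (g v) \<noteq> v"
proof
  assume eq: "g (g v) = v"
  have "g v \<notin> S" using assms eq forest_rank(2)[OF assms] by (auto simp: forest_def)
  moreover have "g v \<in> V" using assms by (auto simp: forest_def)
  ultimately have "depth g S (g (g v)) < depth g S (g v)" using assms forest_rank(1) by blast
  then show False using forest_rank(1)[OF assms] eq by simp
qed

text \<open>Existence of a walk with at most \<open>r\<close> edges. Unlike \<open>tree_dist\<close>
  it makes sense in every graph and is monotone in the graph, as needed for subgraphs shared by
  several trees.\<close>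

primrec near :: "graph \<Rightarrow> nat \<Rightarrow> nat \<Rightarrow> nat \<Rightarrow> bool" where
  "near T 0 u v \<longleftrightarrow> u = v"
| "near T (Suc r) u v \<longleftrightarrow> near T r u v \<or> (\<exists>x. {u, x} \<in> T \<and> near T r x v)"

lemma near_refl: "near T r u u"
  by (induction r) auto

lemma near_mono: "near T r u v \<Longrightarrow> r \<le> s \<Longrightarrow> near T s u v"
  by (induction s) (auto simp: le_Suc_eq)

lemma near_mono_graph: "near T r u v \<Longrightarrow> T \<subseteq> T' \<Longrightarrow> near T' r u v"
  by (induction r arbitrary: u) auto

lemma near_trans: "near T r u v \<Longrightarrow> near T s v w \<Longrightarrow> near T (r + s) u w"
proof (induction r arbitrary: u)
  case (Suc r)
  then show ?case by (auto intro: near_mono[of _ "r + s"])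
qed simp

lemma near_edge: "{u, v} \<in> T \<Longrightarrow> near T (Suc 0) u v"
  by auto

lemma near_sym: "near T r u v \<Longrightarrow> near T r v u"
proof (induction r arbitrary: u)
  case (Suc r)
  from Suc.prems consider "near T r u v" | x where "{u, x} \<in> T" "near T r x v" by auto
  then show ?case
  proof cases
    case 1 then show ?thesis using Suc.IH by auto
  next
    case 2
    then have "near T r v x" "near T (Suc 0) x u" using Suc.IH by (auto simp: insert_commute)
    then show ?thesis using near_trans by fastforce
  qed
qed simp

text \<open>Each edge of the walk leads to the parent or to a child, so \<open>r\<close>
  applications of \<open>g\<close> undo any walk into a root and then stay there. Balls around a
  root thus become statements about iterates.\<close>

lemma near_forest:
  assumes "near (edges g) r u v" "g v = v" shows "(g ^^ r) u = v"
  using assms(1)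
proof (induction r arbitrary: u)
  case (Suc r)
  have fix_v: "(g ^^ k) v = v" for k using assms(2) by (induction k) auto
  from Suc.prems consider "near (edges g) r u v" | x where "{u, x} \<in> edges g" "near (edges g) r x v" by auto
  then show ?case
  proof cases
    case 1 then show ?thesis using Suc.IH assms(2) by simp
  next
    case 2
    then have x: "(g ^^ r) x = v" using Suc.IH by blast
    from 2 consider "g u = x" | "g x = u" by (auto simp: edges_iff)
    then show ?thesis
    proof cases
      case 1 then show ?thesis using x by (simp add: funpow_swap1)
    next
      case 2
      have "(g ^^ Suc r) u = (g ^^ Suc (Suc r)) x" using 2 by (simp add: funpow_swap1)
      also have "\<dots> = v" using x assms(2) by simp
      finally show ?thesis .
    qed
  qed
qed auto

lemma forest_near_root:
  assumes "(g ^^ k) v = r" shows "near (edges g) k v r"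
  using assms
proof (induction k arbitrary: v)
  case (Suc k)
  then have "near (edges g) k (g v) r" by (simp add: funpow_swap1)
  moreover have "{v, g v} \<in> edges g" if "g v \<noteq> v" using that by (auto simp: edges_iff)
  ultimately show ?case by (cases "g v = v") auto
qed auto

lemma near_path: "near T k u v \<Longrightarrow> \<exists>p. is_path T u v p"
proof (induction k arbitrary: u)
  case 0 then show ?case by (intro exI[of _ "[u]"]) (auto simp: is_path_def)
next
  case (Suc k)
  from Suc.prems consider "near T k u v" | x where "{u, x} \<in> T" "near T k x v" by auto
  then show ?case
  proof cases
    case 2
    then obtain p where p: "is_path T x v p" using Suc.IH by blast
    show ?thesis
    proof (cases "u \<in> set p")
      case True
      then obtain p1 p2 where "p = p1 @ u # p2" by (auto simp: in_set_conv_decomp)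
      then have "is_path T u v (u # p2)"
        using p by (auto simp: is_path_def successively_append_iff)
      then show ?thesis by blast
    next
      case False
      then have "is_path T u v (u # p)"
        using p 2 by (cases p) (auto simp: is_path_def)
      then show ?thesis by blast
    qed
  qed (use Suc.IH in blast)
qed

lemma path_near: "is_path T u v p \<Longrightarrow> near T (length p - 1) u v"
proof (induction p arbitrary: u)
  case (Cons a p)
  show ?case
  proof (cases p)
    case Nil then show ?thesis using Cons.prems by (auto simp: is_path_def)
  next
    case (Cons b q)
    then have "is_path T b v p" "{u, b} \<in> T" using Cons.prems by (auto simp: is_path_def)
    then have "near T (length p - 1) b v" using Cons.IH by blast
    then have "near T (Suc (length p - 1)) u v" using \<open>{u, b} \<in> T\<close> by auto
    then show ?thesis using Cons by simp
  qed
qed (auto simp: is_path_def)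

section \<open>Trees are the graphs of parent functions with one root\<close>

lemma cycle_edge:
  assumes "is_cycle G p" "i < length p"
  shows "{p ! i, p ! (Suc i mod length p)} \<in> G"
proof (cases "Suc i = length p")
  case True
  then have "p \<noteq> []" by auto
  then have "p ! i = last p" "p ! (Suc i mod length p) = hd p"
    using True by (simp_all add: last_conv_nth hd_conv_nth flip: True)
  then show ?thesis using assms by (auto simp: is_cycle_def)
next
  case False
  then show ?thesis using assms by (auto simp: is_cycle_def successively_conv_nth)
qed

text \<open>A deepest vertex of a cycle has no child on it, so both of its distinct neighbours on
  the cycle would have to be its parent.\<close>

lemma forest_no_cycle:
  assumes g: "g \<in> forest V S"
  shows "\<not> is_cycle (edges g) p"
proof
  assume p: "is_cycle (edges g) p"
  let ?n = "length p"
  have n: "?n \<ge> 3" "distinct p" using p by (auto simp: is_cycle_def)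
  have "Max ((\<lambda>i. depth g S (p ! i)) ` {..<?n}) \<in> (\<lambda>i. depth g S (p ! i)) ` {..<?n}"
    using n by (intro Max_in) (auto simp: lessThan_empty_iff)
  then obtain m where m: "m < ?n" and "depth g S (p ! m) = Max ((\<lambda>i. depth g S (p ! i)) ` {..<?n})"
    by auto
  then have mmax: "\<And>i. i < ?n \<Longrightarrow> depth g S (p ! i) \<le> depth g S (p ! m)" by simp
  have par: "g (p ! m) = p ! i" if "{p ! m, p ! i} \<in> edges g" "i < ?n" for i
  proof (rule ccontr)
    assume *: "g (p ! m) \<noteq> p ! i"
    then have gi: "g (p ! i) = p ! m" "p ! i \<noteq> p ! m" using that by (auto simp: edges_iff)
    then have "p ! i \<in> V" "p ! i \<notin> S" using g by (auto simp: forest_def)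
    then show False using forest_rank(1)[OF g, of "p ! i"] mmax[OF that(2)] gi by simp
  qed
  define i1 where "i1 = Suc m mod ?n"
  define i2 where "i2 = (if m = 0 then ?n - 1 else m - 1)"
  have i: "i1 < ?n" "i2 < ?n" "i1 \<noteq> i2" "Suc i2 mod ?n = m"
    using n m unfolding i1_def i2_def by (auto simp: mod_Suc)
  have "g (p ! m) = p ! i1" using cycle_edge[OF p m] i by (intro par) (auto simp: i1_def)
  moreover have "g (p ! m) = p ! i2" using cycle_edge[OF p i(2)] i by (intro par) (auto simp: insert_commute)
  ultimately show False using i n by (simp add: nth_eq_iff_index_eq)
qed

lemma forest_depth_root:
  assumes "g \<in> forest V {r}" "v \<in> V" obtains k where "(g ^^ k) v = r"
  using assms by (auto simp: forest_def)

lemma edges_in_trees: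
  assumes g: "g \<in> forest {1..n} {r}"
  shows "edges g \<in> trees n"
proof -
  have "e \<in> {{u, v} | u v. u \<in> {1..n} \<and> v \<in> {1..n} \<and> u \<noteq> v}" if e: "e \<in> edges g" for e
  proof -
    obtain v where v: "e = {v, g v}" "g v \<noteq> v" using e by (auto simp: edges_def)
    then have "v \<in> {1..n}" "g v \<in> {1..n}" using g unfolding forest_def by blast+
    then show ?thesis using v by blast
  qed
  then have "edges g \<in> graphs_on n" unfolding graphs_on_def by blast
  moreover have "\<exists>p. is_path (edges g) u v p" if uv: "u \<in> {1..n}" "v \<in> {1..n}" for u v
  proof -
    obtain k where "(g ^^ k) u = r" using forest_depth_root[OF g uv(1)] by blast
    moreover obtain l where "(g ^^ l) v = r" using forest_depth_root[OF g uv(2)] by blast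
    ultimately have "near (edges g) (k + l) u v"
      by (intro near_trans[of _ k u r] forest_near_root near_sym[OF forest_near_root])
    then show ?thesis by (rule near_path)
  qed
  ultimately show ?thesis using forest_no_cycle[OF g] unfolding trees_def by blast
qed

lemma trees_edge_in: "T \<in> trees n \<Longrightarrow> {u, v} \<in> T \<Longrightarrow> u \<in> {1..n} \<and> v \<in> {1..n} \<and> u \<noteq> v"
proof -
  assume "T \<in> trees n" "{u, v} \<in> T"
  then have "{u, v} \<in> {{u, v} | u v. u \<in> {1..n} \<and> v \<in> {1..n} \<and> u \<noteq> v}"
    unfolding trees_def graphs_on_def by blast
  then show ?thesis by (auto simp: doubleton_eq_iff)
qed

lemma trees_edgeE:
  assumes "T \<in> trees n" "e \<in> T" obtains u v where "e = {u, v}" "u \<noteq> v"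
proof -
  have "e \<in> {{u, v} | u v. u \<in> {1..n} \<and> v \<in> {1..n} \<and> u \<noteq> v}"
    using assms unfolding trees_def graphs_on_def by blast
  then show thesis using that by blast
qed

text \<open>The parent is chosen as a neighbour with a shorter walk to \<open>r\<close>. Any further
  edge of \<open>T\<close> would close a cycle with the path that the chosen edges already
  provide.\<close>

lemma trees_eq_edges:
  assumes T: "T \<in> trees n" and r: "r \<in> {1..n}"
  obtains g where "g \<in> forest {1..n} {r}" "edges g = T"
proof -
  have ex: "\<exists>k. near T k v r" if "v \<in> {1..n}" for v
  proof -
    have "\<exists>p. is_path T v r p" using T r that unfolding trees_def by blast
    then show ?thesis using path_near by blast
  qed
  define d where "d = (\<lambda>v. LEAST k. near T k v r)"
  have d: "near T (d v) v r" if "v \<in> {1..n}" for v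
    unfolding d_def using ex[OF that] by (rule LeastI_ex)
  have "\<exists>x. {v, x} \<in> T \<and> d x < d v" if v: "v \<in> {1..n}" "v \<noteq> r" for v
  proof -
    have "d v \<noteq> 0" using d[OF v(1)] v(2) by (intro notI) auto
    then obtain m where m: "d v = Suc m" by (cases "d v") auto
    have "\<not> near T m v r" using not_less_Least[of m "\<lambda>k. near T k v r"] m[unfolded d_def] by simp
    then obtain x where "{v, x} \<in> T" "near T m x r" using d[OF v(1)] m by auto
    moreover from this have "d x \<le> m" unfolding d_def by (intro Least_le)
    ultimately show ?thesis using m by (intro exI[of _ x]) auto
  qed
  then obtain h where h: "\<And>v. v \<in> {1..n} \<Longrightarrow> v \<noteq> r \<Longrightarrow> {v, h v} \<in> T \<and> d (h v) < d v"
    by metis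
  define g where "g = (\<lambda>v. if v \<in> {1..n} \<and> v \<noteq> r then h v else v)"
  have g: "g \<in> forest {1..n} {r}"
    by (rule forestI_rank[where rk = d]) (use r h trees_edge_in[OF T] in \<open>auto simp: g_def\<close>)
  have sub: "edges g \<subseteq> T"
    using h by (auto simp: edges_def g_def split: if_splits)
  have "T \<subseteq> edges g"
  proof (rule ccontr)
    assume "\<not> T \<subseteq> edges g"
    then obtain a b where ab: "{a, b} \<in> T" "{a, b} \<notin> edges g" using trees_edgeE[OF T] by (metis subsetI)
    then have V: "a \<in> {1..n}" "b \<in> {1..n}" "a \<noteq> b" using trees_edge_in[OF T] by auto
    have "\<exists>p. is_path (edges g) a b p"
      using edges_in_trees[OF g] V unfolding trees_def by blast
    then obtain p where p: "is_path (edges g) a b p" ..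
    have "length p \<ge> 3"
    proof (rule ccontr)
      assume "\<not> length p \<ge> 3"
      then have "length p = 0 \<or> length p = 1 \<or> length p = 2" by arith
      then show False using p ab V
        by (auto simp: is_path_def length_Suc_conv numeral_2_eq_2)
    qed
    moreover have "successively (\<lambda>x y. {x, y} \<in> T) p"
      using p sub by (auto simp: is_path_def intro: successively_mono)
    ultimately have "is_cycle T p"
      using p ab by (auto simp: is_path_def is_cycle_def insert_commute)
    then show False using T by (auto simp: trees_def)
  qed
  with sub g that show ?thesis by blast
qed

text \<open>Read from the root, the path first descends to a child, and as it never turns back to
  the vertex before, it keeps descending.\<close>

lemma path_to_root:
  assumes g: "g v = v" and p: "is_path (edges g) u v p"
  shows "i < length p \<Longrightarrow> p ! i = (g ^^ i) u"
proof -
  let ?q = "rev p"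
  have q: "distinct ?q" "?q \<noteq> []" "hd ?q = v" "\<And>i. Suc i < length p \<Longrightarrow> {?q ! i, ?q ! Suc i} \<in> edges g"
  proof -
    fix i assume i: "Suc i < length p"
    have "{p ! (length p - 2 - i), p ! Suc (length p - 2 - i)} \<in> edges g"
      using p i by (auto simp: is_path_def successively_conv_nth)
    moreover have "Suc (length p - 2 - i) = length p - Suc i" "length p - 2 - i = length p - Suc (Suc i)"
      using i by auto
    ultimately show "{?q ! i, ?q ! Suc i} \<in> edges g"
      using i by (simp add: rev_nth insert_commute)
  qed (use p in \<open>auto simp: is_path_def hd_rev\<close>)
  have step: "Suc i < length p \<Longrightarrow> g (?q ! Suc i) = ?q ! i" for i
  proof (induction i)
    case 0
    have "?q ! 0 = v" using q by (simp add: hd_conv_nth)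
    then show ?case using q(4)[OF 0] g by (auto simp: edges_iff)
  next
    case (Suc i)
    then have "g (?q ! Suc i) = ?q ! i" by simp
    moreover have "?q ! i \<noteq> ?q ! Suc (Suc i)"
      using q(1) Suc.prems by (subst nth_eq_iff_index_eq) auto
    ultimately show ?case using q(4)[OF Suc.prems] by (auto simp: edges_iff)
  qed
  have gp: "g (p ! i) = p ! Suc i" if "Suc i < length p" for i
    using step[of "length p - Suc (Suc i)"] that by (simp add: rev_nth Suc_diff_Suc)
  show "i < length p \<Longrightarrow> p ! i = (g ^^ i) u"
  proof (induction i)
    case 0 then show ?case using p by (auto simp: is_path_def hd_conv_nth)
  next
    case (Suc i) then show ?case using gp[of i] by simp
  qed
qed

lemma path_unique:
  assumes T: "T \<in> trees n" and "v \<in> {1..n}" and p: "is_path T u v p" and q: "is_path T u v q"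
  shows "p = q"
proof -
  obtain g where g: "g \<in> forest {1..n} {v}" "edges g = T" using trees_eq_edges assms by metis
  have gv: "g v = v" using g by (auto simp: forest_def)
  have le: "length q \<le> length p" if p: "is_path T u v p" and q: "is_path T u v q" for p q
  proof (rule ccontr)
    assume *: "\<not> length q \<le> length p"
    let ?i = "length p - 1"
    have ne: "p \<noteq> []" "q \<noteq> []" using p q by (auto simp: is_path_def)
    have "q ! ?i = p ! ?i"
      using path_to_root[of g v u p ?i] path_to_root[of g v u q ?i] gv p q g(2) * ne by auto
    also have "\<dots> = v" using p by (auto simp: is_path_def last_conv_nth)
    also have "v = q ! (length q - 1)" using q by (auto simp: is_path_def last_conv_nth)
    finally have "?i = length q - 1"
      using q * ne by (subst (asm) nth_eq_iff_index_eq) (auto simp: is_path_def)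
    then show False using * ne by (cases p; cases q) auto
  qed
  have "length p = length q" using le p q by (simp add: order_antisym)
  then show ?thesis
    using path_to_root[of g v u p] path_to_root[of g v u q] gv p q g(2)
    by (intro nth_equalityI) auto
qed

lemma near_tree_dist:
  assumes T: "T \<in> trees n" and "u \<in> {1..n}" "v \<in> {1..n}"
  shows "near T (tree_dist T u v) u v"
proof -
  have "\<exists>p. is_path T u v p" using assms unfolding trees_def by blast
  then obtain p where p: "is_path T u v p" ..
  then have "(THE p. is_path T u v p) = p" using path_unique assms by blast
  then show ?thesis using path_near[OF p] by (simp add: tree_dist_def)
qed

text \<open>Converts the absence of short walks, the form in which distances are handled below, into
  the hypothesis of \<open>superposable\<close>.\<close>

lemma tree_set_dist_ge:
  assumes T: "T \<in> trees n" and A: "A \<subseteq> {1..n}" "A \<noteq> {}" and B: "B \<subseteq> {1..n}" "B \<noteq> {}"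
    and far: "\<And>r u v. real r < \<rho> \<Longrightarrow> u \<in> A \<Longrightarrow> v \<in> B \<Longrightarrow> \<not> near T r u v"
  shows "\<rho> \<le> real (tree_set_dist T A B)"
proof (rule ccontr)
  assume *: "\<not> \<rho> \<le> real (tree_set_dist T A B)"
  have eq: "{tree_dist T u v | u v. u \<in> A \<and> v \<in> B} = (\<lambda>(u, v). tree_dist T u v) ` (A \<times> B)" by auto
  have "finite A" "finite B" using A B finite_subset by auto
  then have "tree_set_dist T A B \<in> {tree_dist T u v | u v. u \<in> A \<and> v \<in> B}"
    unfolding tree_set_dist_def using A B by (intro Min_in) (auto simp: eq)
  then obtain u v where uv: "u \<in> A" "v \<in> B" "tree_set_dist T A B = tree_dist T u v" by auto
  then have "near T (tree_dist T u v) u v" using near_tree_dist[OF T] A B by blast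
  then show False using far uv * by auto
qed

text \<open>Replacing the parent of one vertex is a tree perturbation as soon as both parent
  functions are forests with the same root. The absence of 2-cycles shows that the deleted edge
  really disappears and the inserted one is new.\<close>

lemma perturb_edges:
  assumes g: "g \<in> forest V {r}" and g': "g(i := k) \<in> forest V {r}" and k: "k \<noteq> g i"
  shows "perturb i (g i) k (edges g) = edges (g(i := k))" "{i, g i} \<in> edges g" "{i, k} \<notin> edges g"
    "i \<in> V" "k \<in> V" "g i \<in> V"
proof -
  have "g r = r" "(g(i := k)) r = r" "i \<notin> V \<Longrightarrow> g i = i" "i \<notin> V \<Longrightarrow> (g(i := k)) i = i"
    using g g' unfolding forest_def by blast+
  then have i: "i \<in> V" "i \<noteq> r" using k by (metis fun_upd_same)+
  have "g i \<in> V" "(g(i := k)) i \<in> V" using g g' i unfolding forest_def by blast+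
  then show "i \<in> V" "k \<in> V" "g i \<in> V" using i by auto
  have n: "g i \<noteq> i" using forest_rank(2)[OF g] i by auto
  have n': "k \<noteq> i" using forest_rank(2)[OF g', of i] i by auto
  have c: "g (g i) \<noteq> i" using forest_no_2cycle[OF g] i by auto
  have c': "g k \<noteq> i" using forest_no_2cycle[OF g', of i] i n' by auto
  show "{i, g i} \<in> edges g" using n by (auto simp: edges_iff)
  show "{i, k} \<notin> edges g" using n' k c' by (auto simp: edges_iff)
  show "perturb i (g i) k (edges g) = edges (g(i := k))"
    unfolding perturb_def
  proof (intro equalityI subsetI)
    fix e assume "e \<in> insert {i, k} (edges g - {{i, g i}})"
    then consider "e = {i, k}" | v where "e = {v, g v}" "g v \<noteq> v" "e \<noteq> {i, g i}"
      by (auto simp: edges_def)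
    then show "e \<in> edges (g(i := k))"
    proof cases
      case 1 then show ?thesis using n' by (auto simp: edges_iff)
    next
      case 2 then have "v \<noteq> i" by auto
      then show ?thesis using 2 by (auto simp: edges_iff)
    qed
  next
    fix e assume "e \<in> edges (g(i := k))"
    then obtain v where v: "e = {v, (g(i := k)) v}" "(g(i := k)) v \<noteq> v" by (auto simp: edges_def)
    show "e \<in> insert {i, k} (edges g - {{i, g i}})"
    proof (cases "v = i")
      case False
      then have "e = {v, g v}" "g v \<noteq> v" using v by auto
      moreover have "{v, g v} \<noteq> {i, g i}" using False c by (auto simp: doubleton_eq_iff)
      ultimately show ?thesis by (auto simp: edges_iff)
    qed (use v in auto)
  qed
qed

lemma lipschitz_forest:
  assumes F: "tree_lipschitz n \<alpha> F" "0 \<le> \<alpha>"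
    and g: "g \<in> forest {1..n} {r}" and g': "g(i := k) \<in> forest {1..n} {r}"
  shows "\<bar>F (edges g) - F (edges (g(i := k)))\<bar> \<le> \<alpha>"
proof (cases "k = g i")
  case False
  note P = perturb_edges[OF g g' False]
  have "perturb_tree n i (g i) k (edges g)"
    using P edges_in_trees[OF g'] by (simp add: perturb_tree_def)
  then show ?thesis using F edges_in_trees[OF g] P(1) unfolding tree_lipschitz_def by metis
qed (use F in simp)

text \<open>If a parent stays as it is, the mixed difference cancels; otherwise the four parent
  functions are the trees that \<open>superposable\<close> asks for.\<close>

lemma superposable_forest:
  assumes F: "superposable n \<rho> F"
    and g: "g \<in> forest {1..n} {r}" and gi: "g(i := k) \<in> forest {1..n} {r}"
    and ga: "g(a := c) \<in> forest {1..n} {r}" and gia: "g(i := k, a := c) \<in> forest {1..n} {r}"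
    and ia: "i \<noteq> a" and far: "k \<noteq> g i \<Longrightarrow> c \<noteq> g a \<Longrightarrow>
      (\<And>s u v. real s < \<rho> \<Longrightarrow> u \<in> {g i, k} \<Longrightarrow> v \<in> {g a, c} \<Longrightarrow> \<not> near (edges g) s u v)"
  shows "F (edges (g(i := k, a := c))) - F (edges (g(i := k))) - F (edges (g(a := c))) + F (edges g) = 0"
proof (cases "k = g i \<or> c = g a")
  case True
  then show ?thesis
  proof
    assume "k = g i" then show ?thesis by simp
  next
    assume "c = g a"
    then have "g(i := k, a := c) = g(i := k)" using ia by (auto simp: fun_eq_iff)
    then show ?thesis using \<open>c = g a\<close> by simp
  qed
next
  case False
  have sw: "g(a := c, i := k) = g(i := k, a := c)" using ia by (auto simp: fun_eq_iff)
  have F1: "k \<noteq> g i" and F2: "c \<noteq> g a" using False by auto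
  note Pi = perturb_edges[OF g gi F1] and Pa = perturb_edges[OF g ga F2]
  have gai: "(g(a := c)) i = g i" using ia by simp
  have ki: "k \<noteq> (g(a := c)) i" using False gai by simp
  note P = perturb_edges[OF ga gia[folded sw] ki, unfolded gai sw]
  have "perturb_tree n i (g i) k (edges g)" "perturb_tree n a (g a) c (edges g)"
    "perturb_tree n i (g i) k (perturb a (g a) c (edges g))"
    using P(1-3) Pi(1-3) Pa(1-3) edges_in_trees[OF gi] edges_in_trees[OF ga] edges_in_trees[OF gia] False
    unfolding perturb_tree_def by (simp_all del: fun_upd_apply)
  moreover have "\<rho> \<le> real (tree_set_dist (edges g) {g i, k} {g a, c})"
    using Pi Pa False far by (intro tree_set_dist_ge[OF edges_in_trees[OF g]]) auto
  ultimately have "F (perturb i (g i) k (perturb a (g a) c (edges g))) - F (edges g) =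
          (F (perturb i (g i) k (edges g)) - F (edges g)) + (F (perturb a (g a) c (edges g)) - F (edges g))"
    using F edges_in_trees[OF g] unfolding superposable_def by blast
  then show ?thesis unfolding Pa(1) P(1) Pi(1) by simp
qed

lemma finite_forest:
  assumes "finite V" shows "finite (forest V S)"
proof -
  have "forest V S \<subseteq> (\<lambda>h v. if v \<in> V then h v else v) ` (V \<rightarrow>\<^sub>E V)"
  proof
    fix g assume g: "g \<in> forest V S"
    then have "g = (\<lambda>v. if v \<in> V then restrict g V v else v)" "restrict g V \<in> V \<rightarrow>\<^sub>E V"
      by (auto simp: forest_def fun_eq_iff)
    then show "g \<in> (\<lambda>h v. if v \<in> V then h v else v) ` (V \<rightarrow>\<^sub>E V)" by (rule image_eqI)
  qed
  moreover have "finite (V \<rightarrow>\<^sub>E V)" using assms by (intro finite_PiE) auto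
  ultimately show ?thesis using finite_surj by blast
qed

section \<open>Ball sizes in rooted forests\<close>

definition descendants :: "nat set \<Rightarrow> (nat \<Rightarrow> nat) \<Rightarrow> nat \<Rightarrow> nat set" where
  "descendants V g s = {v \<in> V. \<exists>k. (g ^^ k) v = s}"

lemma funpow_fix: "g s = s \<Longrightarrow> (g ^^ k) s = s"
  by (induction k) auto

lemma funpow_reach_unique:
  assumes "(g ^^ k) v = s" "(g ^^ l) v = s'" "g s = s" "g s' = s'" shows "s = s'"
proof -
  have "k \<le> l \<Longrightarrow> (g ^^ l) v = s" if "(g ^^ k) v = s" "g s = s" for k l s
    using that funpow_fix[of g s] by (metis funpow_add le_add_diff_inverse2 o_apply)
  then show ?thesis using assms by (metis nle_le)
qed

lemma sum_card_descendants:
  assumes "finite V" "S \<subseteq> V" "g \<in> forest V S"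
  shows "(\<Sum>s\<in>S. card (descendants V g s)) = card V"
proof -
  have "finite S" using assms finite_subset by auto
  have "V = (\<Union>s\<in>S. descendants V g s)"
    using assms by (auto simp: forest_def descendants_def) blast
  moreover have "descendants V g s \<inter> descendants V g s' = {}" if "s \<in> S" "s' \<in> S" "s \<noteq> s'" for s s'
    using that assms funpow_reach_unique[where g = g and s = s and s' = s'] by (auto simp: descendants_def forest_def)
  ultimately show ?thesis
    using card_UN_disjoint[of S "descendants V g"] \<open>finite S\<close> \<open>finite V\<close>
    by (simp add: descendants_def)
qed

lemma forest_cut:
  assumes g: "g \<in> forest V S" and y: "y \<in> V" and S: "S \<subseteq> V"
  shows "g(y := y) \<in> forest V (insert y S)"
proof (rule forestI_rank[where rk = "depth g S"])
  fix v assume "v \<in> V" "v \<notin> insert y S"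
  then show "(g(y := y)) v \<in> V \<and> depth g S ((g(y := y)) v) < depth g S v"
    using g forest_rank(1)[OF g] by (auto simp: forest_def)
qed (use g y S in \<open>auto simp: forest_def\<close>)

text \<open>The inverse of cutting: a root \<open>u\<close> may be attached to any vertex
  \<open>v\<close> outside its own tree. As a rank, the depths in the tree of \<open>u\<close> are
  lifted above the depth of \<open>v\<close>.\<close>

lemma forest_link:
  assumes g: "g \<in> forest V (insert u S)" and u: "u \<in> V" "u \<notin> S" and S: "S \<subseteq> V"
    and v: "v \<in> V" "v \<notin> descendants V g u"
  shows "g(u := v) \<in> forest V S"
proof -
  have fixed: "g s = s" if "s \<in> insert u S" for s using g that by (auto simp: forest_def)
  define rk where "rk = (\<lambda>w. depth g (insert u S) w + (if w \<in> descendants V g u then Suc (depth g (insert u S) v) else 0))"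
  show ?thesis
  proof (rule forestI_rank[where rk = rk])
    fix w assume w: "w \<in> V" "w \<notin> S"
    show "(g(u := v)) w \<in> V \<and> rk ((g(u := v)) w) < rk w"
    proof (cases "w = u")
      case True
      have "u \<in> descendants V g u" using u by (auto simp: descendants_def intro: exI[of _ 0])
      then show ?thesis using True v by (simp add: rk_def)
    next
      case False
      then have d: "depth g (insert u S) (g w) < depth g (insert u S) w" using w forest_rank(1)[OF g, of w] by auto
      have gw: "g w \<in> V" using g w by (auto simp: forest_def)
      have "g w \<in> descendants V g u \<longleftrightarrow> w \<in> descendants V g u"
      proof
        assume "g w \<in> descendants V g u"
        then obtain k where "(g ^^ k) (g w) = u" by (auto simp: descendants_def)
        then have "(g ^^ Suc k) w = u" by (simp add: funpow_swap1)
        then show "w \<in> descendants V g u" using w unfolding descendants_def by blast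
      next
        assume "w \<in> descendants V g u"
        then obtain k where k: "(g ^^ k) w = u" by (auto simp: descendants_def)
        then obtain l where "k = Suc l" using False by (cases k) auto
        then have "(g ^^ l) (g w) = u" using k by (simp add: funpow_swap1)
        then show "g w \<in> descendants V g u" using gw unfolding descendants_def by blast
      qed
      then show ?thesis using False gw d by (simp add: rk_def)
    qed
  qed (use g u S v fixed in \<open>auto simp: forest_def\<close>)
qed

text \<open>Cutting \<open>u\<close> loose while remembering its former parent is a bijection, with
  linking as its inverse; the former parent can be any vertex outside the tree of
  \<open>u\<close>.\<close>

lemma card_forest_split:
  assumes V: "finite V" and S: "S \<subseteq> V" "S \<noteq> {}" and u: "u \<in> V" "u \<notin> S"
  shows "card (forest V S) = (\<Sum>g\<in>forest V (insert u S). card (V - descendants V g u))"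
proof -
  have "bij_betw (\<lambda>f. (f(u := u), f u)) (forest V S) (SIGMA g:forest V (insert u S). V - descendants V g u)"
  proof (rule bij_betw_byWitness[where f' = "\<lambda>(g, v). g(u := v)"])
    show "(\<lambda>f. (f(u := u), f u)) ` forest V S \<subseteq> (SIGMA g:forest V (insert u S). V - descendants V g u)"
    proof (intro image_subsetI SigmaI)
      fix f assume f: "f \<in> forest V S"
      show "f(u := u) \<in> forest V (insert u S)" using forest_cut[OF f u(1) S(1)] .
      have "f u \<in> V" using f u by (auto simp: forest_def)
      moreover have "f u \<notin> descendants V (f(u := u)) u"
      proof
        assume "f u \<in> descendants V (f(u := u)) u"
        then obtain k where k: "((f(u := u)) ^^ k) (f u) = u" by (auto simp: descendants_def)
        have "depth f S (((f(u := u)) ^^ k) v) \<le> depth f S v" if "v \<in> V" for k v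
          using that
        proof (induction k arbitrary: v)
          case (Suc k)
          have "(f(u := u)) v \<in> V" using f Suc.prems u by (auto simp: forest_def)
          then have "depth f S (((f(u := u)) ^^ k) ((f(u := u)) v)) \<le> depth f S ((f(u := u)) v)" by (rule Suc.IH)
          also have "\<dots> \<le> depth f S v"
          proof (cases "v \<in> S")
            case True then show ?thesis using f by (auto simp: forest_def)
          next
            case False then show ?thesis using forest_rank(1)[OF f Suc.prems False] by auto
          qed
          finally show ?case by (simp only: funpow_Suc_right o_apply)
        qed simp
        from this[OF \<open>f u \<in> V\<close>, of k] k have "depth f S u \<le> depth f S (f u)" by simp
        then show False using forest_rank(1)[OF f u] by simp
      qed
      ultimately show "f u \<in> V - descendants V (f(u := u)) u" by blast
    qed
    show "(\<lambda>(g, v). g(u := v)) ` (SIGMA g:forest V (insert u S). V - descendants V g u) \<subseteq> forest V S"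
      using forest_link[OF _ u S(1)] by auto
  qed (use u in \<open>auto simp: forest_def fun_eq_iff\<close>)
  then have "card (forest V S) = card (SIGMA g:forest V (insert u S). V - descendants V g u)"
    by (rule bij_betw_same_card)
  also have "\<dots> = (\<Sum>g\<in>forest V (insert u S). card (V - descendants V g u))"
    using finite_forest[OF V] V by (intro card_SigmaI) auto
  finally show ?thesis .
qed

text \<open>Conjugation by the transposition of the two roots permutes the forests and carries the
  tree of one root to that of the other.\<close>

lemma sum_descendants_sym:
  assumes V: "finite V" and S: "S \<subseteq> V" and u: "u \<in> S" "s \<in> S"
  shows "(\<Sum>g\<in>forest V S. card (descendants V g u)) = (\<Sum>g\<in>forest V S. card (descendants V g s))"
proof -
  define \<tau> where "\<tau> = Transposition.transpose u s"
  have inv: "\<tau> (\<tau> v) = v" for v by (simp add: \<tau>_def)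
  have \<tau>V: "\<tau> v \<in> V \<longleftrightarrow> v \<in> V" and \<tau>S: "\<tau> v \<in> S \<longleftrightarrow> v \<in> S" for v
    using u S by (auto simp: \<tau>_def Transposition.transpose_def)
  have \<tau>us: "\<tau> u = s" by (simp add: \<tau>_def)
  define h where "h = (\<lambda>g v. \<tau> (g (\<tau> v)))"
  have pow: "(h g ^^ k) v = \<tau> ((g ^^ k) (\<tau> v))" for g k v
    by (induction k) (simp_all add: h_def inv)
  have h: "h g \<in> forest V S" if "g \<in> forest V S" for g
    using that unfolding forest_def mem_Collect_eq pow \<tau>S using \<tau>V \<tau>S inv by (simp add: h_def)
  have bij: "bij_betw h (forest V S) (forest V S)"
    by (rule bij_betw_byWitness[where f' = h]) (use h in \<open>auto simp: h_def inv\<close>)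
  have "card (descendants V (h g) u) = card (descendants V g s)" for g
  proof -
    have "descendants V (h g) u = \<tau> ` descendants V g s"
    proof (intro equalityI subsetI)
      fix v assume "v \<in> descendants V (h g) u"
      then have "\<tau> v \<in> descendants V g s"
        unfolding descendants_def pow mem_Collect_eq using \<tau>V inv \<tau>us by metis
      then show "v \<in> \<tau> ` descendants V g s" using inv by (metis image_eqI)
    next
      fix v assume "v \<in> \<tau> ` descendants V g s"
      then have "\<tau> v \<in> descendants V g s" using inv by auto
      then show "v \<in> descendants V (h g) u"
        unfolding descendants_def pow mem_Collect_eq using \<tau>V inv \<tau>us by metis
    qed
    moreover have "inj_on \<tau> A" for A using inv by (metis inj_onI)
    ultimately show ?thesis by (simp add: card_image)
  qed
  then show ?thesis
    using sum.reindex_bij_betw[OF bij, of "\<lambda>g. card (descendants V g u)"] by simp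
qed

text \<open>The recursion behind the formula \<open>m n ^ (n - m - 1)\<close> for the number of forests on \<open>n\<close> vertices
  with \<open>m\<close> given roots.\<close>

lemma card_forest_insert:
  assumes V: "finite V" and S: "S \<subseteq> V" "S \<noteq> {}" and u: "u \<in> V" "u \<notin> S"
  shows "(card S + 1) * card (forest V S) = card V * card S * card (forest V (insert u S))"
proof -
  let ?G = "forest V (insert u S)"
  let ?D = "\<lambda>s. \<Sum>g\<in>?G. card (descendants V g s)"
  have fin: "finite S" using S V finite_subset by auto
  \<comment> \<open>By symmetry, each of the \<open>card S + 1\<close> trees has on average the same
    share of the vertices.\<close>
  have "(\<Sum>s\<in>insert u S. ?D s) = (\<Sum>s\<in>insert u S. ?D u)"
    using S u by (intro sum.cong refl sum_descendants_sym V) auto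
  then have "(card S + 1) * ?D u = (\<Sum>s\<in>insert u S. ?D s)" using fin u by simp
  also have "\<dots> = (\<Sum>g\<in>?G. card V)"
    unfolding sum.swap[of _ ?G] using S u by (intro sum.cong refl sum_card_descendants V) auto
  finally have D: "(card S + 1) * ?D u = card V * card ?G" by simp
  have "card (forest V S) + ?D u = (\<Sum>g\<in>?G. card (V - descendants V g u) + card (descendants V g u))"
    unfolding card_forest_split[OF V S u] by (simp add: sum.distrib)
  also have "\<dots> = (\<Sum>g\<in>?G. card V)"
  proof (intro sum.cong refl)
    fix g show "card (V - descendants V g u) + card (descendants V g u) = card V"
      using V by (subst card_Diff_subset) (auto simp: descendants_def card_mono)
  qed
  finally have "(card S + 1) * card (forest V S) + (card S + 1) * ?D u = (card S + 1) * (card V * card ?G)"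
    by (simp only: distrib_left[symmetric] sum_constant) (simp add: mult.commute)
  then show ?thesis unfolding D by (simp add: algebra_simps)
qed

text \<open>In a forest the roots are fixed by \<open>g\<close>, so this counts the vertices within
  distance \<open>r\<close> of the root set.\<close>

definition reach_count :: "nat set \<Rightarrow> nat \<Rightarrow> nat set \<Rightarrow> (nat \<Rightarrow> nat) \<Rightarrow> nat" where
  "reach_count V r S g = card {u \<in> V. (g ^^ r) u \<in> S}"

text \<open>For a root \<open>z\<close>, \<open>l\<close> is the time at which the way up from
  \<open>u\<close> first enters \<open>S\<close>.\<close>

definition reach :: "(nat \<Rightarrow> nat) \<Rightarrow> nat set \<Rightarrow> nat \<Rightarrow> nat \<Rightarrow> nat \<Rightarrow> bool" where
  "reach g S l u z \<longleftrightarrow> (g ^^ l) u = z \<and> (\<forall>i<l. (g ^^ i) u \<notin> S)"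

lemma funpow_in: "g \<in> forest V S \<Longrightarrow> u \<in> V \<Longrightarrow> (g ^^ i) u \<in> V"
  by (induction i) (auto simp: forest_def)

lemma reach_depth:
  assumes g: "g \<in> forest V S" and u: "u \<in> V" and l: "\<And>i. i < l \<Longrightarrow> (g ^^ i) u \<notin> S"
  shows "i < j \<Longrightarrow> j \<le> l \<Longrightarrow> (g ^^ i) u \<noteq> (g ^^ j) u"
proof -
  have "i < j \<Longrightarrow> j \<le> l \<Longrightarrow> depth g S ((g ^^ j) u) < depth g S ((g ^^ i) u)"
  proof (induction j)
    case (Suc j)
    have "depth g S ((g ^^ Suc j) u) < depth g S ((g ^^ j) u)"
      using forest_rank(1)[OF g, of "(g ^^ j) u"] funpow_in[OF g u] l[of j] Suc.prems by simp
    then show ?case using Suc by (cases "i = j") auto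
  qed simp
  then show "i < j \<Longrightarrow> j \<le> l \<Longrightarrow> (g ^^ i) u \<noteq> (g ^^ j) u" by fastforce
qed

lemma reach_count_cut:
  assumes "finite V" "S \<subseteq> V" "g \<in> forest V S" "y \<in> V"
  shows "reach_count V r S g \<le> reach_count V r (insert y S) (g(y := y))"
  unfolding reach_count_def
proof (intro card_mono)
  have *: "((g(y := y)) ^^ r) u = (g ^^ r) u \<or> ((g(y := y)) ^^ r) u = y" for r u
    by (induction r) auto
  show "{u \<in> V. (g ^^ r) u \<in> S} \<subseteq> {u \<in> V. ((g(y := y)) ^^ r) u \<in> insert y S}"
  proof (intro subsetI CollectI)
    fix u assume "u \<in> {u \<in> V. (g ^^ r) u \<in> S}"
    then show "u \<in> V \<and> ((g(y := y)) ^^ r) u \<in> insert y S" using *[of r u] by (metis insertCI mem_Collect_eq)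
  qed
qed (use assms in auto)

text \<open>Induction on \<open>l\<close>: turning the last vertex \<open>y\<close> before
  \<open>z\<close> into a root shortens the way up by one. By the counting recursion this multiplies
  \<open>card (forest V S) / card S\<close> by \<open>1 / card V\<close> for each of at most
  \<open>card V\<close> choices of \<open>y\<close>, while \<open>reach_count\<close> can only grow.
  After \<open>l\<close> cuts there are \<open>card S + l\<close> roots, which explains the argument
  of \<open>B\<close>.\<close>

lemma reach_moment:
  fixes B :: "nat \<Rightarrow> real" and k r :: nat
  assumes V: "finite V" "V \<noteq> {}"
    and B: "\<And>S. S \<subseteq> V \<Longrightarrow> S \<noteq> {} \<Longrightarrow>
      (\<Sum>g\<in>forest V S. real (reach_count V r S g) ^ k) \<le> card (forest V S) / card S * B (card S)"
    and B0: "\<And>m. B m \<ge> 0"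
  shows "S \<subseteq> V \<Longrightarrow> S \<noteq> {} \<Longrightarrow> z \<in> S \<Longrightarrow>
    (\<Sum>(g, u) \<in> {(g, u). g \<in> forest V S \<and> u \<in> V \<and> reach g S l u z}. real (reach_count V r S g) ^ k)
      \<le> card (forest V S) / card S * B (card S + l)"
proof (induction l arbitrary: S z)
  case 0
  have "{(g, u). g \<in> forest V S \<and> u \<in> V \<and> reach g S 0 u z} = forest V S \<times> {z}"
    using 0 by (auto simp: reach_def)
  then show ?case using B[OF 0(1,2)] by (simp add: sum.cartesian_product[symmetric])
next
  case (Suc l)
  let ?X = "\<lambda>S l z. {(g, u). g \<in> forest V S \<and> u \<in> V \<and> reach g S l u z}"
  have finX: "finite (?X S l z)" for S l z
    by (rule finite_subset[of _ "forest V S \<times> V"]) (auto simp: finite_forest V)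
  define c where "c = real (card (forest V S)) / card S"
  have finS: "finite S" using Suc.prems V finite_subset by auto
  have cS: "real (card (forest V (insert y S))) / card (insert y S) = c / card V" if y: "y \<in> V - S" for y
  proof -
    have "real (card S + 1) * card (forest V S) = real (card V) * card S * card (forest V (insert y S))"
      using card_forest_insert[OF V(1) Suc.prems(1,2), of y] y by (metis DiffE of_nat_mult)
    then show ?thesis
      using y finS V Suc.prems by (simp add: c_def field_simps)
  qed
  let ?\<phi> = "\<lambda>(g, u). ((g ^^ l) u, (g((g ^^ l) u := (g ^^ l) u), u))"
  have inj: "inj_on ?\<phi> (?X S (Suc l) z)"
  proof (rule inj_onI, clarsimp)
    fix g u g' assume a: "reach g S (Suc l) u z" "reach g' S (Suc l) u z"
      "(g ^^ l) u = (g' ^^ l) u" "g((g' ^^ l) u := (g' ^^ l) u) = g'((g' ^^ l) u := (g' ^^ l) u)"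
    have "g ((g' ^^ l) u) = z" "g' ((g' ^^ l) u) = z" using a by (simp_all add: reach_def)
    then show "g = g'" using a(4) by (metis fun_upd_idem_iff fun_upd_upd)
  qed
  have img: "?\<phi> ` ?X S (Suc l) z \<subseteq> (SIGMA y:V - S. ?X (insert y S) l y)"
  proof clarsimp
    fix g u assume g: "g \<in> forest V S" and u: "u \<in> V" and r: "reach g S (Suc l) u z"
    let ?y = "(g ^^ l) u"
    have y: "?y \<in> V" "?y \<notin> S" using funpow_in[OF g u] r by (auto simp: reach_def)
    have ne: "(g ^^ i) u \<noteq> ?y" if "i < l" for i
      using reach_depth[OF g u, of "Suc l" i l] that r by (auto simp: reach_def)
    have eq: "i \<le> l \<Longrightarrow> ((g(?y := ?y)) ^^ i) u = (g ^^ i) u" for i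
      by (induction i) (use ne in auto)
    have "reach (g(?y := ?y)) (insert ?y S) l u ?y"
      unfolding reach_def using eq ne r by (auto simp: reach_def)
    then show "?y \<in> V \<and> ?y \<notin> S \<and> g(?y := ?y) \<in> forest V (insert ?y S) \<and> reach (g(?y := ?y)) (insert ?y S) l u ?y"
      using y forest_cut[OF g y(1) Suc.prems(1)] by blast
  qed
  have "(\<Sum>(g, u) \<in> ?X S (Suc l) z. real (reach_count V r S g) ^ k) \<le>
      (\<Sum>p \<in> ?X S (Suc l) z. case ?\<phi> p of (y, (g', u)) \<Rightarrow> real (reach_count V r (insert y S) g') ^ k)"
  proof (intro sum_mono, clarsimp)
    fix g u assume g: "g \<in> forest V S" and u: "u \<in> V"
    show "real (reach_count V r S g) ^ k \<le> real (reach_count V r (insert ((g ^^ l) u) S) (g((g ^^ l) u := (g ^^ l) u))) ^ k"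
      using reach_count_cut[OF V(1) Suc.prems(1) g funpow_in[OF g u]] by (intro power_mono) auto
  qed
  also have "\<dots> = (\<Sum>(y, (g', u)) \<in> ?\<phi> ` ?X S (Suc l) z. real (reach_count V r (insert y S) g') ^ k)"
    by (subst sum.reindex[OF inj]) (simp add: o_def case_prod_unfold)
  also have "\<dots> \<le> (\<Sum>(y, (g', u)) \<in> (SIGMA y:V - S. ?X (insert y S) l y). real (reach_count V r (insert y S) g') ^ k)"
    using V finX img by (intro sum_mono2 finite_SigmaI) auto
  also have "\<dots> = (\<Sum>y\<in>V - S. \<Sum>(g', u) \<in> ?X (insert y S) l y. real (reach_count V r (insert y S) g') ^ k)"
    using V finX by (subst sum.Sigma) auto
  also have "\<dots> \<le> (\<Sum>y\<in>V - S. c / card V * B (card S + Suc l))"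
  proof (intro sum_mono)
    fix y assume y: "y \<in> V - S"
    have "(\<Sum>(g', u) \<in> ?X (insert y S) l y. real (reach_count V r (insert y S) g') ^ k) \<le>
        card (forest V (insert y S)) / card (insert y S) * B (card (insert y S) + l)"
      using y Suc.prems by (intro Suc.IH) auto
    then show "(\<Sum>(g', u) \<in> ?X (insert y S) l y. real (reach_count V r (insert y S) g') ^ k) \<le> c / card V * B (card S + Suc l)"
      unfolding cS[OF y] using y finS by simp
  qed
  also have "\<dots> = card (V - S) / card V * (c * B (card S + Suc l))" by simp
  also have "\<dots> \<le> 1 * (c * B (card S + Suc l))"
    using V B0 by (intro mult_right_mono) (auto simp: c_def card_mono divide_le_eq_1 intro!: mult_nonneg_nonneg)
  finally show ?case by (simp add: c_def)
qed

lemma sum_UN_le: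
  fixes f :: "'a \<Rightarrow> real"
  assumes "finite I" "\<And>i. i \<in> I \<Longrightarrow> finite (A i)" "\<And>x. 0 \<le> f x"
  shows "sum f (\<Union>i\<in>I. A i) \<le> (\<Sum>i\<in>I. sum f (A i))"
  using assms(1,2)
proof (induction I)
  case (insert i I)
  have "sum f (A i \<union> (\<Union>i\<in>I. A i)) \<le> sum f (A i) + sum f (\<Union>i\<in>I. A i)"
    using insert assms(3) by (subst sum_Un) (auto intro!: sum_nonneg)
  then show ?case using insert by simp
qed simp

text \<open>One factor of the power is expanded as a sum over vertices \<open>u\<close>, sorted by
  root and entry time, and the way up from \<open>u\<close> is cut into new roots. Each factor thus
  costs \<open>r + 1\<close> entry times and at most \<open>r\<close> further roots. For a single
  root the bound is of order \<open>r ^ (2 * k + 1)\<close>, so balls behave like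
  \<open>r^2\<close>.\<close>

lemma forest_moment:
  assumes V: "finite V" "V \<noteq> {}"
  shows "S \<subseteq> V \<Longrightarrow> S \<noteq> {} \<Longrightarrow> (\<Sum>g\<in>forest V S. real (reach_count V r S g) ^ k) \<le>
    card (forest V S) / card S * (real (card S + k * r) ^ (k + 1) * real (r + 1) ^ k)"
proof (induction k arbitrary: S)
  case 0
  then have "card S > 0" using V finite_subset by (metis card_gt_0_iff)
  then show ?case by simp
next
  case (Suc k)
  let ?B = "\<lambda>m. real (m + k * r) ^ (k + 1) * real (r + 1) ^ k"
  let ?X = "\<lambda>l z. {(g, u). g \<in> forest V S \<and> u \<in> V \<and> reach g S l u z}"
  let ?c = "real (card (forest V S)) / card S"
  have finS: "finite S" using Suc.prems V finite_subset by auto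
  have finX: "finite (?X l z)" for l z
    by (rule finite_subset[of _ "forest V S \<times> V"]) (auto simp: finite_forest V)
  have W: "(\<Sum>(g, u) \<in> ?X l z. real (reach_count V r S g) ^ k) \<le> ?c * ?B (card S + l)" if "z \<in> S" for l z
    using reach_moment[OF V Suc.IH _ Suc.prems that] by simp
  have "(\<Sum>g\<in>forest V S. real (reach_count V r S g) ^ Suc k) =
      (\<Sum>g\<in>forest V S. \<Sum>u\<in>{u \<in> V. (g ^^ r) u \<in> S}. real (reach_count V r S g) ^ k)"
    by (simp add: reach_count_def)
  also have "\<dots> = (\<Sum>(g, u) \<in> (SIGMA g:forest V S. {u \<in> V. (g ^^ r) u \<in> S}). real (reach_count V r S g) ^ k)"
    using V by (subst sum.Sigma) (auto simp: finite_forest)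
  also have "\<dots> \<le> (\<Sum>(g, u) \<in> (\<Union>z\<in>S. \<Union>l\<in>{..r}. ?X l z). real (reach_count V r S g) ^ k)"
  proof (rule sum_mono2)
    show "(SIGMA g:forest V S. {u \<in> V. (g ^^ r) u \<in> S}) \<subseteq> (\<Union>z\<in>S. \<Union>l\<in>{..r}. ?X l z)"
    proof clarsimp
      fix g u assume g: "g \<in> forest V S" and u: "u \<in> V" and r: "(g ^^ r) u \<in> S"
      define l where "l = (LEAST l. (g ^^ l) u \<in> S)"
      have "(g ^^ l) u \<in> S" "l \<le> r" "\<And>i. i < l \<Longrightarrow> (g ^^ i) u \<notin> S"
        unfolding l_def using r by (auto intro: LeastI Least_le dest: not_less_Least)
      then show "\<exists>z\<in>S. \<exists>l\<in>{..r}. reach g S l u z" by (auto simp: reach_def)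
    qed
  qed (use finS finX in auto)
  also have "\<dots> \<le> (\<Sum>z\<in>S. \<Sum>(g, u) \<in> (\<Union>l\<in>{..r}. ?X l z). real (reach_count V r S g) ^ k)"
    by (rule sum_UN_le) (use finS finX in \<open>auto simp: case_prod_unfold\<close>)
  also have "\<dots> \<le> (\<Sum>z\<in>S. \<Sum>l\<in>{..r}. \<Sum>(g, u) \<in> ?X l z. real (reach_count V r S g) ^ k)"
    by (intro sum_mono sum_UN_le) (use finX in \<open>auto simp: case_prod_unfold\<close>)
  also have "\<dots> \<le> (\<Sum>z\<in>S. \<Sum>l\<in>{..r}. ?c * ?B (card S + r))"
  proof (intro sum_mono)
    fix z l assume "z \<in> S" "l \<in> {..r}"
    have "?B (card S + l) \<le> ?B (card S + r)"
      using \<open>l \<in> {..r}\<close> by (intro mult_right_mono power_mono) auto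
    then have "?c * ?B (card S + l) \<le> ?c * ?B (card S + r)" by (intro mult_left_mono) auto
    with W[OF \<open>z \<in> S\<close>, of l] show "(\<Sum>(g, u) \<in> ?X l z. real (reach_count V r S g) ^ k) \<le> ?c * ?B (card S + r)" by linarith
  qed
  also have "\<dots> = ?c * (real (card S) * real (r + 1) * ?B (card S + r))"
    by (simp only: sum_constant card_atMost Suc_eq_plus1 mult_ac)
  also have "\<dots> \<le> ?c * (real (card S + Suc k * r) * real (r + 1) * ?B (card S + r))"
    by (intro mult_left_mono mult_right_mono) auto
  also have "\<dots> = ?c * (real (card S + Suc k * r) ^ (Suc k + 1) * real (r + 1) ^ Suc k)"
  proof -
    have e: "card S + r + k * r = card S + Suc k * r" by simp
    show ?thesis unfolding e Suc_eq_plus1[symmetric] power_Suc by (simp only: mult_ac)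
  qed
  finally show ?case .
qed

section \<open>The tree of a word\<close>

declare One_nat_def [simp del]

text \<open>\<open>P\<close> holds the parents in the four corners of a double change,
  \<open>x\<close> to \<open>y\<close> and \<open>x'\<close> to \<open>y'\<close>. If the two pairs
  are disjoint and no parent links them, no vertex is moved by both changes, and each change acts in
  the same way whether or not the other is made.\<close>

lemma noninterference:
  fixes P :: "bool \<Rightarrow> bool \<Rightarrow> nat \<Rightarrow> nat"
  assumes j: "\<And>\<tau> v. P True \<tau> v \<noteq> P False \<tau> v \<Longrightarrow> v \<in> {x, y} \<or> P False \<tau> v = x \<and> P True \<tau> v = y"
    and a: "\<And>\<sigma> v. P \<sigma> True v \<noteq> P \<sigma> False v \<Longrightarrow> v \<in> {x', y'} \<or> P \<sigma> False v = x' \<and> P \<sigma> True v = y'"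
    and disj: "{x, y} \<inter> {x', y'} = {}"
    and na: "\<And>\<sigma> \<tau> v. v \<in> {x, y} \<Longrightarrow> P \<sigma> \<tau> v \<notin> {x', y'}" "\<And>\<sigma> \<tau> v. v \<in> {x', y'} \<Longrightarrow> P \<sigma> \<tau> v \<notin> {x, y}"
  shows "P True False v \<noteq> P False False v \<Longrightarrow> P False True v = P False False v \<and> P True True v = P True False v"
    and "P True False v = P False False v \<Longrightarrow> P True True v = P False True v"
proof -
  have 1: "P False True v = P False False v" if "P True False v \<noteq> P False False v"
    using j[of False v] a[of False v] disj na[of v False False] na[of v False True] that by blast
  have 2: "P True True v = P True False v" if "P True False v \<noteq> P False False v"
    using j[of False v] a[of True v] disj na[of v True False] na[of v True True] that by blast
  show "P True False v \<noteq> P False False v \<Longrightarrow> P False True v = P False False v \<and> P True True v = P True False v"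
    using 1 2 by blast
  show "P True True v = P False True v" if "P True False v = P False False v"
  proof (cases "P False True v = P False False v")
    case True
    show ?thesis
    proof (rule ccontr)
      assume *: "P True True v \<noteq> P False True v"
      then have "P True True v \<noteq> P True False v" using True that by simp
      then show False
        using j[OF *] a[of True v] disj na[of v True True] na[of v False True] na[of v True False] True that
        by (metis (full_types) disjoint_iff insertI1 insertI2)
    qed
  next
    case False
    show ?thesis
    proof (rule ccontr)
      assume *: "P True True v \<noteq> P False True v"
      show False
        using j[OF *] a[OF False] disj na[of v False True] na[of v False False] by (metis (full_types) disjoint_iff insertI1 insertI2)
    qed
  qed
qed

text \<open>Stop the walk at its first vertex in \<open>B\<close> and drop everything up to the last
  edge inside \<open>A\<close>; what remains uses only edges of \<open>C\<close>.\<close>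

lemma near_reduce:
  assumes H: "H \<subseteq> C \<union> {e. e \<subseteq> A} \<union> {e. e \<subseteq> B}"
    and "near H r u v" "v \<in> B"
  shows "(\<exists>v'\<in>B. near C r u v') \<or> (\<exists>u'\<in>A. \<exists>v'\<in>B. near C r u' v')"
  using assms(2)
proof (induction r arbitrary: u)
  case 0 then show ?case using assms(3) by auto
next
  case (Suc r)
  then consider "near H r u v" | x where "{u, x} \<in> H" "near H r x v" by auto
  then show ?case
  proof cases
    case 1 then show ?thesis using Suc.IH by (meson near.simps(2))
  next
    case 2
    have "{u, x} \<in> C \<or> u \<in> A \<and> x \<in> A \<or> u \<in> B" using 2(1) H by auto
    then show ?thesis
      using Suc.IH[OF 2(2)] near_refl near_mono[of C r _ _ "Suc r"] by (meson le_Suc_eq near.simps(2))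
  qed
qed

section \<open>First occurrences and parents of a word\<close>

locale tree_words =
  fixes n N :: nat
  assumes n_pos: "n \<ge> 1"
begin

sublocale word_space "{1..n}" "1::nat" N
  by unfold_locales (use n_pos in auto)

text \<open>Letters that do not occur get the first occurrence \<open>Suc N\<close> and are attached to \<open>1\<close>, so that every
  word codes a tree.\<close>

definition first :: "(nat \<Rightarrow> nat) \<Rightarrow> nat \<Rightarrow> nat" where
  "first w v = (if v \<in> range w then LEAST k. w k = v else Suc N)"

definition par :: "(nat \<Rightarrow> nat) \<Rightarrow> nat \<Rightarrow> nat" where
  "par w v = (if v = 1 then 1 else if v \<in> range w then w (first w v - 1) else if v \<in> {1..n} then 1 else v)"

abbreviation tree :: "(nat \<Rightarrow> nat) \<Rightarrow> graph" where
  "tree w \<equiv> edges (par w)"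

lemma first_le: "first w (w k) \<le> k"
  unfolding first_def by (auto intro: Least_le)

lemma w_first: "v \<in> range w \<Longrightarrow> w (first w v) = v"
  unfolding first_def by (auto intro: LeastI)

lemma first_eqI: "w k = v \<Longrightarrow> (\<And>i. i < k \<Longrightarrow> w i \<noteq> v) \<Longrightarrow> first w v = k"
  using first_le[of w k] w_first[of v w] by (metis linorder_neqE_nat not_less rangeI)

lemma first_less: "i < first w v \<Longrightarrow> i \<le> N \<Longrightarrow> w i \<noteq> v"
  using first_le[of w i] by auto

lemma words_beyond: "w \<in> words \<Longrightarrow> k \<notin> {1..N} \<Longrightarrow> w k = 1"
  by (auto simp: words_iff)

lemma first_1: "w \<in> words \<Longrightarrow> first w 1 = 0"
  by (rule first_eqI) (auto simp: words_0)

lemma first_le_N: "w \<in> words \<Longrightarrow> v \<in> range w \<Longrightarrow> first w v \<le> N"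
  using w_first[of v w] words_beyond[of w "first w v"] first_1[of w] by (cases "v = 1") auto

lemma first_pos: "w \<in> words \<Longrightarrow> v \<noteq> 1 \<Longrightarrow> 0 < first w v"
  using w_first[of v w] words_0[of w] by (cases "v \<in> range w") (auto simp: first_def intro!: Nat.gr0I)

lemma range_words: "w \<in> words \<Longrightarrow> range w \<subseteq> {1..n}"
  using words_in_V by auto

lemma par_1: "par w 1 = 1"
  by (simp add: par_def)

lemma par_outside: "w \<in> words \<Longrightarrow> v \<notin> {1..n} \<Longrightarrow> par w v = v"
  using range_words[of w] by (auto simp: par_def)

lemma par_in: "w \<in> words \<Longrightarrow> v \<in> {1..n} \<Longrightarrow> par w v \<in> {1..n}"
  using words_in_V[of w] n_pos by (auto simp: par_def)

lemma first_par:
  assumes "w \<in> words" "v \<in> {1..n}" "v \<noteq> 1" shows "first w (par w v) < first w v"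
proof (cases "v \<in> range w")
  case True
  then have "first w (par w v) \<le> first w v - 1"
    unfolding par_def using assms first_le by auto
  then show ?thesis using first_pos[OF assms(1,3)] by simp
next
  case False
  then show ?thesis using assms first_1 by (simp add: par_def) (simp add: first_def)
qed

text \<open>The least first occurrence among the words of \<open>W\<close> is a rank: each vertex
  takes its parent from a word where it occurs earliest, and in that word the parent occurs still
  earlier.\<close>

lemma hybrid_in_forest:
  assumes W: "finite W" "W \<subseteq> words" "W \<noteq> {}"
    and Q: "Q 1 = 1" "\<And>v. v \<notin> {1..n} \<Longrightarrow> Q v = v"
      "\<And>v. v \<in> {1..n} \<Longrightarrow> v \<noteq> 1 \<Longrightarrow> \<exists>\<omega>\<in>W. Q v = par \<omega> v \<and> (\<forall>\<omega>'\<in>W. first \<omega> v \<le> first \<omega>' v)"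
  shows "Q \<in> forest {1..n} {1}"
proof (rule forestI_rank[where rk = "\<lambda>v. Min ((\<lambda>\<omega>. first \<omega> v) ` W)"])
  fix v assume v: "v \<in> {1..n}" "v \<notin> {1}"
  then obtain \<omega> where \<omega>: "\<omega> \<in> W" "Q v = par \<omega> v" "\<forall>\<omega>'\<in>W. first \<omega> v \<le> first \<omega>' v"
    using Q(3) by blast
  have "Min ((\<lambda>\<omega>. first \<omega> (Q v)) ` W) \<le> first \<omega> (par \<omega> v)" using W \<omega> by (intro Min_le) auto
  also have "\<dots> < first \<omega> v" using \<omega> W v by (intro first_par) auto
  also have "\<dots> = Min ((\<lambda>\<omega>. first \<omega> v) ` W)"
    using \<omega> W by (intro Min_eqI[symmetric]) auto
  finally show "Q v \<in> {1..n} \<and> Min ((\<lambda>\<omega>. first \<omega> (Q v)) ` W) < Min ((\<lambda>\<omega>. first \<omega> v) ` W)"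
    using \<omega> W v par_in by auto
qed (use Q n_pos in auto)

lemma par_in_forest: "w \<in> words \<Longrightarrow> par w \<in> forest {1..n} {1}"
  by (rule hybrid_in_forest[of "{w}"]) (auto simp: par_1 par_outside)

section \<open>The effect of changing one letter\<close>

context
  fixes w :: "nat \<Rightarrow> nat" and j y :: nat
  assumes w: "w \<in> words" and j: "j \<in> {1..N}" and y: "y \<in> {1..n}"
begin

lemma first_upd: "v \<notin> {w j, y} \<Longrightarrow> first (w(j := y)) v = first w v"
proof -
  assume v: "v \<notin> {w j, y}"
  then have *: "(w(j := y)) k = v \<longleftrightarrow> w k = v" for k by auto
  then have "v \<in> range (w(j := y)) \<longleftrightarrow> v \<in> range w" unfolding image_iff by metis
  then show ?thesis unfolding first_def * by simp
qed

lemma first_upd_new: "first (w(j := y)) y \<le> first w y"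
proof (cases "y \<in> range w \<and> first w y \<noteq> j")
  case True
  then have "(w(j := y)) (first w y) = y" using w_first by auto
  then show ?thesis using first_le by metis
next
  case False
  have "first (w(j := y)) ((w(j := y)) j) \<le> j" by (rule first_le)
  then show ?thesis using False j by (auto simp: first_def)
qed

lemma first_upd_old: "w j \<noteq> y \<Longrightarrow> first w (w j) \<le> first (w(j := y)) (w j)"
proof -
  assume xy: "w j \<noteq> y"
  show ?thesis
  proof (cases "w j \<in> range (w(j := y))")
    case True
    then have "w (first (w(j := y)) (w j)) = w j"
      using w_first[OF True] xy by (auto simp: fun_upd_def split: if_splits)
    then show ?thesis using first_le by metis
  next
    case False
    then show ?thesis using first_le_N[OF w, of "w j"] by (auto simp: first_def)
  qed
qed

text \<open>Besides the two letters involved, only the letter right after position \<open>j\<close>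
  can get a new parent, namely if it occurs there for the first time.\<close>

lemma par_upd_other:
  assumes v: "v \<notin> {w j, y}" "par (w(j := y)) v \<noteq> par w v"
  shows "par w v = w j" "par (w(j := y)) v = y" "v = w (Suc j)"
proof -
  have *: "(w(j := y)) k = v \<longleftrightarrow> w k = v" for k using v by auto
  then have r: "v \<in> range (w(j := y)) \<longleftrightarrow> v \<in> range w" unfolding image_iff by metis
  have f: "first (w(j := y)) v = first w v" using first_upd v by blast
  have v1: "v \<noteq> 1" "v \<in> range w" using v r by (auto simp: par_def split: if_splits)
  then have "(w(j := y)) (first w v - 1) \<noteq> w (first w v - 1)"
    using v r f by (simp add: par_def)
  then have k: "first w v - 1 = j" by (auto split: if_splits)
  then have "first w v = Suc j" using first_pos[OF w v1(1)] by simp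
  then show "v = w (Suc j)" using w_first[OF v1(2)] by simp
  show "par w v = w j" "par (w(j := y)) v = y" using v1 k r f by (simp_all add: par_def)
qed

lemma par_upd: "par (w(j := y)) v \<noteq> par w v \<Longrightarrow> v \<in> {w j, y} \<or> par w v = w j \<and> par (w(j := y)) v = y"
  using par_upd_other by blast

lemma par_upd_new:
  assumes "y \<noteq> w j" "par (w(j := y)) y \<noteq> par w y"
  shows "par (w(j := y)) y = w (j - 1)"
proof -
  have y1: "y \<noteq> 1" using assms par_1 by metis
  have r: "y \<in> range (w(j := y))" by (metis fun_upd_same rangeI)
  have le: "first (w(j := y)) y \<le> j" using first_le[of "w(j := y)" j] by simp
  have "first (w(j := y)) y = j"
  proof (rule ccontr)
    assume "first (w(j := y)) y \<noteq> j"
    then have lt: "first (w(j := y)) y < j" using le by simp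
    then have wf: "w (first (w(j := y)) y) = y" using w_first[OF r] by auto
    then have "first w y = first (w(j := y)) y" using first_le first_upd_new by (metis order_antisym)
    moreover have "y \<in> range w" using wf by (metis rangeI)
    ultimately have "par (w(j := y)) y = par w y" using lt wf y1 r by (auto simp: par_def)
    then show False using assms by simp
  qed
  moreover have "j - 1 \<noteq> j" using j by auto
  ultimately show ?thesis using y1 r by (simp add: par_def)
qed

lemma par_upd_old:
  assumes "y \<noteq> w j" "par (w(j := y)) (w j) \<noteq> par w (w j)"
  shows "first w (w j) = j"
proof (rule ccontr)
  assume "first w (w j) \<noteq> j"
  then have lt: "first w (w j) < j" using first_le[of w j] by simp
  have f: "w (first w (w j)) = w j" using w_first[of "w j" w] by simp
  then have "first (w(j := y)) (w j) \<le> first w (w j)" using first_le[of "w(j := y)" "first w (w j)"] lt by simp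
  then have e: "first (w(j := y)) (w j) = first w (w j)" using first_upd_old assms by simp
  moreover have "w j \<in> range (w(j := y))" using f lt by (metis fun_upd_apply less_irrefl rangeI)
  ultimately have "par (w(j := y)) (w j) = par w (w j)" using lt by (auto simp: par_def)
  then show False using assms by simp
qed

text \<open>Consider the last changed edge of the walk. The rest lies in the old tree and starts, up
  to an edge of that tree, at one of the three listed letters, unless the changed edge leads from
  \<open>w j\<close> to its new parent. That case is kept in two forms: counts for the word itself
  use the first, counts after resampling the second.\<close>

lemma near_upd_reduce:
  assumes "near (tree (w(j := y))) R z b"
  shows "near (tree w) R z b \<or>
    (\<exists>u\<in>{w j, y, w (j - 1)}. near (tree w) R u b) \<or>
    first w (w j) = j \<and> near (tree w) R (par (w(j := y)) (w j)) b \<and> near (tree (w(j := y))) R (w j) b"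
  using assms
proof (induction R arbitrary: z)
  case (Suc R)
  let ?ok = "\<lambda>R. (\<exists>u\<in>{w j, y, w (j - 1)}. near (tree w) R u b) \<or>
    first w (w j) = j \<and> near (tree w) R (par (w(j := y)) (w j)) b \<and> near (tree (w(j := y))) R (w j) b"
  have mono: "?ok R \<Longrightarrow> ?ok (Suc R)" by (meson near.simps(2))
  from Suc.prems consider "near (tree (w(j := y))) R z b" | z1 where "{z, z1} \<in> tree (w(j := y))" "near (tree (w(j := y))) R z1 b"
    unfolding near.simps by blast
  then show ?case
  proof cases
    case 1 then show ?thesis using Suc.IH mono by (meson near.simps(2))
  next
    case 2
    from Suc.IH[OF 2(2)] consider "?ok R" | "near (tree w) R z1 b" "{z, z1} \<in> tree w"
      | "near (tree w) R z1 b" "{z, z1} \<notin> tree w" by blast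
    then show ?thesis
    proof cases
      case 1 then show ?thesis using mono by blast
    next
      case 2 then show ?thesis by auto
    next
      case 3
      then have "w j \<noteq> y" using 2 by (metis fun_upd_triv)
      show ?thesis
      proof (cases "z1 \<in> {w j, y}")
        case True then show ?thesis using 3 mono by blast
      next
        case z1: False
        obtain v where v: "z = v \<and> z1 = par (w(j := y)) v \<or> z1 = v \<and> z = par (w(j := y)) v" "par (w(j := y)) v \<noteq> v"
          using 2(1) unfolding edges_iff by metis
        have ch: "par (w(j := y)) v \<noteq> par w v" using v 3(2) by (auto simp: edges_iff)
        from v(1) show ?thesis
        proof
          assume zv: "z = v \<and> z1 = par (w(j := y)) v"
          show ?thesis
          proof (cases "v \<in> {w j, y}")
            case True
            then consider "v = y" | "v = w j" by auto
            then show ?thesis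
            proof cases
              case 1
              then show ?thesis using par_upd_new \<open>w j \<noteq> y\<close> ch zv 3 mono by (auto simp del: fun_upd_apply)
            next
              case 2
              then have "first w (w j) = j" using par_upd_old \<open>w j \<noteq> y\<close> ch by blast
              moreover have "near (tree w) (Suc R) (par (w(j := y)) (w j)) b" using 2 zv 3 by simp
              moreover have "near (tree (w(j := y))) (Suc R) (w j) b" using Suc.prems 2 zv by blast
              ultimately show ?thesis by blast
            qed
          next
            case False
            then show ?thesis using par_upd_other[OF _ ch] zv z1 by (auto simp del: fun_upd_apply)
          qed
        next
          assume zv: "z1 = v \<and> z = par (w(j := y)) v"
          then have "par w v = w j" using par_upd_other(1)[OF _ ch] z1 by blast
          then have "{w j, v} \<in> tree w" using z1 zv by (auto simp: edges_iff)
          then have "near (tree w) (Suc R) (w j) b" using 3 zv by auto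
          then show ?thesis by blast
        qed
      qed
    qed
  qed
qed auto

end

end

text \<open>A change of one letter from \<open>x\<close> to \<open>y\<close> alters at most three parents. They are changed one at a
  time, first that of \<open>y\<close>, last that of \<open>x\<close>: in this order all intermediate parent functions are
  acyclic.\<close>

definition stage :: "nat \<Rightarrow> nat \<Rightarrow> nat \<Rightarrow> nat set" where
  "stage s x y = (if s = 0 then {} else if s = 1 then {y} else if s = 2 then - {x} else UNIV)"

text \<open>The words, \<open>False\<close> for the old and \<open>True\<close> for the new one,
  that supply parents at stage \<open>s\<close>.\<close>

definition stage_choices :: "nat \<Rightarrow> bool set" where
  "stage_choices s = (if s = 0 then {False} else if s < 3 then {False, True} else {True})"

definition stage_vertex :: "nat \<Rightarrow> nat \<Rightarrow> nat \<Rightarrow> nat \<Rightarrow> nat" where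
  "stage_vertex s x y q = (if s = 0 then y else if s = 1 then q else x)"

lemma stage_mem: "s \<le> 3 \<Longrightarrow> (v \<in> stage s x y) \<in> stage_choices s"
  by (auto simp: stage_def stage_choices_def)

lemma stage_Suc: "s < 3 \<Longrightarrow> x \<noteq> y \<Longrightarrow> v \<in> stage s x y \<Longrightarrow> v \<in> stage (Suc s) x y"
  by (auto simp: stage_def One_nat_def)

lemma stage_diff:
  "s < 3 \<Longrightarrow> v \<in> stage (Suc s) x y \<Longrightarrow> v \<notin> stage s x y \<Longrightarrow> v \<in> {x, y, q} \<Longrightarrow> x \<noteq> y \<Longrightarrow> v = stage_vertex s x y q"
  by (auto simp: stage_def stage_vertex_def One_nat_def split: if_splits)

section \<open>One or two letter changes as sequences of parent switches\<close>

context tree_words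
begin

text \<open>The change brings the first occurrence of \<open>y\<close> forward and delays that of
  \<open>w j\<close>. Hence at every stage each vertex takes its parent from a word where it occurs
  earliest, as \<open>hybrid_in_forest\<close> demands.\<close>

lemma first_stage:
  assumes "w \<in> words" "j \<in> {1..N}" "y \<in> {1..n}" "w j \<noteq> y" "\<sigma> \<in> stage_choices s"
  shows "first (if v \<in> stage s (w j) y then w(j := y) else w) v \<le> first (if \<sigma> then w(j := y) else w) v"
proof -
  note f = first_upd[OF assms(1-3)] first_upd_new[OF assms(1-3)] first_upd_old[OF assms(1-4)]
  consider "v \<notin> {w j, y}" | "v = y" | "v = w j" by auto
  then show ?thesis
    using f assms(4,5) by cases (auto simp: stage_def stage_choices_def simp del: fun_upd_apply split: if_splits)
qed

definition corner :: "(nat \<Rightarrow> nat) \<Rightarrow> nat \<Rightarrow> nat \<Rightarrow> nat \<Rightarrow> nat \<Rightarrow> bool \<Rightarrow> bool \<Rightarrow> nat \<Rightarrow> nat" where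
  "corner w j y a c \<sigma> \<tau> = (let w' = (if \<tau> then w(a := c) else w) in if \<sigma> then w'(j := y) else w')"

lemma corner_simps:
  "corner w j y a c False False = w" "corner w j y a c True False = w(j := y)"
  "corner w j y a c False True = w(a := c)" "corner w j y a c True True = w(a := c, j := y)"
  by (simp_all add: corner_def)

lemma corner_j: "corner w j y a c True \<tau> = (corner w j y a c False \<tau>)(j := y)"
  by (simp add: corner_def)

lemma corner_a: "j \<noteq> a \<Longrightarrow> corner w j y a c \<sigma> True = (corner w j y a c \<sigma> False)(a := c)"
  by (auto simp: corner_def)

lemma corner_at:
  "j \<noteq> a \<Longrightarrow> corner w j y a c False \<tau> j = w j" "j \<noteq> a \<Longrightarrow> corner w j y a c \<sigma> False a = w a"
  by (auto simp: corner_def)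

lemma corner_words:
  "w \<in> words \<Longrightarrow> j \<in> {1..N} \<Longrightarrow> y \<in> {1..n} \<Longrightarrow> a \<in> {1..N} \<Longrightarrow> c \<in> {1..n} \<Longrightarrow> corner w j y a c \<sigma> \<tau> \<in> words"
  unfolding corner_def Let_def by (auto intro!: upd_words simp del: fun_upd_apply)

lemma lipschitz_words:
  assumes F: "tree_lipschitz n \<alpha> F" "0 \<le> \<alpha>"
    and w: "w \<in> words" and j: "j \<in> {1..N}" and y: "y \<in> {1..n}"
  shows "\<bar>F (tree w) - F (tree (w(j := y)))\<bar> \<le> 3 * \<alpha>"
proof (cases "w j = y")
  case True
  then have "w(j := y) = w" by auto
  then show ?thesis using F by simp
next
  case False
  define Q where "Q = (\<lambda>s v. par (if v \<in> stage s (w j) y then w(j := y) else w) v)"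
  have w': "w(j := y) \<in> words" by (rule upd_words[OF w j y])
  have Q: "Q s \<in> forest {1..n} {1}" if "s \<le> 3" for s
  proof (rule hybrid_in_forest[of "(\<lambda>\<sigma>. if \<sigma> then w(j := y) else w) ` stage_choices s"])
    fix v
    show "\<exists>\<omega>\<in>(\<lambda>\<sigma>. if \<sigma> then w(j := y) else w) ` stage_choices s. Q s v = par \<omega> v \<and>
      (\<forall>\<omega>'\<in>(\<lambda>\<sigma>. if \<sigma> then w(j := y) else w) ` stage_choices s. first \<omega> v \<le> first \<omega>' v)"
      unfolding Q_def using stage_mem[OF that, of v "w j" y] first_stage[OF w j y False, of True s v]
        first_stage[OF w j y False, of False s v]
      by (intro bexI[of _ "if v \<in> stage s (w j) y then w(j := y) else w"])
        (auto simp del: fun_upd_apply intro: rev_image_eqI)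
  qed (use w w' in \<open>auto simp: Q_def par_1 par_outside stage_choices_def simp del: fun_upd_apply\<close>)
  have step: "\<bar>F (edges (Q s)) - F (edges (Q (Suc s)))\<bar> \<le> \<alpha>" if s: "s < 3" for s
  proof -
    define i where "i = stage_vertex s (w j) y (w (Suc j))"
    have "Q (Suc s) v = Q s v" if "v \<noteq> i" for v
    proof (rule ccontr)
      assume *: "Q (Suc s) v \<noteq> Q s v"
      then have d: "v \<in> stage (Suc s) (w j) y" "v \<notin> stage s (w j) y" "par (w(j := y)) v \<noteq> par w v"
        using stage_Suc[OF s False] unfolding Q_def by (auto simp del: fun_upd_apply split: if_splits)
      then have "v \<in> {w j, y, w (Suc j)}" using par_upd_other(3)[OF w j y _ d(3)] by blast
      then show False using stage_diff[OF s d(1,2) _ False] \<open>v \<noteq> i\<close> by (simp add: i_def)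
    qed
    then have "Q (Suc s) = (Q s)(i := Q (Suc s) i)" by auto
    then show ?thesis using lipschitz_forest[OF F Q[of s], of i "Q (Suc s) i"] Q[of "Suc s"] s by simp
  qed
  have "Q 0 = par w" "Q 3 = par (w(j := y))" by (auto simp: Q_def stage_def fun_eq_iff)
  then show ?thesis
    using step[of 0] step[of 1] step[of 2] by (simp add: One_nat_def numeral_eq_Suc abs_le_iff) 
qed

text \<open>Both changes are split into three switches, and the mixed difference telescopes over a
  grid of nine squares. A square is trivial unless both of its switches move a parent. Otherwise
  superposability applies, because short walks in an intermediate graph reduce to short walks in one
  of the four corner trees.\<close>

lemma second_difference:
  assumes F: "superposable n \<rho> F"
    and w: "w \<in> words" and j: "j \<in> {1..N}" and y: "y \<in> {1..n}"
    and a: "a \<in> {1..N}" and c: "c \<in> {1..n}" and ja: "j \<noteq> a"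
    and R: "\<And>r. real r < \<rho> \<Longrightarrow> r + 2 \<le> R" "1 \<le> R"
    and far: "\<And>\<sigma> \<tau> u v. u \<in> {w j, y} \<Longrightarrow> v \<in> {w a, c} \<Longrightarrow> \<not> near (tree (corner w j y a c \<sigma> \<tau>)) R u v"
  shows "F (tree (w(a := c, j := y))) - F (tree (w(j := y))) - F (tree (w(a := c))) + F (tree w) = 0"
proof (cases "w j = y \<or> w a = c")
  case True
  then show ?thesis
  proof
    assume "w j = y"
    then have "w(j := y) = w" "w(a := c, j := y) = w(a := c)" using ja by auto
    then show ?thesis by simp
  next
    assume "w a = c"
    then have "w(a := c) = w" by auto
    then show ?thesis by simp
  qed
next
  case False
  let ?x = "w j" and ?x' = "w a"
  have xy: "?x \<noteq> y" "?x' \<noteq> c" using False by auto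
  define wd where "wd = corner w j y a c"
  define P where "P = (\<lambda>\<sigma> \<tau>. par (wd \<sigma> \<tau>))"
  have wdw: "wd \<sigma> \<tau> \<in> words" for \<sigma> \<tau> unfolding wd_def using corner_words w j y a c by blast
  have wdj: "wd True \<tau> = (wd False \<tau>)(j := y)" "wd False \<tau> j = ?x" for \<tau>
    unfolding wd_def using corner_j corner_at ja by auto
  have wda: "wd \<sigma> True = (wd \<sigma> False)(a := c)" "wd \<sigma> False a = ?x'" for \<sigma>
    unfolding wd_def using corner_a corner_at ja by auto
  have disj: "{?x, y} \<inter> {?x', c} = {}"
    using far near_refl by blast
  have edge_far: "{u, v} \<notin> tree (wd \<sigma> \<tau>)" if "u \<in> {?x, y}" "v \<in> {?x', c}" for u v \<sigma> \<tau>
    using far[OF that, of \<sigma> \<tau>] near_mono[OF near_edge, of u v _ R] R(2) unfolding wd_def by (auto simp: One_nat_def)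
  have cj: "P True \<tau> v \<noteq> P False \<tau> v \<Longrightarrow> v \<in> {?x, y} \<or> P False \<tau> v = ?x \<and> P True \<tau> v = y" for \<tau> v
    using par_upd[OF wdw[of False \<tau>] j y, of v] unfolding P_def wdj by simp
  have ca: "P \<sigma> True v \<noteq> P \<sigma> False v \<Longrightarrow> v \<in> {?x', c} \<or> P \<sigma> False v = ?x' \<and> P \<sigma> True v = c" for \<sigma> v
    using par_upd[OF wdw[of \<sigma> False] a c, of v] unfolding P_def wda by simp
  have na1: "P \<sigma> \<tau> v \<notin> {?x', c}" if "v \<in> {?x, y}" for \<sigma> \<tau> v
  proof
    assume *: "P \<sigma> \<tau> v \<in> {?x', c}"
    then have "{v, P \<sigma> \<tau> v} \<in> tree (wd \<sigma> \<tau>)" using that disj unfolding P_def edges_iff by auto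
    then show False using edge_far[OF that *] by blast
  qed
  have na2: "P \<sigma> \<tau> v \<notin> {?x, y}" if "v \<in> {?x', c}" for \<sigma> \<tau> v
  proof
    assume *: "P \<sigma> \<tau> v \<in> {?x, y}"
    then have "{P \<sigma> \<tau> v, v} \<in> tree (wd \<sigma> \<tau>)" using that disj unfolding P_def edges_iff by auto
    then show False using edge_far[OF * that] by blast
  qed
  note NI = noninterference[of P, OF cj ca disj na1 na2]
  \<comment> \<open>The vertices moved by either change. By noninterference the two sets are
    disjoint, and each vertex moves in the same way whatever the other change does.\<close>
  define Cj where "Cj = {v. P True False v \<noteq> P False False v}"
  define Ca where "Ca = {v. P False True v \<noteq> P False False v}"
  have Cj: "P False \<tau> v = P False False v" "P True \<tau> v = P True False v" if "v \<in> Cj" for v \<tau>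
    using NI(1)[of v] that by (cases \<tau>; simp add: Cj_def)+
  have Ca: "P \<sigma> False v = P False False v" "P \<sigma> True v = P False True v" if "v \<in> Ca" for v \<sigma>
    using NI(1)[of v] NI(2)[of v] that by (cases \<sigma>; auto simp add: Ca_def)+
  have CC: "Cj \<inter> Ca = {}" using NI(1) by (auto simp: Cj_def Ca_def)
  have nCj: "P True \<tau> v = P False \<tau> v" if "v \<notin> Cj" for v \<tau>
    using NI(2)[of v] that by (cases \<tau>; simp add: Cj_def)
  have nCa: "P \<sigma> True v = P \<sigma> False v" if "v \<notin> Ca" for v \<sigma>
    using NI(1)[of v] NI(2)[of v] that by (cases \<sigma>; cases "v \<in> Cj"; simp add: Cj_def Ca_def)
  define Q where "Q = (\<lambda>s t v. P (v \<in> stage s ?x y) (v \<in> stage t ?x' c) v)"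
  have Q: "Q s t \<in> forest {1..n} {1}" if st: "s \<le> 3" "t \<le> 3" for s t
  proof (rule hybrid_in_forest[of "(\<lambda>(\<sigma>, \<tau>). wd \<sigma> \<tau>) ` (stage_choices s \<times> stage_choices t)"])
    fix v
    have "first (wd (v \<in> stage s ?x y) (v \<in> stage t ?x' c)) v \<le> first (wd \<sigma> \<tau>) v"
      if "\<sigma> \<in> stage_choices s" "\<tau> \<in> stage_choices t" for \<sigma> \<tau>
    proof -
      have "first (wd (v \<in> stage s ?x y) (v \<in> stage t ?x' c)) v \<le> first (wd \<sigma> (v \<in> stage t ?x' c)) v"
        using first_stage[OF wdw j y _ that(1), of False "v \<in> stage t ?x' c" v] xy unfolding wdj(2)
        by (cases \<sigma>; cases "v \<in> stage s ?x y"; simp add: wdj(1) del: fun_upd_apply)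
      also have "\<dots> \<le> first (wd \<sigma> \<tau>) v"
        using first_stage[OF wdw a c _ that(2), of \<sigma> False v] xy unfolding wda(2)
        by (cases \<tau>; cases "v \<in> stage t ?x' c"; simp add: wda(1) del: fun_upd_apply)
      finally show ?thesis .
    qed
    then show "\<exists>\<omega>\<in>(\<lambda>(\<sigma>, \<tau>). wd \<sigma> \<tau>) ` (stage_choices s \<times> stage_choices t). Q s t v = par \<omega> v \<and>
      (\<forall>\<omega>'\<in>(\<lambda>(\<sigma>, \<tau>). wd \<sigma> \<tau>) ` (stage_choices s \<times> stage_choices t). first \<omega> v \<le> first \<omega>' v)"
      using stage_mem[OF st(1), of v ?x y] stage_mem[OF st(2), of v ?x' c]
      by (intro bexI[of _ "wd (v \<in> stage s ?x y) (v \<in> stage t ?x' c)"]) (auto simp: Q_def P_def)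
  qed (use wdw in \<open>auto simp: Q_def P_def par_1 par_outside stage_choices_def\<close>)
  \<comment> \<open>Moved vertices with their old and new parents. Apart from edges common to all
    four corners, an intermediate graph has only edges inside \<open>Ej\<close> or inside
    \<open>Ea\<close>.\<close>
  define Ej where "Ej = (\<Union>v\<in>Cj. {v, P False False v, P True False v})"
  define Ea where "Ea = (\<Union>v\<in>Ca. {v, P False False v, P False True v})"
  define Com where "Com = (\<Inter>\<sigma>. \<Inter>\<tau>. tree (wd \<sigma> \<tau>))"
  have QE: "edges (Q s t) \<subseteq> Com \<union> {e. e \<subseteq> Ej} \<union> {e. e \<subseteq> Ea}" for s t
  proof
    fix e assume "e \<in> edges (Q s t)"
    then obtain v where v: "e = {v, Q s t v}" "Q s t v \<noteq> v" by (auto simp: edges_def)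
    consider "v \<in> Cj" | "v \<in> Ca" | "v \<notin> Cj" "v \<notin> Ca" by blast
    then show "e \<in> Com \<union> {e. e \<subseteq> Ej} \<union> {e. e \<subseteq> Ea}"
    proof cases
      case 1
      then have "Q s t v = P False False v \<or> Q s t v = P True False v"
        unfolding Q_def using Cj[of v] by (cases "v \<in> stage s ?x y") auto
      then show ?thesis using 1 v unfolding Ej_def by blast
    next
      case 2
      then have "Q s t v = P False False v \<or> Q s t v = P False True v"
        unfolding Q_def using Ca[of v] by (cases "v \<in> stage t ?x' c") auto
      then show ?thesis using 2 v unfolding Ea_def by blast
    next
      case 3
      then have "P \<sigma> \<tau> v = P False False v" for \<sigma> \<tau> using nCj[of v] nCa[of v] by (cases \<sigma>; cases \<tau>) auto
      then have "P \<sigma> \<tau> v = Q s t v" for \<sigma> \<tau> unfolding Q_def by metis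
      then show ?thesis using v unfolding Com_def P_def by (auto simp: edges_def)
    qed
  qed
  \<comment> \<open>The flag \<open>\<sigma>\<close> depends on \<open>u\<close> but works for both
    \<open>\<tau>\<close>, and dually for \<open>Ea\<close>. So one corner serves both ends of a
    walk, at the price of one more edge at each end: the 2 in \<open>r + 2 \<le> R\<close>.\<close>
  have Ej_near: "\<exists>\<sigma>. \<forall>\<tau>. \<exists>z\<in>{?x, y}. near (tree (wd \<sigma> \<tau>)) 1 z u" if u: "u \<in> Ej" for u
  proof -
    obtain v where v: "v \<in> Cj" "u \<in> {v, P False False v, P True False v}" using u by (auto simp: Ej_def)
    have e: "near (tree (wd \<sigma> \<tau>)) 1 v (P \<sigma> False v) \<and> near (tree (wd \<sigma> \<tau>)) 1 (P \<sigma> False v) v" for \<sigma> \<tau>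
    proof -
      have "P \<sigma> \<tau> v = P \<sigma> False v" using Cj[OF v(1)] by (cases \<sigma>) auto
      then have "near (tree (wd \<sigma> \<tau>)) 1 v (P \<sigma> False v)"
        unfolding P_def by (cases "par (wd \<sigma> \<tau>) v = v") (auto simp: One_nat_def edges_iff)
      then show ?thesis using near_sym by blast
    qed
    from cj[of False v] v(1) consider "v \<in> {?x, y}" | "P False False v = ?x" "P True False v = y"
      by (auto simp: Cj_def)
    then show ?thesis
    proof cases
      case 1
      then show ?thesis using v(2) e near_refl by (metis insertE singletonD)
    next
      case 2
      then show ?thesis using v(2) e near_refl by (metis insertCI insertE singletonD)
    qed
  qed
  have Ea_near: "\<exists>\<tau>. \<forall>\<sigma>. \<exists>z\<in>{?x', c}. near (tree (wd \<sigma> \<tau>)) 1 u z" if u: "u \<in> Ea" for u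
  proof -
    obtain v where v: "v \<in> Ca" "u \<in> {v, P False False v, P False True v}" using u by (auto simp: Ea_def)
    have e: "near (tree (wd \<sigma> \<tau>)) 1 v (P False \<tau> v) \<and> near (tree (wd \<sigma> \<tau>)) 1 (P False \<tau> v) v" for \<sigma> \<tau>
    proof -
      have "P \<sigma> \<tau> v = P False \<tau> v" using Ca[OF v(1)] by (cases \<tau>) auto
      then have "near (tree (wd \<sigma> \<tau>)) 1 v (P False \<tau> v)"
        unfolding P_def by (cases "par (wd \<sigma> \<tau>) v = v") (auto simp: One_nat_def edges_iff)
      then show ?thesis using near_sym by blast
    qed
    from ca[of False v] v(1) consider "v \<in> {?x', c}" | "P False False v = ?x'" "P False True v = c"
      by (auto simp: Ca_def)
    then show ?thesis
    proof cases
      case 1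
      then show ?thesis using v(2) e near_refl by (metis insertE singletonD)
    next
      case 2
      then show ?thesis using v(2) e near_refl by (metis insertCI insertE singletonD)
    qed
  qed
  have Qfar: "\<not> near (edges (Q s t)) r u v" if "real r < \<rho>" "u \<in> Ej" "v \<in> Ea" for s t r u v
  proof
    assume "near (edges (Q s t)) r u v"
    then obtain u' v' where uv: "u' \<in> Ej" "v' \<in> Ea" "near Com r u' v'"
      using near_reduce[OF QE _ \<open>v \<in> Ea\<close>] \<open>u \<in> Ej\<close> by blast
    obtain \<sigma> where \<sigma>: "\<And>\<tau>. \<exists>z\<in>{?x, y}. near (tree (wd \<sigma> \<tau>)) 1 z u'" using Ej_near[OF uv(1)] by blast
    obtain \<tau> where \<tau>: "\<And>\<sigma>. \<exists>z\<in>{?x', c}. near (tree (wd \<sigma> \<tau>)) 1 v' z" using Ea_near[OF uv(2)] by blast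
    obtain z z' where z: "z \<in> {?x, y}" "near (tree (wd \<sigma> \<tau>)) 1 z u'" "z' \<in> {?x', c}" "near (tree (wd \<sigma> \<tau>)) 1 v' z'"
      using \<sigma>[of \<tau>] \<tau>[of \<sigma>] by blast
    have "near (tree (wd \<sigma> \<tau>)) r u' v'"
      using uv(3) by (rule near_mono_graph) (auto simp: Com_def)
    then have "near (tree (wd \<sigma> \<tau>)) (1 + r + 1) z z'"
      using z near_trans by blast
    then have "near (tree (wd \<sigma> \<tau>)) R z z'"
      using R(1)[OF \<open>real r < \<rho>\<close>] by (elim near_mono) auto
    then show False using far z unfolding wd_def by blast
  qed
  define S where "S = (\<lambda>s t. F (edges (Q s t)))"
  have cell: "S (Suc s) (Suc t) - S (Suc s) t - S s (Suc t) + S s t = 0" if st: "s < 3" "t < 3" for s t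
  proof -
    define i where "i = stage_vertex s ?x y (w (Suc j))"
    define b where "b = stage_vertex t ?x' c (w (Suc a))"
    have chj: "v = i \<and> v \<in> Cj \<and> v \<in> stage (Suc s) ?x y \<and> v \<notin> stage s ?x y" if "Q (Suc s) t v \<noteq> Q s t v" for v t
    proof -
      have d: "v \<in> stage (Suc s) ?x y" "v \<notin> stage s ?x y" and v: "v \<in> Cj"
        using that stage_Suc[OF st(1) xy(1), of v] nCj[of v] unfolding Q_def by (auto split: if_splits) metis+
      have "par (w(j := y)) v \<noteq> par w v"
        using v unfolding Cj_def P_def wd_def corner_simps by simp
      then have "v \<in> {?x, y, w (Suc j)}" using par_upd_other(3)[OF w j y, of v] by blast
      then show ?thesis using stage_diff[OF st(1) d _ xy(1)] d v by (auto simp: i_def)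
    qed
    have cha: "v = b \<and> v \<in> Ca \<and> v \<in> stage (Suc t) ?x' c \<and> v \<notin> stage t ?x' c" if "Q s (Suc t) v \<noteq> Q s t v" for v s
    proof -
      have d: "v \<in> stage (Suc t) ?x' c" "v \<notin> stage t ?x' c" and v: "v \<in> Ca"
        using that stage_Suc[OF st(2) xy(2), of v] nCa[of v] unfolding Q_def by (auto split: if_splits) metis+
      have "par (w(a := c)) v \<noteq> par w v"
        using v unfolding Ca_def P_def wd_def corner_simps by simp
      then have "v \<in> {?x', c, w (Suc a)}" using par_upd_other(3)[OF w a c, of v] by blast
      then show ?thesis using stage_diff[OF st(2) d _ xy(2)] d v by (auto simp: b_def)
    qed
    consider "Q (Suc s) t = Q s t" "Q (Suc s) (Suc t) = Q s (Suc t)" | "Q s (Suc t) = Q s t" "Q (Suc s) (Suc t) = Q (Suc s) t"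
      | "i \<in> Cj" "i \<in> stage (Suc s) ?x y" "i \<notin> stage s ?x y" "b \<in> Ca" "b \<in> stage (Suc t) ?x' c" "b \<notin> stage t ?x' c"
      using chj cha by (metis ext)
    then show ?thesis
    proof cases
      case 1 then show ?thesis by (simp add: S_def)
    next
      case 2 then show ?thesis by (simp add: S_def)
    next
      case 3
      have ib: "i \<noteq> b" using 3 CC by auto
      define k where "k = Q (Suc s) t i"
      define l where "l = Q s (Suc t) b"
      have Qi: "Q (Suc s) t = (Q s t)(i := k)" using chj[of t] unfolding k_def fun_eq_iff fun_upd_apply by metis
      have Qb: "Q s (Suc t) = (Q s t)(b := l)" using cha[of s] unfolding l_def fun_eq_iff fun_upd_apply by metis
      have ki: "Q (Suc s) (Suc t) i = k"
        unfolding k_def Q_def using Cj(2)[OF 3(1), of "i \<in> stage (Suc t) ?x' c"] Cj(2)[OF 3(1), of "i \<in> stage t ?x' c"] 3(2) by simp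
      have lb: "Q (Suc s) (Suc t) b = l"
        unfolding l_def Q_def using Ca(2)[OF 3(4), of "b \<in> stage (Suc s) ?x y"] Ca(2)[OF 3(4), of "b \<in> stage s ?x y"] 3(5) by simp
      have Qib: "Q (Suc s) (Suc t) = (Q s t)(i := k, b := l)"
      proof
        fix v show "Q (Suc s) (Suc t) v = ((Q s t)(i := k, b := l)) v"
        proof (cases "v = b \<or> v = i")
          case True then show ?thesis using ki lb ib by auto
        next
          case False
          then have "Q (Suc s) (Suc t) v = Q s (Suc t) v" "Q s (Suc t) v = Q s t v"
            using chj[of "Suc t" v] cha[of s v] by blast+
          then show ?thesis using False by simp
        qed
      qed
      have gi: "Q s t i \<in> Ej" "k \<in> Ej"
        unfolding k_def Q_def Ej_def using Cj[OF 3(1), of "i \<in> stage t ?x' c"] 3(1-3) by auto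
      have gb: "Q s t b \<in> Ea" "l \<in> Ea"
        unfolding l_def Q_def Ea_def using Ca[OF 3(4), of "b \<in> stage s ?x y"] 3(4-6) by auto
      have "F (edges ((Q s t)(i := k, b := l))) - F (edges ((Q s t)(i := k))) - F (edges ((Q s t)(b := l))) + F (edges (Q s t)) = 0"
      proof (rule superposable_forest[OF F])
        show "Q s t \<in> forest {1..n} {1}" "(Q s t)(i := k) \<in> forest {1..n} {1}"
          "(Q s t)(b := l) \<in> forest {1..n} {1}" "(Q s t)(i := k, b := l) \<in> forest {1..n} {1}"
          using Q[of s t] Q[of "Suc s" t, unfolded Qi] Q[of s "Suc t", unfolded Qb]
            Q[of "Suc s" "Suc t", unfolded Qib] st by simp_all
        show "i \<noteq> b" by (rule ib)
        show "\<not> near (edges (Q s t)) r u v" if "real r < \<rho>" "u \<in> {Q s t i, k}" "v \<in> {Q s t b, l}" for r u v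
          using Qfar[OF that(1)] that gi gb by blast
      qed
      then show ?thesis unfolding S_def Qi Qb Qib .
    qed
  qed
  have "(\<Sum>s<3. \<Sum>t<3. S (Suc s) (Suc t) - S (Suc s) t - S s (Suc t) + S s t) = 0"
    using cell by (simp add: sum.neutral)
  moreover have "(\<Sum>s<3. \<Sum>t<3. S (Suc s) (Suc t) - S (Suc s) t - S s (Suc t) + S s t) = S 3 3 - S 3 0 - S 0 3 + S 0 0"
    by (simp add: numeral_eq_Suc)
  moreover have "Q 0 0 = par w" "Q 3 0 = par (w(j := y))" "Q 0 3 = par (w(a := c))" "Q 3 3 = par (w(a := c, j := y))"
    unfolding Q_def P_def wd_def by (auto simp: stage_def corner_simps)
  ultimately show ?thesis by (simp add: S_def)
qed

end

text \<open>The graph determines which iterates hit the root, hence the depth, and the parent is the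
  neighbour of smaller depth.\<close>

lemma edges_inj_forest: "inj_on edges (forest V {r})"
proof (rule inj_onI)
  fix g h assume g: "g \<in> forest V {r}" and h: "h \<in> forest V {r}" and eq: "edges g = edges h"
  have fix_r: "g r = r" "h r = r" using g h by (auto simp: forest_def)
  have "(g ^^ k) v = r \<longleftrightarrow> (h ^^ k) v = r" for k v
    using near_forest[of g k v r] near_forest[of h k v r] forest_near_root[of k g v r] forest_near_root[of k h v r] fix_r
    unfolding eq by metis
  then have d: "depth g {r} v = depth h {r} v" for v by (simp add: depth_def)
  show "g = h"
  proof
    fix v
    show "g v = h v"
    proof (cases "v \<in> V \<and> v \<noteq> r")
      case True
      then have gv: "depth g {r} (g v) < depth g {r} v" "g v \<noteq> v" "g v \<in> V"
        using forest_rank[OF g, of v] g by (auto simp: forest_def)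
      then have "{v, g v} \<in> edges h" unfolding eq[symmetric] by (auto simp: edges_iff)
      then consider "h v = g v" | "h (g v) = v" by (auto simp: edges_iff)
      then show ?thesis
      proof cases
        case 2
        then have "g v \<noteq> r" using gv fix_r by auto
        then have "depth h {r} v < depth h {r} (g v)" using forest_rank(1)[OF h, of "g v"] 2 gv by auto
        then show ?thesis using gv d by simp
      qed simp
    next
      case False
      then show ?thesis using g h fix_r by (auto simp: forest_def)
    qed
  qed
qed

lemma edges_bij_forest: "r \<in> {1..n} \<Longrightarrow> bij_betw edges (forest {1..n} {r}) (trees n)"
  unfolding bij_betw_def using edges_inj_forest edges_in_trees trees_eq_edges by (metis (no_types, lifting) image_eqI subsetI subset_antisym image_subsetI)

lemma avg_trees_forest: "r \<in> {1..n} \<Longrightarrow> avg (trees n) H = avg (forest {1..n} {r}) (\<lambda>g. H (edges g))"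
  using avg_reindex[OF edges_bij_forest, of r n H] by simp

lemma finite_trees: "finite (trees n)"
  unfolding trees_def graphs_on_def by (rule finite_subset[of _ "Pow (Pow {1..n})"]) auto

section \<open>Uniformity of the tree of a word\<close>

text \<open>Reading a word backwards and moving the root to each letter in turn produces the tree of the word,
  since the parent of a vertex is set for the last time at its first occurrence. Each step preserves the
  uniform distribution on rooted trees.\<close>

definition reroot :: "nat \<Rightarrow> nat \<times> (nat \<Rightarrow> nat) \<Rightarrow> nat \<times> (nat \<Rightarrow> nat)" where
  "reroot x = (\<lambda>(r, g). (x, g(r := x, x := x)))"

lemma reroot_in:
  assumes g: "g \<in> forest V {r}" and "r \<in> V" "x \<in> V"
  shows "g(r := x, x := x) \<in> forest V {x}"
proof (rule forestI_rank[where rk = "\<lambda>v. if v = x then 0 else Suc (depth g {r} v)"])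
  fix v assume v: "v \<in> V" "v \<notin> {x}"
  show "(g(r := x, x := x)) v \<in> V \<and> (if (g(r := x, x := x)) v = x then 0 else Suc (depth g {r} ((g(r := x, x := x)) v)))
      < (if v = x then 0 else Suc (depth g {r} v))"
    using v assms forest_rank(1)[OF g, of v] by (auto simp: forest_def)
qed (use assms in \<open>auto simp: forest_def\<close>)

text \<open>The way up from the former parent of \<open>x\<close> avoids \<open>x\<close>, ends at
  the old root \<open>r\<close>, and now continues from there to \<open>x\<close>. So
  \<open>r\<close> can be read off from the new tree and the former parent as the last vertex before
  \<open>x\<close>.\<close>

lemma reroot_last_step:
  assumes g: "g \<in> forest V {r}" and x: "x \<in> V" and rx: "r \<noteq> x"
  defines "g' \<equiv> g(r := x, x := x)"
  shows "(g' ^^ ((LEAST k. (g' ^^ k) (g x) = x) - 1)) (g x) = r" "(LEAST k. (g' ^^ k) (g x) = x) \<noteq> 0"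
proof -
  let ?w = "g x"
  define d where "d = depth g {r} ?w"
  have w: "?w \<in> V" using g x by (auto simp: forest_def)
  have dr: "(g ^^ d) ?w = r" unfolding d_def depth_def using g w by (auto simp: forest_def intro: LeastI_ex)
  have lt: "m < d \<Longrightarrow> (g ^^ m) ?w \<noteq> r" for m
    unfolding d_def depth_def using not_less_Least[of m "\<lambda>k. (g ^^ k) ?w \<in> {r}"] by auto
  have nx: "(g ^^ m) ?w \<noteq> x" if "m \<le> d" for m
  proof -
    have "(g ^^ i) x \<notin> {r}" if "i < Suc d" for i
      using that rx lt by (cases i) (auto simp: funpow_Suc_right simp del: funpow.simps)
    from reach_depth[OF g x this, of "Suc d" 0 "Suc m"] that
    show ?thesis by (auto simp: funpow_Suc_right simp del: funpow.simps)
  qed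
  have eq: "m \<le> d \<Longrightarrow> (g' ^^ m) ?w = (g ^^ m) ?w" for m
    by (induction m) (use nx lt in \<open>auto simp: g'_def less_imp_le\<close>)
  have "(LEAST k. (g' ^^ k) ?w = x) = Suc d"
  proof (rule Least_equality)
    show "(g' ^^ Suc d) ?w = x" using eq[of d] dr by (simp add: g'_def)
    show "Suc d \<le> k" if "(g' ^^ k) ?w = x" for k
      using that eq[of k] nx[of k] by (cases "k \<le> d") auto
  qed
  then show "(g' ^^ ((LEAST k. (g' ^^ k) (g x) = x) - 1)) (g x) = r" "(LEAST k. (g' ^^ k) (g x) = x) \<noteq> 0"
    using eq[of d] dr by simp_all
qed

lemma reroot_inj:
  assumes x: "x \<in> V"
  shows "inj_on (\<lambda>(r, g). (g(r := x, x := x), g x)) (SIGMA r:V. forest V {r})"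
proof (rule inj_onI, clarsimp)
  fix r g r' g'
  assume r: "r \<in> V" "g \<in> forest V {r}" and r': "r' \<in> V" "g' \<in> forest V {r'}"
    and eq: "g(r := x, x := x) = g'(r' := x, x := x)" "g x = g' x"
  have *: "(LEAST k. (g(r := x, x := x) ^^ k) (g x) = x) = 0 \<longleftrightarrow> r = x" if "g \<in> forest V {r}" for r g
  proof
    assume "r = x"
    then have "g x = x" using that by (auto simp: forest_def)
    then show "(LEAST k. (g(r := x, x := x) ^^ k) (g x) = x) = 0" by simp
  qed (use reroot_last_step(2)[OF that x] in blast)
  have "r = r'"
  proof (cases "r = x")
    case True
    then show ?thesis using *[OF r(2)] *[OF r'(2)] unfolding eq by auto
  next
    case False
    then have "r' \<noteq> x" using *[OF r(2)] *[OF r'(2)] unfolding eq by auto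
    then show ?thesis
      using reroot_last_step(1)[OF r(2) x False] reroot_last_step(1)[OF r'(2) x] unfolding eq by auto
  qed
  moreover have "g v = g' v" for v
  proof (cases "v = x \<or> v = r")
    case True
    then show ?thesis using eq(2) r r' \<open>r = r'\<close> by (auto simp: forest_def)
  next
    case False
    then show ?thesis using fun_cong[OF eq(1), of v] \<open>r = r'\<close> by simp
  qed
  ultimately show "r = r' \<and> g = g'" by auto
qed

lemma card_prod_eq_imp_bij:
  assumes "inj_on f A" "f ` A \<subseteq> B" "finite B" "card A = card B"
  shows "bij_betw f A B"
  using assms by (metis bij_betw_def card_image card_subset_eq)

text \<open>Sending a rooted tree to its rerooted form together with the former parent of
  \<open>x\<close> is injective, and both sides have \<open>n * card (trees n)\<close> elements.
  Hence a uniform rooted tree becomes a uniform tree with root \<open>x\<close>.\<close>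

lemma avg_reroot:
  assumes x: "x \<in> {1..n}"
  shows "avg (SIGMA r:{1..n}. forest {1..n} {r}) (\<lambda>s. H (reroot x s)) = avg (forest {1..n} {x}) (\<lambda>g. H (x, g))"
proof -
  let ?V = "{1..n}"
  have c: "card (forest ?V {r}) = card (trees n)" if "r \<in> ?V" for r
    using edges_bij_forest[OF that] by (rule bij_betw_same_card)
  have "bij_betw (\<lambda>(r, g). (g(r := x, x := x), g x)) (SIGMA r:?V. forest ?V {r}) (forest ?V {x} \<times> ?V)"
  proof (rule card_prod_eq_imp_bij[OF reroot_inj[OF x]])
    show "(\<lambda>(r, g). (g(r := x, x := x), g x)) ` (SIGMA r:?V. forest ?V {r}) \<subseteq> forest ?V {x} \<times> ?V"
      using x by (auto intro!: reroot_in simp del: fun_upd_apply) (auto simp: forest_def)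
    show "finite (forest ?V {x} \<times> ?V)" by (simp add: finite_forest)
    show "card (SIGMA r:?V. forest ?V {r}) = card (forest ?V {x} \<times> ?V)"
      using c x by (subst card_SigmaI) (auto simp: finite_forest card_cartesian_product)
  qed
  from avg_reindex[OF this, of "\<lambda>(g, w). H (x, g)"]
  have "avg (SIGMA r:?V. forest ?V {r}) (\<lambda>s. H (reroot x s)) = avg (forest ?V {x} \<times> ?V) (\<lambda>(g, w). H (x, g))"
    by (simp add: reroot_def case_prod_unfold)
  also have "\<dots> = avg (forest ?V {x}) (\<lambda>g. H (x, g))"
    unfolding avg_Times using x by (intro avg_cong refl avg_const) auto
  finally show ?thesis .
qed

lemma avg_Sigma:
  assumes "finite A" "\<And>x. x \<in> A \<Longrightarrow> finite (B x)" "\<And>x. x \<in> A \<Longrightarrow> card (B x) = c"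
  shows "avg (SIGMA x:A. B x) f = avg A (\<lambda>x. avg (B x) (\<lambda>y. f (x, y)))"
proof -
  have "sum f (SIGMA x:A. B x) = (\<Sum>x\<in>A. \<Sum>y\<in>B x. f (x, y))"
    using assms by (subst sum.Sigma) auto
  moreover have "card (SIGMA x:A. B x) = card A * c"
    using assms by (subst card_SigmaI) auto
  moreover have "(\<Sum>x\<in>A. (\<Sum>y\<in>B x. f (x, y)) / real (card (B x))) = (\<Sum>x\<in>A. \<Sum>y\<in>B x. f (x, y)) / c"
    using assms unfolding sum_divide_distrib[where A = A] by (intro sum.cong) auto
  ultimately show ?thesis unfolding avg_def by (simp add: mult.commute)
qed

section \<open>Running through a word backwards\<close>

context tree_words
begin

text \<open>The letters are read at \<open>N\<close>, \<open>N - 1\<close> and so on; the last of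
  \<open>Suc N\<close> steps reads \<open>w 0 = 1\<close>.\<close>

primrec rerun :: "(nat \<Rightarrow> nat) \<Rightarrow> nat \<Rightarrow> nat \<times> (nat \<Rightarrow> nat) \<Rightarrow> nat \<times> (nat \<Rightarrow> nat)" where
  "rerun w 0 s = s"
| "rerun w (Suc m) s = reroot (w (N - m)) (rerun w m s)"

abbreviation rooted :: "(nat \<times> (nat \<Rightarrow> nat)) set" where
  "rooted \<equiv> SIGMA r:{1..n}. forest {1..n} {r}"

lemma rerun_upd: "m \<le> N \<Longrightarrow> rerun (w(N - m := y)) m s = rerun w m s"
proof -
  have "k \<le> m \<Longrightarrow> m \<le> N \<Longrightarrow> rerun (w(N - m := y)) k s = rerun w k s" for k
  proof (induction k)
    case (Suc k)
    then have "N - k \<noteq> N - m" by auto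
    then show ?case using Suc by simp
  qed simp
  then show "m \<le> N \<Longrightarrow> rerun (w(N - m := y)) m s = rerun w m s" by simp
qed

text \<open>The letter read in a step is independent of the steps before, and rerooting at a uniform
  letter preserves the uniform rooted tree.\<close>

lemma avg_rerun:
  "m \<le> N \<Longrightarrow> avg words (\<lambda>w. avg rooted (\<lambda>s. H (rerun w m s))) = avg rooted H"
proof (induction m arbitrary: H)
  case 0 then show ?case by (simp add: avgW_const)
next
  case (Suc m)
  let ?j = "N - m"
  have j: "?j \<in> {1..N}" using Suc.prems by auto
  have c: "card (forest {1..n} {r}) = card (trees n)" if "r \<in> {1..n}" for r
    using edges_bij_forest[OF that] by (rule bij_betw_same_card)
  have "avg words (\<lambda>w. avg rooted (\<lambda>s. H (rerun w (Suc m) s))) =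
      avg words (\<lambda>w. avg {1..n} (\<lambda>y. avg rooted (\<lambda>s. H (reroot y (rerun w m s)))))"
    using Suc.prems by (subst avg_resample1[OF j]) (simp add: rerun_upd)
  also have "\<dots> = avg {1..n} (\<lambda>y. avg words (\<lambda>w. avg rooted (\<lambda>s. H (reroot y (rerun w m s)))))"
    by (rule avg_swap)
  also have "\<dots> = avg {1..n} (\<lambda>y. avg rooted (\<lambda>s. H (reroot y s)))"
    using Suc.prems Suc.IH[of "\<lambda>s. H (reroot _ s)"] by (intro avg_cong refl) simp
  also have "\<dots> = avg {1..n} (\<lambda>y. avg (forest {1..n} {y}) (\<lambda>g. H (y, g)))"
    by (intro avg_cong refl avg_reroot)
  also have "\<dots> = avg rooted H"
    by (subst avg_Sigma) (auto simp: finite_forest c)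
  finally show ?case .
qed

lemma avg_rerun_final:
  "avg words (\<lambda>w. avg rooted (\<lambda>s. H (rerun w (Suc N) s))) = avg (forest {1..n} {1}) (\<lambda>g. H (1, g))"
proof -
  have "avg words (\<lambda>w. avg rooted (\<lambda>s. H (rerun w (Suc N) s))) = avg words (\<lambda>w. avg rooted (\<lambda>s. H (reroot 1 (rerun w N s))))"
    by (intro avg_cong refl) (simp add: words_0)
  also have "\<dots> = avg rooted (\<lambda>s. H (reroot 1 s))" using avg_rerun[of N "\<lambda>s. H (reroot 1 s)"] by simp
  also have "\<dots> = avg (forest {1..n} {1}) (\<lambda>g. H (1, g))" using n_pos by (intro avg_reroot) auto
  finally show ?thesis .
qed

lemma rerun_in:
  assumes "w \<in> words" "s \<in> rooted" shows "rerun w m s \<in> rooted"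
proof (induction m)
  case (Suc m)
  obtain r g where s: "rerun w m s = (r, g)" "r \<in> {1..n}" "g \<in> forest {1..n} {r}" using Suc by auto
  have "w (N - m) \<in> {1..n}" using words_in_V[OF assms(1)] .
  then show ?case using s reroot_in[OF s(3) s(2)] by (auto simp: reroot_def)
qed (use assms in simp)

lemma rerun_root: "fst (rerun w (Suc m) s) = w (N - m)"
  by (simp add: reroot_def case_prod_unfold)

text \<open>When position \<open>f - 1\<close> is read, \<open>v = w f\<close> is the current root
  and gets the parent \<open>w (f - 1)\<close>. The following steps leave it alone, since
  \<open>v\<close> does not occur at the smaller positions read.\<close>

lemma rerun_par:
  assumes "m \<le> N" "N - m \<le> f" "f \<le> N" "w f = v" "\<And>i. N - m \<le> i \<Longrightarrow> i < f \<Longrightarrow> w i \<noteq> v"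
  shows "snd (rerun w (Suc m) s) v = (if f = N - m then v else w (f - 1))"
  using assms
proof (induction m)
  case 0
  then have f: "f = N" and v: "v = w N" by auto
  show ?case unfolding f v by (simp add: reroot_def case_prod_unfold)
next
  case (Suc m)
  show ?case
  proof (cases "f = N - Suc m")
    case True
    then show ?thesis using Suc.prems by (auto simp: reroot_def case_prod_unfold)
  next
    case False
    then have f: "N - m \<le> f" using Suc.prems by auto
    have IH: "snd (rerun w (Suc m) s) v = (if f = N - m then v else w (f - 1))"
      using Suc.prems f by (intro Suc.IH) auto
    have vx: "v \<noteq> w (N - Suc m)" using Suc.prems(5)[of "N - Suc m"] Suc.prems(2) False by (metis le_refl le_neq_implies_less)
    have root: "fst (rerun w (Suc m) s) = w (N - m)" by (rule rerun_root)
    show ?thesis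
    proof (cases "f = N - m")
      case True
      have "f - 1 = N - Suc m" using True Suc.prems(1) by auto
      then show ?thesis using True False vx root Suc.prems
        by (simp only: rerun.simps(2)[of w "Suc m"]) (simp add: reroot_def case_prod_unfold)
    next
      case False': False
      have "N - Suc m \<le> N - m" by (rule diff_le_mono2) simp
      then have "v \<noteq> w (N - m)" using Suc.prems(5)[of "N - m"] f False' by (metis le_neq_implies_less)
      then show ?thesis using False False' vx root IH
        by (simp only: rerun.simps(2)[of w "Suc m"]) (simp add: reroot_def case_prod_unfold)
    qed
  qed
qed

text \<open>If all letters occur, the starting tree is forgotten. This couples the tree of the word
  with an exactly uniform tree.\<close>

lemma rerun_cover:
  assumes w: "w \<in> words" and cov: "{1..n} \<subseteq> range w" and s: "s \<in> rooted"
  shows "snd (rerun w (Suc N) s) = par w"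
proof
  fix v
  show "snd (rerun w (Suc N) s) v = par w v"
  proof (cases "v \<in> {1..n}")
    case True
    then have r: "v \<in> range w" using cov by auto
    have "snd (rerun w (Suc N) s) v = (if first w v = N - N then v else w (first w v - 1))"
      using first_le_N[OF w r] w_first[OF r] first_less[of _ w v] by (intro rerun_par) auto
    also have "\<dots> = par w v"
      using first_1[OF w] first_pos[OF w, of v] r by (cases "v = 1") (auto simp: par_def)
    finally show ?thesis .
  next
    case False
    have "rerun w (Suc N) s \<in> rooted" using rerun_in[OF w s] .
    then show ?thesis using False par_outside[OF w] by (auto simp: forest_def simp del: rerun.simps)
  qed
qed

lemma rooted_nonempty: "rooted \<noteq> {}" and finite_rooted: "finite rooted"
proof -
  obtain w where "w \<in> words" using words_nonempty by auto
  then have "(1, par w) \<in> rooted" using par_in_forest n_pos by auto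
  then show "rooted \<noteq> {}" by blast
qed (auto simp: finite_forest)

theorem law_of_tree:
  assumes B: "\<And>T T'. T \<in> trees n \<Longrightarrow> T' \<in> trees n \<Longrightarrow> \<bar>H T - H T'\<bar> \<le> B"
  shows "\<bar>avg words (\<lambda>w. H (tree w)) - avg (trees n) H\<bar> \<le> B * avg words (\<lambda>w. of_bool (\<not> {1..n} \<subseteq> range w))"
proof -
  have "avg (trees n) H = avg words (\<lambda>w. avg rooted (\<lambda>s. H (edges (snd (rerun w (Suc N) s)))))"
    using avg_trees_forest[of 1 n H] avg_rerun_final[of "\<lambda>s. H (edges (snd s))"] n_pos by simp
  then have "avg words (\<lambda>w. H (tree w)) - avg (trees n) H =
      avg words (\<lambda>w. avg rooted (\<lambda>s. H (tree w) - H (edges (snd (rerun w (Suc N) s)))))"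
    by (simp add: avg_diff avg_const[OF finite_rooted rooted_nonempty] del: rerun.simps)
  also have "\<bar>\<dots>\<bar> \<le> avg words (\<lambda>w. B * of_bool (\<not> {1..n} \<subseteq> range w))"
  proof (rule avg_abs_mono)
    fix w assume w: "w \<in> words"
    have "\<bar>H (tree w) - H (edges (snd (rerun w (Suc N) s)))\<bar> \<le> B * of_bool (\<not> {1..n} \<subseteq> range w)" if s: "s \<in> rooted" for s
    proof (cases "{1..n} \<subseteq> range w")
      case True
      then show ?thesis using rerun_cover[OF w True s] by (simp del: rerun.simps)
    next
      case False
      have "edges (snd (rerun w (Suc N) s)) \<in> trees n"
        using rerun_in[OF w s, of "Suc N"] edges_in_trees by (auto simp del: rerun.simps)
      then show ?thesis using B[OF edges_in_trees[OF par_in_forest[OF w]]] False by simp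
    qed
    then have "\<bar>avg rooted (\<lambda>s. H (tree w) - H (edges (snd (rerun w (Suc N) s))))\<bar> \<le>
        avg rooted (\<lambda>s. B * of_bool (\<not> {1..n} \<subseteq> range w))"
      by (intro avg_abs_mono) blast
    then show "\<bar>avg rooted (\<lambda>s. H (tree w) - H (edges (snd (rerun w (Suc N) s))))\<bar> \<le> B * of_bool (\<not> {1..n} \<subseteq> range w)"
      by (simp add: avg_const[OF finite_rooted rooted_nonempty])
  qed
  also have "\<dots> = B * avg words (\<lambda>w. of_bool (\<not> {1..n} \<subseteq> range w))" by (rule avg_cmult)
  finally show ?thesis .
qed

end

section \<open>Tools for conditional nearness: moments, visited and unvisited vertices\<close>

lemma near_equivariant:
  assumes "near (edges g) r u v" "\<And>v. \<pi> (\<pi> v) = v" "\<And>v. h (\<pi> v) = \<pi> (g v)"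
  shows "near (edges h) r (\<pi> u) (\<pi> v)"
  using assms(1)
proof (induction r arbitrary: u)
  case (Suc r)
  have "{\<pi> u, \<pi> x} \<in> edges h" if "{u, x} \<in> edges g" for x
    using that assms(2,3) unfolding edges_iff by metis
  then show ?case using Suc by (auto simp: edges_iff)
qed simp

context word_space
begin

lemma avg_prod:
  assumes "finite K" "K \<subseteq> {1..N}"
  shows "avg words (\<lambda>w. \<Prod>k\<in>K. h (w k)) = avg V h ^ card K"
  using assms
proof (induction K)
  case empty then show ?case by (simp add: avgW_const)
next
  case (insert j K)
  have "(\<Prod>k\<in>insert j K. h ((w(j := y)) k)) = h y * (\<Prod>k\<in>K. h (w k))" for w y
    using insert.hyps by (subst prod.insert) (auto intro!: prod.cong)
  then have "avg words (\<lambda>w. \<Prod>k\<in>insert j K. h (w k)) = avg words (\<lambda>w. avg V (\<lambda>y. h y * (\<Prod>k\<in>K. h (w k))))"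
    using insert.prems by (subst avg_resample1[of j]) simp_all
  also have "\<dots> = avg V h * avg words (\<lambda>w. \<Prod>k\<in>K. h (w k))"
    by (simp only: avg_multc avg_cmult)
  finally show ?case using insert by simp
qed

text \<open>Letters are added one at a time: the partial sum ignores the next letter, so the cross
  term gains a factor \<open>p\<close>, and the square of \<open>x j w\<close> is at most
  \<open>x j w\<close>. The result is the bound for independent indicators.\<close>

lemma predictable_second_moment:
  fixes x :: "nat \<Rightarrow> (nat \<Rightarrow> 'a) \<Rightarrow> real" and p :: real
  assumes x01: "\<And>j w. w \<in> words \<Longrightarrow> 0 \<le> x j w" "\<And>j w. w \<in> words \<Longrightarrow> x j w \<le> 1"
    and past: "\<And>j k w y. w \<in> words \<Longrightarrow> y \<in> V \<Longrightarrow> j < k \<Longrightarrow> k \<le> N \<Longrightarrow> x j (w(k := y)) = x j w"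
    and p: "\<And>j w. w \<in> words \<Longrightarrow> j \<in> {1..N} \<Longrightarrow> avg V (\<lambda>y. x j (w(j := y))) \<le> p" "0 \<le> p"
  shows "avg words (\<lambda>w. (\<Sum>j=1..N. x j w)\<^sup>2) \<le> N * p + (N * p)\<^sup>2"
proof -
  define S where "S = (\<lambda>k w. \<Sum>j=1..k. x j w)"
  have "k \<le> N \<Longrightarrow> avg words (S k) \<le> k * p \<and> avg words (\<lambda>w. (S k w)\<^sup>2) \<le> k * p + (k * p)\<^sup>2" for k
  proof (induction k)
    case 0 then show ?case by (simp add: S_def avgW_const)
  next
    case (Suc k)
    then have j: "Suc k \<in> {1..N}" by auto
    have S: "S (Suc k) w = S k w + x (Suc k) w" for w by (simp add: S_def One_nat_def)
    have past': "S k (w(Suc k := y)) = S k w" if "w \<in> words" "y \<in> V" for w y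
      unfolding S_def using that past j by (intro sum.cong) auto
    have S0: "0 \<le> S k w" if "w \<in> words" for w unfolding S_def using x01 that by (intro sum_nonneg) auto
    have m: "avg words (\<lambda>w. f w * x (Suc k) w) \<le> avg words f * p"
      if f: "\<And>w. w \<in> words \<Longrightarrow> 0 \<le> f w" "\<And>w y. w \<in> words \<Longrightarrow> y \<in> V \<Longrightarrow> f (w(Suc k := y)) = f w" for f
    proof -
      have "avg words (\<lambda>w. f w * x (Suc k) w) = avg words (\<lambda>w. avg V (\<lambda>y. f w * x (Suc k) (w(Suc k := y))))"
        unfolding avg_resample1[OF j, of "\<lambda>w. f w * x (Suc k) w"] using f by (intro avg_cong) auto
      also have "\<dots> \<le> avg words (\<lambda>w. f w * p)"
        unfolding avg_cmult using f p j by (intro avg_mono mult_left_mono) auto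
      finally show ?thesis by (simp add: avg_multc)
    qed
    have x1: "avg words (x (Suc k)) \<le> p"
      using m[of "\<lambda>_. 1"] by (simp add: avgW_const)
    have "avg words (\<lambda>w. (S (Suc k) w)\<^sup>2) = avg words (\<lambda>w. (S k w)\<^sup>2 + 2 * (S k w * x (Suc k) w) + (x (Suc k) w)\<^sup>2)"
      unfolding S by (intro avg_cong) (auto simp: power2_eq_square algebra_simps)
    also have "\<dots> = avg words (\<lambda>w. (S k w)\<^sup>2) + 2 * avg words (\<lambda>w. S k w * x (Suc k) w) + avg words (\<lambda>w. (x (Suc k) w)\<^sup>2)"
      by (simp only: avg_add avg_cmult)
    also have "\<dots> \<le> (k * p + (k * p)\<^sup>2) + 2 * ((k * p) * p) + p"
    proof (intro add_mono mult_left_mono)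
      show "avg words (\<lambda>w. (S k w)\<^sup>2) \<le> k * p + (k * p)\<^sup>2" using Suc by simp
      have "avg words (\<lambda>w. S k w * x (Suc k) w) \<le> avg words (S k) * p" by (rule m[OF S0 past'])
      also have "\<dots> \<le> k * p * p" using Suc p by (intro mult_right_mono) auto
      finally show "avg words (\<lambda>w. S k w * x (Suc k) w) \<le> k * p * p" .
      have "avg words (\<lambda>w. (x (Suc k) w)\<^sup>2) \<le> avg words (x (Suc k))"
        using x01 by (intro avg_mono) (simp add: power2_eq_square mult_left_le_one_le)
      then show "avg words (\<lambda>w. (x (Suc k) w)\<^sup>2) \<le> p" using x1 by simp
    qed simp
    also have "\<dots> \<le> Suc k * p + (Suc k * p)\<^sup>2" by (simp add: power2_eq_square algebra_simps)
    finally have "avg words (\<lambda>w. (S (Suc k) w)\<^sup>2) \<le> Suc k * p + (Suc k * p)\<^sup>2" .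
    moreover have "avg words (S (Suc k)) \<le> Suc k * p"
      unfolding S avg_add using Suc x1 by (simp add: algebra_simps)
    ultimately show ?case by blast
  qed
  then show ?thesis by (simp add: S_def)
qed

end

lemma sum_square_le_upper:
  fixes s :: "nat \<Rightarrow> real"
  assumes "\<And>j. 0 \<le> s j"
  shows "(\<Sum>j=1..N. s j)\<^sup>2 \<le> 2 * (\<Sum>j=1..N. \<Sum>i=j..N. s j * s i)"
proof (induction N)
  case (Suc N)
  have "(\<Sum>j=1..Suc N. \<Sum>i=j..Suc N. s j * s i) = (\<Sum>j=1..N. (\<Sum>i=j..N. s j * s i) + s j * s (Suc N)) + s (Suc N) * s (Suc N)"
    by (simp add: One_nat_def sum.atLeast_Suc_atMost)
  also have "\<dots> = (\<Sum>j=1..N. \<Sum>i=j..N. s j * s i) + (\<Sum>j=1..N. s j) * s (Suc N) + s (Suc N) * s (Suc N)"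
    by (simp add: sum.distrib sum_distrib_right)
  finally have *: "(\<Sum>j=1..Suc N. \<Sum>i=j..Suc N. s j * s i) =
    (\<Sum>j=1..N. \<Sum>i=j..N. s j * s i) + (\<Sum>j=1..N. s j) * s (Suc N) + s (Suc N) * s (Suc N)" .
  have "(\<Sum>j=1..Suc N. s j)\<^sup>2 = (\<Sum>j=1..N. s j)\<^sup>2 + 2 * ((\<Sum>j=1..N. s j) * s (Suc N)) + s (Suc N) * s (Suc N)"
    by (simp add: power2_eq_square algebra_simps One_nat_def)
  moreover have "0 \<le> s (Suc N) * s (Suc N)" using assms by simp
  ultimately have "(\<Sum>j=1..Suc N. s j)\<^sup>2 \<le> 2 * (\<Sum>j=1..N. \<Sum>i=j..N. s j * s i) +
      2 * ((\<Sum>j=1..N. s j) * s (Suc N)) + 2 * (s (Suc N) * s (Suc N))"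
    using Suc.IH by linarith
  then show ?case unfolding * distrib_left .
qed simp

context tree_words
begin

text \<open>The letters visited up to \<open>j\<close> form a parent-closed subtree on which both
  words agree. Sending every vertex to its first visited ancestor maps a walk to one that is no
  longer and lies in this common subtree.\<close>

lemma near_visited:
  assumes t: "t \<in> words" "t' \<in> words" and eq: "\<And>k. k \<le> j \<Longrightarrow> t k = t' k"
    and ub: "u \<in> t ` {..j}" "b \<in> t ` {..j}" and near: "near (tree t) r u b"
  shows "near (tree t') r u b"
proof -
  define Vis where "Vis = t ` {..j}"
  define g where "g = par t"
  define ret where "ret = (\<lambda>v. (g ^^ depth g Vis v) v)"
  have g: "g \<in> forest {1..n} {1}" unfolding g_def using t by (intro par_in_forest)
  have one: "1 \<in> Vis" unfolding Vis_def using words_0[OF t(1)] by (intro image_eqI[of _ _ 0]) auto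
  have vis: "par t v \<in> Vis \<and> par t' v = par t v" if v: "v \<in> Vis" for v
  proof (cases "v = 1")
    case False
    obtain k where k: "k \<le> j" "t k = v" using v by (auto simp: Vis_def)
    have f: "first t v \<le> j" using first_le[of t k] k by simp
    have tf: "t (first t v) = v" using k by (intro w_first) auto
    have f': "first t' v = first t v"
    proof (rule first_eqI)
      show "t' (first t v) = v" using eq[OF f] tf by simp
      show "t' i \<noteq> v" if "i < first t v" for i
        using first_le[of t i] that f eq[of i] by auto
    qed
    have r: "v \<in> range t" "v \<in> range t'" using k eq by (metis rangeI)+
    have le: "first t v - 1 \<le> j" using f by simp
    then have "t (first t v - 1) \<in> Vis" by (simp add: Vis_def)
    then show ?thesis using False r f' eq[OF le] by (simp add: par_def)
  qed (use one in \<open>simp add: par_1\<close>)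
  have ret_vis: "ret v = v" if "v \<in> Vis" for v
    using that by (simp add: ret_def depth_def Least_eq_0)
  have ret_par: "ret (g v) = ret v" if "v \<in> {1..n}" "v \<notin> Vis" for v
  proof -
    have "\<exists>k. (g ^^ k) v = 1" using g that(1) unfolding forest_def by blast
    then obtain k where "(g ^^ k) v = 1" ..
    then have k: "(g ^^ k) v \<in> Vis" using one by simp
    have "depth g Vis v = Suc (LEAST m. (g ^^ Suc m) v \<in> Vis)"
      unfolding depth_def using that by (intro Least_Suc[where P = "\<lambda>k. (g ^^ k) v \<in> Vis", OF k]) auto
    then have "depth g Vis v = Suc (depth g Vis (g v))" by (simp add: depth_def funpow_swap1)
    then show ?thesis by (simp add: ret_def funpow_swap1)
  qed
  have step: "ret v = ret (g v) \<or> {ret v, ret (g v)} \<in> tree t'" if "g v \<noteq> v" for v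
  proof (cases "v \<in> Vis")
    case True
    then have "ret v = v" "ret (g v) = g v" "par t' v = g v" using vis[OF True] ret_vis by (auto simp: g_def)
    then show ?thesis using that by (auto simp: edges_iff)
  next
    case False
    have "v \<in> {1..n}" using that g by (auto simp: forest_def)
    then show ?thesis using ret_par[OF _ False] by simp
  qed
  have "near (edges g) r u b \<Longrightarrow> near (tree t') r (ret u) (ret b)" for r u
  proof (induction r arbitrary: u)
    case (Suc r)
    then consider "near (edges g) r u b" | x where "{u, x} \<in> edges g" "near (edges g) r x b" by auto
    then show ?case
    proof cases
      case 2
      have "ret u = ret x \<or> {ret u, ret x} \<in> tree t'"
        using 2(1) step[of u] step[of x] by (auto simp: edges_iff insert_commute)
      then show ?thesis using Suc.IH[OF 2(2)] by auto
    qed (use Suc.IH in auto)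
  qed simp
  then show ?thesis using near ub ret_vis unfolding g_def Vis_def[symmetric] by metis
qed

lemma par_permute:
  assumes \<pi>: "\<And>v. \<pi> (\<pi> v) = v" "\<pi> 1 = 1" "\<And>v. \<pi> v \<in> {1..n} \<longleftrightarrow> v \<in> {1..n}"
  shows "par (\<pi> \<circ> t) (\<pi> v) = \<pi> (par t v)"
proof -
  have eq: "(\<pi> \<circ> t) k = \<pi> v \<longleftrightarrow> t k = v" for k by (metis \<pi>(1) comp_apply)
  then have r: "\<pi> v \<in> range (\<pi> \<circ> t) \<longleftrightarrow> v \<in> range t" unfolding image_iff by metis
  have f: "first (\<pi> \<circ> t) (\<pi> v) = first t v" unfolding first_def r eq ..
  have "\<pi> v = 1 \<longleftrightarrow> v = 1" using \<pi> by metis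
  then show ?thesis unfolding par_def r f using \<pi> by simp
qed

text \<open>Renaming two unvisited letters changes neither the prefix nor the law of the
  tail.\<close>

lemma near_exchange:
  assumes w: "w \<in> words" and c: "c \<in> {1..n} - w ` {..j}" and c': "c' \<in> {1..n} - w ` {..j}" and i: "i \<le> j"
  shows "avg words (\<lambda>Y. of_bool (near (tree (mix j w Y)) R (w i) c)) =
    avg words (\<lambda>Y. of_bool (near (tree (mix j w Y)) R (w i) c'))"
proof -
  define \<pi> where "\<pi> = Transposition.transpose c c'"
  have inv: "\<pi> (\<pi> v) = v" for v by (simp add: \<pi>_def)
  have fixw: "\<pi> (w k) = w k" if "k \<le> j" for k
    using c c' that by (auto simp: \<pi>_def Transposition.transpose_def)
  have V: "\<pi> v \<in> {1..n} \<longleftrightarrow> v \<in> {1..n}" for v using c c' by (auto simp: \<pi>_def Transposition.transpose_def)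
  have one: "\<pi> 1 = 1" using fixw[of 0] words_0[OF w] by simp
  have cc: "\<pi> c = c'" by (simp add: \<pi>_def)
  have "\<pi> \<circ> Y \<in> words" if "Y \<in> words" for Y
    using that unfolding words_iff comp_apply V by (simp add: one)
  then have bij: "bij_betw (\<lambda>Y. \<pi> \<circ> Y) words words"
    by (intro bij_betw_byWitness[where f' = "\<lambda>Y. \<pi> \<circ> Y"]) (auto simp: fun_eq_iff inv)
  have "near (tree (mix j w (\<pi> \<circ> Y))) R (w i) c' \<longleftrightarrow> near (tree (mix j w Y)) R (w i) c" for Y
  proof -
    have m: "mix j w (\<pi> \<circ> Y) = \<pi> \<circ> mix j w Y" by (auto simp: mix_def fun_eq_iff fixw)
    have h: "par (\<pi> \<circ> mix j w Y) (\<pi> v) = \<pi> (par (mix j w Y) v)" for v by (rule par_permute[OF inv one V])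
    then have h': "par (mix j w Y) (\<pi> v) = \<pi> (par (\<pi> \<circ> mix j w Y) v)" for v by (metis inv)
    show ?thesis
      unfolding m using near_equivariant[where \<pi> = \<pi> and g = "par (mix j w Y)" and h = "par (\<pi> \<circ> mix j w Y)", OF _ inv h, of R "w i" c]
        near_equivariant[where \<pi> = \<pi> and h = "par (mix j w Y)" and g = "par (\<pi> \<circ> mix j w Y)", OF _ inv h', of R "w i" c']
      by (metis cc fixw i inv)
  qed
  then show ?thesis
    using avg_reindex[OF bij, of "\<lambda>Y. of_bool (near (tree (mix j w Y)) R (w i) c')"] by simp
qed

end

section \<open>Close pairs of positions\<close>

text \<open>Outside a bad event, \<open>m\<close> bounds ball sizes and \<open>\<mu>\<close> the
  multiplicity of a letter. By \<open>N \<le> n * \<mu>\<close>, the product \<open>\<kappa>\<close>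
  of both also dominates \<open>N * m / n\<close>, the order of the expected number of independent
  letters falling into a ball.\<close>

locale ball_words = tree_words +
  fixes R m \<mu> :: nat
  assumes m1: "1 \<le> m" and mn: "m \<le> n" and \<mu>1: "1 \<le> \<mu>" and \<mu>N: "\<mu> \<le> N" and N\<mu>: "N \<le> n * \<mu>"
begin

definition ball :: "(nat \<Rightarrow> nat) \<Rightarrow> nat \<Rightarrow> nat set" where
  "ball w b = {u \<in> {1..n}. near (tree w) R u b}"

text \<open>The third clause guarantees that a letter still occurs after any one position is
  overwritten; it provides the second occurrence of a letter whose first one is lost.\<close>

definition good :: "(nat \<Rightarrow> nat) \<Rightarrow> bool" where
  "good w \<longleftrightarrow> (\<forall>b\<in>{1..n}. card (ball w b) \<le> m) \<and> (\<forall>v\<in>{1..n}. card {k. k \<le> N \<and> w k = v} \<le> \<mu>) \<and>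
     (\<forall>v\<in>{1..n}. \<forall>j. \<exists>k\<in>{1..N}. k \<noteq> j \<and> w k = v)"

abbreviation bad :: "(nat \<Rightarrow> nat) \<Rightarrow> real" where
  "bad w \<equiv> of_bool (\<not> good w)"

definition \<beta> :: real where "\<beta> = avg words bad"

definition \<kappa> :: real where "\<kappa> = real m * real \<mu>"

definition pr :: "(nat \<Rightarrow> nat) \<Rightarrow> nat \<Rightarrow> nat \<Rightarrow> real" where
  "pr w u b = of_bool (near (tree w) R u b)"

text \<open>The conditional probability of a bad word given the letters up to
  \<open>j\<close>.\<close>

definition bad_after :: "nat \<Rightarrow> (nat \<Rightarrow> nat) \<Rightarrow> real" where
  "bad_after j w = avg words (\<lambda>Y. bad (mix j w Y))"

lemma pr_01: "0 \<le> pr w u b" "pr w u b \<le> 1"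
  by (auto simp: pr_def)

lemma pr_sym: "pr w u b = pr w b u"
proof -
  have "near (tree w) R u b \<longleftrightarrow> near (tree w) R b u" using near_sym by blast
  then show ?thesis by (simp add: pr_def)
qed

lemma \<kappa>1: "1 \<le> \<kappa>"
  unfolding \<kappa>_def using m1 \<mu>1 by (simp add: mult_ge1_I)

lemma \<beta>0: "0 \<le> \<beta>"
  unfolding \<beta>_def by (intro avg_nonneg) auto

lemma Nm: "real N * (real m / real n) \<le> \<kappa>"
proof -
  have "real N * real m \<le> real (n * \<mu>) * real m" by (intro mult_right_mono of_nat_mono N\<mu>) simp
  then show ?thesis using n_pos unfolding \<kappa>_def by (simp add: field_simps)
qed

lemma bad_after_01: "0 \<le> bad_after j w" "bad_after j w \<le> 1"
  unfolding bad_after_def by (auto intro!: avg_nonneg avg_le_const finite_words words_nonempty)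

lemma avg_bad_after: "avg words (bad_after j) = \<beta>"
  unfolding bad_after_def \<beta>_def by (rule avg_mix1[symmetric])

lemma avg_sum_bad_after_sq: "avg words (\<lambda>w. (\<Sum>j=1..N. bad_after (f j) w)\<^sup>2) \<le> (real N)\<^sup>2 * \<beta>"
proof -
  have "(\<Sum>j=1..N. bad_after (f j) w)\<^sup>2 \<le> real N * (\<Sum>j=1..N. bad_after (f j) w)" for w
  proof -
    have "(\<Sum>j=1..N. bad_after (f j) w) \<le> (\<Sum>j=1..N. 1)" by (intro sum_mono bad_after_01)
    moreover have "0 \<le> (\<Sum>j=1..N. bad_after (f j) w)" by (intro sum_nonneg bad_after_01)
    ultimately show ?thesis unfolding power2_eq_square by (intro mult_right_mono) auto
  qed
  then have "avg words (\<lambda>w. (\<Sum>j=1..N. bad_after (f j) w)\<^sup>2) \<le> avg words (\<lambda>w. real N * (\<Sum>j=1..N. bad_after (f j) w))"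
    by (intro avg_mono)
  also have "\<dots> = real N * (\<Sum>j=1..N. \<beta>)" by (simp only: avg_cmult avg_sum avg_bad_after)
  finally show ?thesis by (simp add: power2_eq_square)
qed

lemma avg_pr_ball: "b \<in> {1..n} \<Longrightarrow> avg {1..n} (\<lambda>y. pr w y b) = real (card (ball w b)) / real n"
proof -
  have "(\<Sum>y\<in>{1..n}. pr w y b) = (\<Sum>y\<in>ball w b. 1)"
    unfolding pr_def ball_def by (intro sum.mono_neutral_cong_right) auto
  then show ?thesis by (simp add: avg_def)
qed

lemma card_ball_le: "card (ball w b) \<le> n"
proof -
  have "card (ball w b) \<le> card {1..n}" by (intro card_mono) (auto simp: ball_def)
  then show ?thesis by simp
qed

lemma card_ball_bad: "b \<in> {1..n} \<Longrightarrow> real (card (ball w b)) \<le> real m + real n * bad w"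
  using card_ball_le[of w b] by (cases "good w") (auto simp: good_def)

lemma avg_pr_le: "b \<in> {1..n} \<Longrightarrow> avg {1..n} (\<lambda>y. pr w y b) \<le> real m / real n + bad w"
  unfolding avg_pr_ball using card_ball_bad[of b w] n_pos by (simp add: field_simps)

lemma sum_pr_positions:
  assumes w: "w \<in> words" "good w" and b: "b \<in> {1..n}" and f: "inj_on f J" "J \<subseteq> {1..N}" "\<And>j. j \<in> J \<Longrightarrow> f j \<le> N"
  shows "(\<Sum>j\<in>J. pr w (w (f j)) b) \<le> \<kappa>"
proof -
  have finJ: "finite J" using f finite_subset by blast
  have "(\<Sum>j\<in>J. pr w (w (f j)) b) = (\<Sum>j\<in>{j\<in>J. w (f j) \<in> ball w b}. 1)"
    unfolding pr_def ball_def using words_in_V[OF w(1)] finJ by (intro sum.mono_neutral_cong_right) auto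
  also have "\<dots> = real (card {j\<in>J. w (f j) \<in> ball w b})" by simp
  also have "card {j\<in>J. w (f j) \<in> ball w b} \<le> card (\<Union>v\<in>ball w b. {k. k \<le> N \<and> w k = v})"
    using f by (intro card_inj_on_le[where f = f]) (auto simp: inj_on_def ball_def)
  also have "\<dots> \<le> (\<Sum>v\<in>ball w b. card {k. k \<le> N \<and> w k = v})"
    by (intro card_UN_le) (simp add: ball_def)
  also have "\<dots> \<le> (\<Sum>v\<in>ball w b. \<mu>)"
    using w by (intro sum_mono) (auto simp: good_def ball_def)
  also have "\<dots> \<le> m * \<mu>" using w b by (simp add: good_def)
  finally show ?thesis by (simp add: \<kappa>_def)
qed

lemma sum_pr_shift:
  assumes w: "w \<in> words" and b: "b \<in> {1..n}" and s: "s \<le> 1" and J: "J \<subseteq> {1..N}"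
  shows "(\<Sum>j\<in>J. pr w (w (j - s)) b) \<le> \<kappa> + real N * bad w"
proof (cases "good w")
  case True
  have "inj_on (\<lambda>j. j - s) J"
  proof (rule inj_onI)
    fix x y assume "x \<in> J" "y \<in> J" "x - s = y - s"
    moreover from this have "1 \<le> x" "1 \<le> y" using J by auto
    ultimately show "x = y" using s by linarith
  qed
  then show ?thesis using sum_pr_positions[OF w True b _ J, of "\<lambda>j. j - s"] J True by fastforce
next
  case False
  have "(\<Sum>j\<in>J. pr w (w (j - s)) b) \<le> (\<Sum>j\<in>J. 1)" by (intro sum_mono pr_01)
  also have "\<dots> \<le> real N" using card_mono[OF _ J] by simp
  finally show ?thesis using False \<kappa>1 by simp
qed

end

lemma square_add_le: "(a + b)\<^sup>2 \<le> 2 * a\<^sup>2 + 2 * (b\<^sup>2 :: real)"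
  using sum_squares_bound[of a b] by (simp add: power2_eq_square algebra_simps)

lemma square_le_of_le_add: "0 \<le> x \<Longrightarrow> x \<le> a + b \<Longrightarrow> x\<^sup>2 \<le> 2 * a\<^sup>2 + 2 * (b\<^sup>2 :: real)"
  using order_trans[OF power_mono[of x "a + b" 2] square_add_le[of a b]] by simp

section \<open>Conditional counts for visited, fresh, future and unvisited letters\<close>

context ball_words
begin

text \<open>The conditional probability, given the letters up to \<open>j\<close>, that the fixed
  letter \<open>w i\<close> is near \<open>b\<close>.\<close>

definition hit :: "nat \<Rightarrow> nat \<Rightarrow> (nat \<Rightarrow> nat) \<Rightarrow> nat \<Rightarrow> real" where
  "hit j i w b = avg words (\<lambda>Y. pr (mix j w Y) (w i) b)"

lemma hit_01: "0 \<le> hit j i w b" "hit j i w b \<le> 1"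
  unfolding hit_def using pr_01 by (auto intro!: avg_nonneg avg_le_const finite_words words_nonempty)

lemma hit_visited:
  assumes w: "w \<in> words" and "i \<le> j" "b \<in> w ` {..j}"
  shows "hit j i w b \<le> pr w (w i) b"
proof -
  have "pr (mix j w Y) (w i) b \<le> pr w (w i) b" if Y: "Y \<in> words" for Y
  proof -
    have im: "mix j w Y ` {..j} = w ` {..j}" by (intro image_cong) (auto simp: mix_def)
    have "near (tree (mix j w Y)) R (w i) b \<Longrightarrow> near (tree w) R (w i) b"
      by (rule near_visited[OF mix_words[OF w Y] w, where j = j]) (use assms im in \<open>auto simp: mix_def\<close>)
    then show ?thesis by (simp add: pr_def)
  qed
  then show ?thesis unfolding hit_def by (intro avg_le_const finite_words words_nonempty)
qed

lemma hit_visited_sq: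
  assumes s: "s \<le> 1" and B: "\<And>w. w \<in> words \<Longrightarrow> B w \<in> {1..n}"
  shows "avg words (\<lambda>w. (\<Sum>j=1..N. of_bool (B w \<in> w ` {..j}) * hit j (j - s) w (B w))\<^sup>2) \<le> 2 * \<kappa>\<^sup>2 + 2 * (real N)\<^sup>2 * \<beta>"
proof -
  have "(\<Sum>j=1..N. of_bool (B w \<in> w ` {..j}) * hit j (j - s) w (B w))\<^sup>2 \<le> 2 * \<kappa>\<^sup>2 + 2 * (real N)\<^sup>2 * bad w"
    if w: "w \<in> words" for w
  proof -
    have "(\<Sum>j=1..N. of_bool (B w \<in> w ` {..j}) * hit j (j - s) w (B w)) \<le> (\<Sum>j=1..N. pr w (w (j - s)) (B w))"
      using hit_visited[OF w] pr_01 by (intro sum_mono) (auto simp: of_bool_def)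
    also have "\<dots> \<le> \<kappa> + real N * bad w" using sum_pr_shift[OF w B[OF w] s] by blast
    finally have le: "(\<Sum>j=1..N. of_bool (B w \<in> w ` {..j}) * hit j (j - s) w (B w)) \<le> \<kappa> + real N * bad w" .
    have "(\<Sum>j=1..N. of_bool (B w \<in> w ` {..j}) * hit j (j - s) w (B w))\<^sup>2 \<le> 2 * \<kappa>\<^sup>2 + 2 * (real N * bad w)\<^sup>2"
      using le hit_01 by (intro square_le_of_le_add sum_nonneg) auto
    also have "(real N * bad w)\<^sup>2 = (real N)\<^sup>2 * bad w" by (simp add: power_mult_distrib of_bool_def)
    finally show ?thesis by (simp only: mult.assoc)
  qed
  then have "avg words (\<lambda>w. (\<Sum>j=1..N. of_bool (B w \<in> w ` {..j}) * hit j (j - s) w (B w))\<^sup>2)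
      \<le> avg words (\<lambda>w. 2 * \<kappa>\<^sup>2 + 2 * (real N)\<^sup>2 * bad w)" by (intro avg_mono)
  also have "\<dots> = 2 * \<kappa>\<^sup>2 + 2 * (real N)\<^sup>2 * \<beta>" by (simp only: avg_add avg_cmult avgW_const \<beta>_def)
  finally show ?thesis .
qed

lemma hit_fresh_sq:
  assumes B: "\<And>w. w \<in> words \<Longrightarrow> B w \<in> {1..n}"
  shows "avg words (\<lambda>w. (\<Sum>j=1..N. avg {1..n} (\<lambda>y. avg words (\<lambda>Y. pr (mix j w Y) y (B w))))\<^sup>2) \<le>
    2 * \<kappa>\<^sup>2 + 2 * (real N)\<^sup>2 * \<beta>"
proof -
  have "(\<Sum>j=1..N. avg {1..n} (\<lambda>y. avg words (\<lambda>Y. pr (mix j w Y) y (B w))))\<^sup>2 \<le>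
      2 * \<kappa>\<^sup>2 + 2 * (\<Sum>j=1..N. bad_after j w)\<^sup>2" if w: "w \<in> words" for w
  proof -
    have "avg {1..n} (\<lambda>y. avg words (\<lambda>Y. pr (mix j w Y) y (B w))) \<le> real m / real n + bad_after j w" for j
    proof -
      have "avg {1..n} (\<lambda>y. avg words (\<lambda>Y. pr (mix j w Y) y (B w))) = avg words (\<lambda>Y. avg {1..n} (\<lambda>y. pr (mix j w Y) y (B w)))"
        by (rule avg_swap)
      also have "\<dots> \<le> avg words (\<lambda>Y. real m / real n + bad (mix j w Y))"
        by (intro avg_mono avg_pr_le B w)
      finally show ?thesis by (simp add: avg_add avgW_const bad_after_def)
    qed
    then have "(\<Sum>j=1..N. avg {1..n} (\<lambda>y. avg words (\<lambda>Y. pr (mix j w Y) y (B w)))) \<le>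
        (\<Sum>j=1..N. real m / real n + bad_after j w)" by (intro sum_mono)
    also have "\<dots> \<le> \<kappa> + (\<Sum>j=1..N. bad_after j w)"
      using Nm by (simp add: sum.distrib)
    finally show ?thesis
      using pr_01 by (intro square_le_of_le_add sum_nonneg avg_nonneg) auto
  qed
  then have "avg words (\<lambda>w. (\<Sum>j=1..N. avg {1..n} (\<lambda>y. avg words (\<lambda>Y. pr (mix j w Y) y (B w))))\<^sup>2) \<le>
      avg words (\<lambda>w. 2 * \<kappa>\<^sup>2 + 2 * (\<Sum>j=1..N. bad_after j w)\<^sup>2)" by (intro avg_mono)
  also have "\<dots> = 2 * \<kappa>\<^sup>2 + 2 * avg words (\<lambda>w. (\<Sum>j=1..N. bad_after j w)\<^sup>2)" by (simp only: avg_add avg_cmult avgW_const)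
  finally show ?thesis using avg_sum_bad_after_sq[of "\<lambda>j. j"] by simp
qed

text \<open>The letter \<open>w j\<close> is uniform and independent of the tree resampled from
  \<open>j\<close> on, so it falls into a ball of a good word with probability at most
  \<open>m / n\<close>. Restricting to good words makes this bound deterministic, as
  \<open>predictable_second_moment\<close> requires.\<close>

lemma hit_future_sq:
  assumes B: "\<And>w. w \<in> words \<Longrightarrow> B w \<in> {1..n}"
    and past: "\<And>w k y. a < k \<Longrightarrow> B (w(k := y)) = B w"
  shows "avg words (\<lambda>w. (\<Sum>j=1..N. of_bool (a < j) * hit (j - 1) j w (B w))\<^sup>2) \<le>
    2 * (\<kappa> + \<kappa>\<^sup>2) + 2 * (real N)\<^sup>2 * \<beta>"
proof -
  define x where "x = (\<lambda>j w. of_bool (a < j) * avg words (\<lambda>Y. pr (mix (j - 1) w Y) (w j) (B w) * of_bool (good (mix (j - 1) w Y))))"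
  have x01: "0 \<le> x j w" "x j w \<le> 1" for j w
    unfolding x_def using pr_01 by (auto intro!: avg_nonneg avg_le_const finite_words words_nonempty mult_le_one simp: of_bool_def)
  have "avg words (\<lambda>w. (\<Sum>j=1..N. x j w)\<^sup>2) \<le> N * (real m / real n) + (N * (real m / real n))\<^sup>2"
  proof (rule predictable_second_moment[OF x01])
    fix j k w y assume "j < k" "k \<le> N"
    then show "x j (w(k := y)) = x j w"
      unfolding x_def using past[of k] by (cases "a < j") (simp_all add: mix_upd_left')
  next
    fix j w assume w: "w \<in> words" and j: "j \<in> {1..N}"
    show "avg {1..n} (\<lambda>y. x j (w(j := y))) \<le> real m / real n"
    proof (cases "a < j")
      case True
      have "avg {1..n} (\<lambda>y. x j (w(j := y))) = avg words (\<lambda>Y. avg {1..n} (\<lambda>y. pr (mix (j - 1) w Y) y (B w) * of_bool (good (mix (j - 1) w Y))))"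
        unfolding x_def using True j past[of j] by (subst avg_swap) (simp add: mix_upd_left')
      also have "\<dots> \<le> real m / real n"
        unfolding avg_multc using B[OF w] n_pos
        by (intro avg_le_const finite_words words_nonempty)
          (auto simp: avg_pr_ball good_def divide_right_mono of_bool_def)
      finally show ?thesis .
    qed (simp add: x_def avgV_const)
  qed auto
  also have "\<dots> \<le> \<kappa> + \<kappa>\<^sup>2" using Nm by (intro add_mono power_mono) auto
  finally have X: "avg words (\<lambda>w. (\<Sum>j=1..N. x j w)\<^sup>2) \<le> \<kappa> + \<kappa>\<^sup>2" .
  have "(\<Sum>j=1..N. of_bool (a < j) * hit (j - 1) j w (B w))\<^sup>2 \<le>
      2 * (\<Sum>j=1..N. x j w)\<^sup>2 + 2 * (\<Sum>j=1..N. bad_after (j - 1) w)\<^sup>2" for w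
  proof -
    have "of_bool (a < j) * hit (j - 1) j w (B w) \<le> x j w + bad_after (j - 1) w" for j
    proof (cases "a < j")
      case True
      have "hit (j - 1) j w (B w) \<le> avg words (\<lambda>Y. pr (mix (j - 1) w Y) (w j) (B w) * of_bool (good (mix (j - 1) w Y)) + bad (mix (j - 1) w Y))"
        unfolding hit_def using pr_01 by (intro avg_mono) (auto simp: of_bool_def)
      then show ?thesis using True by (simp add: x_def bad_after_def avg_add)
    qed (use bad_after_01 x01 in \<open>simp add: add_nonneg_nonneg\<close>)
    then have "(\<Sum>j=1..N. of_bool (a < j) * hit (j - 1) j w (B w)) \<le> (\<Sum>j=1..N. x j w) + (\<Sum>j=1..N. bad_after (j - 1) w)"
      unfolding sum.distrib[symmetric] by (intro sum_mono)
    then show ?thesis using hit_01 by (intro square_le_of_le_add sum_nonneg) auto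
  qed
  then have "avg words (\<lambda>w. (\<Sum>j=1..N. of_bool (a < j) * hit (j - 1) j w (B w))\<^sup>2) \<le>
      avg words (\<lambda>w. 2 * (\<Sum>j=1..N. x j w)\<^sup>2 + 2 * (\<Sum>j=1..N. bad_after (j - 1) w)\<^sup>2)" by (intro avg_mono)
  also have "\<dots> = 2 * avg words (\<lambda>w. (\<Sum>j=1..N. x j w)\<^sup>2) + 2 * avg words (\<lambda>w. (\<Sum>j=1..N. bad_after (j - 1) w)\<^sup>2)"
    by (simp only: avg_add avg_cmult)
  finally show ?thesis using X avg_sum_bad_after_sq[of "\<lambda>j. j - 1"] by simp
qed

text \<open>Given the letters up to \<open>j\<close>, all unvisited letters are exchangeable.\<close>

lemma hit_unvisited:
  assumes w: "w \<in> words" and i: "i \<le> j" and c: "c \<in> {1..n} - w ` {..j}"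
  shows "hit j i w c \<le> real m / real (card ({1..n} - w ` {..j})) + real n * bad_after j w"
proof -
  let ?U = "{1..n} - w ` {..j}"
  have U: "0 < card ?U" using c card_gt_0_iff[of ?U] by blast
  have wi: "w i \<in> {1..n}" by (rule words_in_V[OF w])
  have "real (card ?U) * hit j i w c = (\<Sum>c'\<in>?U. hit j i w c)" by simp
  also have "\<dots> = (\<Sum>c'\<in>?U. hit j i w c')"
    unfolding hit_def pr_def by (intro sum.cong refl near_exchange[OF w c _ i])
  also have "\<dots> = avg words (\<lambda>Y. \<Sum>c'\<in>?U. pr (mix j w Y) (w i) c')" unfolding hit_def avg_sum ..
  also have "\<dots> \<le> avg words (\<lambda>Y. real m + real n * bad (mix j w Y))"
  proof (intro avg_mono)
    fix Y
    have "(\<Sum>c'\<in>?U. pr (mix j w Y) (w i) c') \<le> (\<Sum>c'\<in>{1..n}. pr (mix j w Y) c' (w i))"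
      unfolding pr_sym[of _ "w i"] using pr_01 by (intro sum_mono2) auto
    also have "\<dots> = real (card (ball (mix j w Y) (w i)))"
      using avg_pr_ball[OF wi, of "mix j w Y"] n_pos by (simp add: avg_def)
    also have "\<dots> \<le> real m + real n * bad (mix j w Y)" by (rule card_ball_bad[OF wi])
    finally show "(\<Sum>c'\<in>?U. pr (mix j w Y) (w i) c') \<le> real m + real n * bad (mix j w Y)" .
  qed
  also have "\<dots> = real m + real n * bad_after j w" by (simp only: avg_add avg_cmult avgW_const bad_after_def)
  finally have "hit j i w c \<le> (real m + real n * bad_after j w) / real (card ?U)"
    using U by (simp add: field_simps)
  also have "\<dots> \<le> real m / real (card ?U) + real n * bad_after j w"
  proof -
    have "real n * bad_after j w / real (card ?U) \<le> real n * bad_after j w / 1"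
      using U bad_after_01 by (intro divide_left_mono) auto
    then show ?thesis by (simp add: add_divide_distrib)
  qed
  finally show ?thesis .
qed

text \<open>The square is expanded over \<open>j \<le> i\<close>. At the earlier time
  \<open>j\<close> the probability is replaced by \<open>m / card (U j w)\<close>; averaging over
  \<open>c\<close> in \<open>U j w\<close> returns \<open>card (U j w) / n\<close>. What remains is
  \<open>m / n\<close> times a sum over \<open>i\<close> of actual near positions, at most
  \<open>\<kappa>\<close> on good words.\<close>

lemma hit_unvisited_sq:
  assumes s: "s \<le> 1"
  shows "avg words (\<lambda>w. avg {1..n} (\<lambda>c. (\<Sum>j=1..N. of_bool (c \<notin> w ` {..j}) * hit j (j - s) w c)\<^sup>2)) \<le>
    2 * \<kappa>\<^sup>2 + 4 * real n * (real N)\<^sup>2 * \<beta>"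
proof -
  define U where "U = (\<lambda>j (w :: nat \<Rightarrow> nat). {1..n} - w ` {..j})"
  define \<phi> where "\<phi> = (\<lambda>j i w. avg {1..n} (\<lambda>c. of_bool (c \<in> U j w) * (real m / real (card (U j w))) * pr w (w (i - s)) c))"
  have m_n: "real m / real n * real N \<le> \<kappa>" using Nm by (simp add: mult.commute)
  have pw: "(\<Sum>j=1..N. of_bool (c \<notin> w ` {..j}) * hit j (j - s) w c)\<^sup>2 \<le>
      2 * (\<Sum>j=1..N. \<Sum>i=j..N. of_bool (c \<in> U j w) * (real m / real (card (U j w))) * hit i (i - s) w c + real n * bad_after j w)"
    if w: "w \<in> words" and c: "c \<in> {1..n}" for w c
  proof -
    define x where "x = (\<lambda>j. of_bool (c \<notin> w ` {..j}) * hit j (j - s) w c)"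
    have x01: "0 \<le> x j" "x j \<le> hit j (j - s) w c" "x j \<le> 1" for j
      unfolding x_def using hit_01[of j "j - s" w c] by (auto simp: of_bool_def)
    have "x j * x i \<le> of_bool (c \<in> U j w) * (real m / real (card (U j w))) * hit i (i - s) w c + real n * bad_after j w" for i j
    proof (cases "c \<in> U j w")
      case True
      have "x j \<le> real m / real (card (U j w)) + real n * bad_after j w"
        using hit_unvisited[OF w, of "j - s" j c] True x01(2)[of j] unfolding U_def by simp
      then have "x j * x i \<le> (real m / real (card (U j w)) + real n * bad_after j w) * x i"
        using x01 by (intro mult_right_mono) auto
      also have "\<dots> = real m / real (card (U j w)) * x i + real n * bad_after j w * x i" by (simp add: algebra_simps)
      also have "\<dots> \<le> real m / real (card (U j w)) * hit i (i - s) w c + real n * bad_after j w * 1"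
        using x01 bad_after_01 by (intro add_mono mult_left_mono mult_nonneg_nonneg) auto
      finally show ?thesis using True by simp
    next
      case False
      then have "x j = 0" using c by (auto simp: x_def U_def)
      then show ?thesis using False bad_after_01 by simp
    qed
    then have "(\<Sum>j=1..N. \<Sum>i=j..N. x j * x i) \<le>
        (\<Sum>j=1..N. \<Sum>i=j..N. of_bool (c \<in> U j w) * (real m / real (card (U j w))) * hit i (i - s) w c + real n * bad_after j w)"
      by (intro sum_mono)
    then show ?thesis using sum_square_le_upper[of x N] x01 unfolding x_def by fastforce
  qed
  \<comment> \<open>\<open>U j w\<close> is determined by the letters up to
    \<open>j \<le> i\<close>, so the average over the tail after \<open>i\<close> inside
    \<open>hit\<close> can be undone.\<close>
  have E1: "avg words (\<lambda>w. avg {1..n} (\<lambda>c. of_bool (c \<in> U j w) * (real m / real (card (U j w))) * hit i (i - s) w c)) = avg words (\<phi> j i)"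
    if ji: "j \<le> i" for j i
  proof -
    have "avg words (\<lambda>w. avg {1..n} (\<lambda>c. of_bool (c \<in> U j w) * (real m / real (card (U j w))) * hit i (i - s) w c)) =
        avg words (\<lambda>w. avg words (\<lambda>Y. \<phi> j i (mix i w Y)))"
    proof (intro avg_cong refl)
      fix w
      have U': "U j (mix i w Y) = U j w" for Y
        unfolding U_def using ji by (auto simp: mix_def intro!: image_eqI)
      have i': "mix i w Y (i - s) = w (i - s)" for Y by (simp add: mix_def)
      show "avg {1..n} (\<lambda>c. of_bool (c \<in> U j w) * (real m / real (card (U j w))) * hit i (i - s) w c) = avg words (\<lambda>Y. \<phi> j i (mix i w Y))"
        unfolding \<phi>_def U' i' hit_def by (subst avg_swap) (simp only: avg_cmult)
    qed
    then show ?thesis using avg_mix1[of "\<phi> j i" i] by simp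
  qed
  have E2: "(\<Sum>i=j..N. avg words (\<phi> j i)) \<le> (real m / real n) * (\<kappa> + real N * \<beta>)" if j: "j \<in> {1..N}" for j
  proof -
    have "(\<Sum>i=j..N. \<phi> j i w) \<le> (real m / real n) * (\<kappa> + real N * bad w)" if w: "w \<in> words" for w
    proof -
      have K0: "0 \<le> \<kappa> + real N * bad w" using \<kappa>1 by simp
      have "(\<Sum>i=j..N. \<phi> j i w) = avg {1..n} (\<lambda>c. of_bool (c \<in> U j w) * (real m / real (card (U j w))) * (\<Sum>i=j..N. pr w (w (i - s)) c))"
        unfolding \<phi>_def by (simp only: avg_sum[symmetric] sum_distrib_left)
      also have "\<dots> \<le> avg {1..n} (\<lambda>c. of_bool (c \<in> U j w) * (real m / real (card (U j w))) * (\<kappa> + real N * bad w))"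
        using sum_pr_shift[OF w _ s, of _ "{j..N}"] j by (intro avg_mono mult_left_mono) auto
      also have "\<dots> = avg {1..n} (\<lambda>c. of_bool (c \<in> U j w)) * ((real m / real (card (U j w))) * (\<kappa> + real N * bad w))"
        by (simp only: avg_multc mult.assoc)
      also have "avg {1..n} (\<lambda>c. of_bool (c \<in> U j w)) = real (card (U j w)) / real n"
      proof -
        have "(\<Sum>c\<in>{1..n}. of_bool (c \<in> U j w) :: real) = (\<Sum>c\<in>U j w. 1)"
          unfolding U_def by (intro sum.mono_neutral_cong_right) auto
        then show ?thesis by (simp add: avg_def)
      qed
      also have "real (card (U j w)) / real n * ((real m / real (card (U j w))) * (\<kappa> + real N * bad w)) \<le>
          (real m / real n) * (\<kappa> + real N * bad w)"
        using K0 by (cases "card (U j w) = 0") (auto intro!: divide_nonneg_nonneg mult_nonneg_nonneg)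
      finally show ?thesis .
    qed
    then have "avg words (\<lambda>w. \<Sum>i=j..N. \<phi> j i w) \<le> avg words (\<lambda>w. (real m / real n) * (\<kappa> + real N * bad w))"
      by (intro avg_mono)
    then show ?thesis by (simp only: avg_sum avg_cmult avg_add avgW_const \<beta>_def)
  qed
  have "avg words (\<lambda>w. avg {1..n} (\<lambda>c. (\<Sum>j=1..N. of_bool (c \<notin> w ` {..j}) * hit j (j - s) w c)\<^sup>2)) \<le>
      avg words (\<lambda>w. avg {1..n} (\<lambda>c. 2 * (\<Sum>j=1..N. \<Sum>i=j..N. of_bool (c \<in> U j w) * (real m / real (card (U j w))) * hit i (i - s) w c + real n * bad_after j w)))"
    by (intro avg_mono pw)
  also have "\<dots> = 2 * (\<Sum>j=1..N. \<Sum>i=j..N. avg words (\<lambda>w. avg {1..n} (\<lambda>c. of_bool (c \<in> U j w) * (real m / real (card (U j w))) * hit i (i - s) w c)) + real n * \<beta>)"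
    by (simp only: avg_cmult avg_sum avg_add avgV_const avg_bad_after)
  also have "\<dots> = 2 * (\<Sum>j=1..N. \<Sum>i=j..N. avg words (\<phi> j i) + real n * \<beta>)"
    by (intro arg_cong[where f = "(*) 2"] sum.cong refl arg_cong2[where f = "(+)"] E1) auto
  also have "\<dots> = 2 * (\<Sum>j=1..N. (\<Sum>i=j..N. avg words (\<phi> j i)) + real (card {j..N}) * (real n * \<beta>))"
    by (simp add: sum.distrib)
  also have "\<dots> \<le> 2 * (\<Sum>j=1..N. (real m / real n) * (\<kappa> + real N * \<beta>) + real N * (real n * \<beta>))"
    using \<beta>0 by (intro mult_left_mono sum_mono add_mono E2 mult_right_mono) auto
  also have "\<dots> = 2 * ((real m / real n * real N) * (\<kappa> + real N * \<beta>) + (real N)\<^sup>2 * real n * \<beta>)"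
    by (simp add: power2_eq_square algebra_simps)
  also have "\<dots> \<le> 2 * (\<kappa> * \<kappa> + 1 * real N * (real N * \<beta>) + (real N)\<^sup>2 * real n * \<beta>)"
  proof -
    have "real m / real n * real N * (real N * \<beta>) \<le> 1 * real N * (real N * \<beta>)"
      using mn n_pos \<beta>0 by (intro mult_right_mono) (auto simp: divide_le_eq_1)
    moreover have "real m / real n * real N * \<kappa> \<le> \<kappa> * \<kappa>"
      using m_n \<kappa>1 by (intro mult_right_mono) auto
    ultimately show ?thesis by (simp add: distrib_left)
  qed
  also have "\<dots> \<le> 2 * \<kappa>\<^sup>2 + 4 * real n * (real N)\<^sup>2 * \<beta>"
  proof -
    have "1 * ((real N)\<^sup>2 * \<beta>) \<le> real n * ((real N)\<^sup>2 * \<beta>)"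
      using n_pos \<beta>0 by (intro mult_right_mono) auto
    then show ?thesis by (simp add: power2_eq_square algebra_simps)
  qed
  finally show ?thesis .
qed

end

lemma square_sum4_le: "(a + b + c + d)\<^sup>2 \<le> 4 * (a\<^sup>2 + b\<^sup>2 + c\<^sup>2 + d\<^sup>2 :: real)"
  using square_add_le[of "a + b" "c + d"] square_add_le[of a b] square_add_le[of c d]
  by (simp add: add.assoc)

section \<open>Second moments of the number of close positions\<close>

context ball_words
begin

text \<open>Bounds the expected number of positions \<open>j\<close> whose change to a uniform
  letter comes near \<open>b\<close>; the summands are the cases of
  \<open>near_upd_reduce\<close>.\<close>

definition psi1 :: "(nat \<Rightarrow> nat) \<Rightarrow> nat \<Rightarrow> real" where
  "psi1 w b = (\<Sum>j=1..N. avg {1..n} (\<lambda>y. pr w (w j) b + pr w (w (j - 1)) b + pr w y b +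
     of_bool (first w (w j) = j \<and> near (tree w) R (par (w(j := y)) (w j)) b)))"

text \<open>The analogue for words resampled after \<open>j\<close>. Positions \<open>j < a\<close>
  drop out because conditioning on the letters up to \<open>j\<close> ignores letter
  \<open>a\<close>.\<close>

definition psi2 :: "nat \<Rightarrow> (nat \<Rightarrow> nat) \<Rightarrow> nat \<Rightarrow> real" where
  "psi2 a w b = (\<Sum>j=1..N. of_bool (a < j) * (hit j j w b + hit j (j - 1) w b +
     avg {1..n} (\<lambda>y. avg words (\<lambda>Y. pr (mix j w Y) y b)) + hit (j - 1) j w b))"

text \<open>The order of all second moments below: the square of a typical count, plus the loss on
  bad words, where a count may reach \<open>N\<close>; the factor \<open>n\<close> comes from
  unvisited letters.\<close>

definition Theta :: real where "Theta = \<kappa>\<^sup>2 + real n * (real N)\<^sup>2 * \<beta>"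

lemma Theta1: "1 \<le> Theta"
proof -
  have "1 \<le> \<kappa>\<^sup>2" using \<kappa>1 by simp
  moreover have "0 \<le> real n * (real N)\<^sup>2 * \<beta>" using \<beta>0 by simp
  ultimately show ?thesis unfolding Theta_def by linarith
qed

lemma Theta_bounds: "\<kappa>\<^sup>2 \<le> Theta" "(real N)\<^sup>2 * \<beta> \<le> Theta" "real n * (real N)\<^sup>2 * \<beta> \<le> Theta" "\<kappa> \<le> Theta"
proof -
  have "1 * ((real N)\<^sup>2 * \<beta>) \<le> real n * ((real N)\<^sup>2 * \<beta>)"
    using n_pos \<beta>0 by (intro mult_right_mono) auto
  moreover have "0 \<le> (real N)\<^sup>2 * \<beta>" using \<beta>0 by simp
  moreover have "\<kappa> \<le> \<kappa>\<^sup>2" using \<kappa>1 by (simp add: power2_eq_square)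
  moreover have "0 \<le> \<kappa>\<^sup>2" by simp
  ultimately show "\<kappa>\<^sup>2 \<le> Theta" "(real N)\<^sup>2 * \<beta> \<le> Theta" "real n * (real N)\<^sup>2 * \<beta> \<le> Theta" "\<kappa> \<le> Theta"
    unfolding Theta_def mult.assoc by linarith+
qed

text \<open>If \<open>x = w j\<close> loses its first occurrence, its new parent is the letter before its second
  occurrence; this position determines \<open>j\<close>.\<close>

lemma sum_new_parent:
  assumes w: "w \<in> words" "good w" and b: "b \<in> {1..n}"
  shows "(\<Sum>j=1..N. avg {1..n} (\<lambda>y. of_bool (first w (w j) = j \<and> near (tree w) R (par (w(j := y)) (w j)) b))) \<le> 3 * \<kappa>"
proof -
  define J where "J = {j \<in> {1..N}. first w (w j) = j}"
  define nx where "nx = (\<lambda>j. LEAST k. j < k \<and> w k = w j)"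
  have nx: "j < nx j" "w (nx j) = w j" "\<And>i. j < i \<Longrightarrow> i < nx j \<Longrightarrow> w i \<noteq> w j" if j: "j \<in> J" for j
  proof -
    have f: "first w (w j) = j" using j by (simp add: J_def)
    obtain k where k: "k \<noteq> j" "w k = w j" using w words_in_V[OF w(1)] unfolding good_def by metis
    then have "j < k" using first_le[of w k] f by simp
    then have "j < nx j \<and> w (nx j) = w j" unfolding nx_def using k LeastI[of "\<lambda>k. j < k \<and> w k = w j" k] by blast
    then show "j < nx j" "w (nx j) = w j" by auto
    show "w i \<noteq> w j" if "j < i" "i < nx j" for i
      using not_less_Least[of i "\<lambda>k. j < k \<and> w k = w j"] that unfolding nx_def by auto
  qed
  have w1: "w j \<noteq> 1" if "j \<in> J" for j
    using that first_1[OF w(1)] unfolding J_def by auto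
  have bound: "of_bool (first w (w j) = j \<and> near (tree w) R (par (w(j := y)) (w j)) b) \<le>
      pr w (w (j - 1)) b + pr w y b + of_bool (j \<in> J) * pr w (w (nx j - 1)) b" if j: "j \<in> {1..N}" for j y
  proof (cases "first w (w j) = j \<and> near (tree w) R (par (w(j := y)) (w j)) b")
    case True
    then have jJ: "j \<in> J" using j by (simp add: J_def)
    have "par (w(j := y)) (w j) \<in> {w (j - 1), y, w (nx j - 1)}"
    proof (cases "y = w j")
      case True
      then have "w(j := y) = w" by auto
      then show ?thesis using w1[OF jJ] \<open>first w (w j) = j \<and> _\<close> by (simp add: par_def)
    next
      case False
      have f: "first (w(j := y)) (w j) = nx j"
      proof (rule first_eqI)
        show "(w(j := y)) (nx j) = w j" using nx[OF jJ] by simp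
        fix i assume "i < nx j"
        then show "(w(j := y)) i \<noteq> w j"
          using nx(3)[OF jJ, of i] False first_le[of w i] True by (cases "i < j"; cases "i = j") auto
      qed
      have "w j \<in> range (w(j := y))" using nx(1,2)[OF jJ] by (metis fun_upd_other less_irrefl rangeI)
      then have "par (w(j := y)) (w j) = (w(j := y)) (nx j - 1)" using w1[OF jJ] f by (simp add: par_def)
      then show ?thesis by simp
    qed
    then have "1 \<le> pr w (w (j - 1)) b + pr w y b + pr w (w (nx j - 1)) b"
      using True pr_01(1)[of w _ b] by (auto simp: pr_def add_nonneg_nonneg)
    then show ?thesis using True jJ by simp
  next
    case False
    then show ?thesis using pr_01(1) by (auto simp: add_nonneg_nonneg)
  qed
  have "(\<Sum>j=1..N. avg {1..n} (\<lambda>y. of_bool (first w (w j) = j \<and> near (tree w) R (par (w(j := y)) (w j)) b))) \<le>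
      (\<Sum>j=1..N. avg {1..n} (\<lambda>y. pr w (w (j - 1)) b + pr w y b + of_bool (j \<in> J) * pr w (w (nx j - 1)) b))"
    using bound by (intro sum_mono avg_mono) auto
  also have "\<dots> = (\<Sum>j=1..N. pr w (w (j - 1)) b) + (\<Sum>j=1..N. avg {1..n} (\<lambda>y. pr w y b)) +
      (\<Sum>j=1..N. of_bool (j \<in> J) * pr w (w (nx j - 1)) b)"
    by (simp only: avg_add avgV_const sum.distrib)
  also have "(\<Sum>j=1..N. of_bool (j \<in> J) * pr w (w (nx j - 1)) b) = (\<Sum>j\<in>J. pr w (w (nx j - 1)) b)"
    by (intro sum.mono_neutral_cong_right) (auto simp: J_def)
  also have "(\<Sum>j=1..N. pr w (w (j - 1)) b) \<le> \<kappa>"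
    using sum_pr_shift[OF w(1) b, of 1 "{1..N}"] w by simp
  also have "(\<Sum>j=1..N. avg {1..n} (\<lambda>y. pr w y b)) \<le> \<kappa>"
  proof -
    have "(\<Sum>j=1..N. avg {1..n} (\<lambda>y. pr w y b)) \<le> (\<Sum>j=1..N. real m / real n)"
      using avg_pr_le[OF b, of w] w by (intro sum_mono) simp
    then show ?thesis using Nm by simp
  qed
  also have "(\<Sum>j\<in>J. pr w (w (nx j - 1)) b) \<le> \<kappa>"
  proof (rule sum_pr_positions[OF w b])
    show "inj_on (\<lambda>j. nx j - 1) J"
    proof (rule inj_onI)
      fix j j' assume j: "j \<in> J" "j' \<in> J" "nx j - 1 = nx j' - 1"
      then have "nx j = nx j'" using nx(1)[OF j(1)] nx(1)[OF j(2)] by simp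
      then have "w j = w j'" using nx(2) j by metis
      then show "j = j'" using j unfolding J_def by auto
    qed
    fix j assume j: "j \<in> J"
    have "nx j \<in> {1..N}" using words_beyond[OF w(1), of "nx j"] nx(2)[OF j] w1[OF j] by metis
    then show "nx j - 1 \<le> N" by auto
  qed (auto simp: J_def)
  finally show ?thesis by (simp del: fun_upd_apply)
qed

lemma psi1_le:
  assumes w: "w \<in> words" and b: "b \<in> {1..n}"
  shows "0 \<le> psi1 w b" "psi1 w b \<le> 6 * \<kappa> + 4 * real N * bad w"
proof -
  show "0 \<le> psi1 w b" unfolding psi1_def using pr_01(1) by (intro sum_nonneg avg_nonneg add_nonneg_nonneg) auto
  show "psi1 w b \<le> 6 * \<kappa> + 4 * real N * bad w"
  proof (cases "good w")
    case True
    have "psi1 w b = (\<Sum>j=1..N. pr w (w (j - 0)) b) + (\<Sum>j=1..N. pr w (w (j - 1)) b) + (\<Sum>j=1..N. avg {1..n} (\<lambda>y. pr w y b)) +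
      (\<Sum>j=1..N. avg {1..n} (\<lambda>y. of_bool (first w (w j) = j \<and> near (tree w) R (par (w(j := y)) (w j)) b)))"
      unfolding psi1_def by (simp only: avg_add avgV_const sum.distrib diff_zero)
    also have "\<dots> \<le> \<kappa> + \<kappa> + \<kappa> + 3 * \<kappa>"
    proof (intro add_mono)
      show "(\<Sum>j=1..N. pr w (w (j - 0)) b) \<le> \<kappa>" "(\<Sum>j=1..N. pr w (w (j - 1)) b) \<le> \<kappa>"
        using sum_pr_shift[OF w b, of 0 "{1..N}"] sum_pr_shift[OF w b, of 1 "{1..N}"] True by simp_all
      have "(\<Sum>j=1..N. avg {1..n} (\<lambda>y. pr w y b)) \<le> (\<Sum>j=1..N. real m / real n)"
        using avg_pr_le[OF b, of w] True by (intro sum_mono) simp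
      then show "(\<Sum>j=1..N. avg {1..n} (\<lambda>y. pr w y b)) \<le> \<kappa>" using Nm by simp
    qed (rule sum_new_parent[OF w True b])
    finally show ?thesis using True by (simp del: fun_upd_apply)
  next
    case False
    have "psi1 w b \<le> (\<Sum>j=1..N. 1 + 1 + 1 + 1)"
      unfolding psi1_def using pr_01(2) by (intro sum_mono avg_le_const finite_V V_nonempty add_mono) auto
    then show ?thesis using False \<kappa>1 by simp
  qed
qed

lemma psi1_sq:
  assumes B: "\<And>w. w \<in> words \<Longrightarrow> B w \<in> {1..n}"
  shows "avg words (\<lambda>w. (psi1 w (B w))\<^sup>2) \<le> 200 * Theta"
proof -
  have "(psi1 w (B w))\<^sup>2 \<le> 72 * \<kappa>\<^sup>2 + 32 * (real N)\<^sup>2 * bad w" if w: "w \<in> words" for w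
  proof -
    have "(psi1 w (B w))\<^sup>2 \<le> 2 * (6 * \<kappa>)\<^sup>2 + 2 * (4 * real N * bad w)\<^sup>2"
      using psi1_le[OF w B[OF w]] by (intro square_le_of_le_add)
    then show ?thesis by (simp add: power_mult_distrib of_bool_def split: if_splits)
  qed
  then have "avg words (\<lambda>w. (psi1 w (B w))\<^sup>2) \<le> avg words (\<lambda>w. 72 * \<kappa>\<^sup>2 + 32 * (real N)\<^sup>2 * bad w)"
    by (intro avg_mono)
  also have "\<dots> = 72 * \<kappa>\<^sup>2 + 32 * (real N)\<^sup>2 * \<beta>" by (simp only: avg_add avg_cmult avgW_const \<beta>_def)
  also have "\<dots> \<le> 200 * Theta" using Theta_bounds Theta1 by simp
  finally show ?thesis .
qed

lemma psi2_nonneg: "0 \<le> psi2 a w b"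
  unfolding psi2_def using hit_01(1) pr_01(1) by (intro sum_nonneg mult_nonneg_nonneg add_nonneg_nonneg avg_nonneg) auto

lemma psi2_sq_le:
  "(psi2 a w b)\<^sup>2 \<le> 4 * ((\<Sum>j=1..N. of_bool (a < j) * hit j (j - 0) w b)\<^sup>2 + (\<Sum>j=1..N. of_bool (a < j) * hit j (j - 1) w b)\<^sup>2 +
     (\<Sum>j=1..N. avg {1..n} (\<lambda>y. avg words (\<lambda>Y. pr (mix j w Y) y b)))\<^sup>2 + (\<Sum>j=1..N. of_bool (a < j) * hit (j - 1) j w b)\<^sup>2)"
proof -
  have "psi2 a w b \<le> (\<Sum>j=1..N. of_bool (a < j) * hit j (j - 0) w b) + (\<Sum>j=1..N. of_bool (a < j) * hit j (j - 1) w b) +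
     (\<Sum>j=1..N. avg {1..n} (\<lambda>y. avg words (\<lambda>Y. pr (mix j w Y) y b))) + (\<Sum>j=1..N. of_bool (a < j) * hit (j - 1) j w b)"
    unfolding psi2_def sum.distrib[symmetric] using pr_01(1)
    by (intro sum_mono) (auto simp: of_bool_def intro!: avg_nonneg)
  then show ?thesis using power_mono[OF _ psi2_nonneg, of a w b _ 2] square_sum4_le order_trans by blast
qed

text \<open>The letter \<open>w a\<close> is visited before any \<open>j > a\<close>, so its
  nearness to visited letters is decided by the prefix.\<close>

lemma psi2_sq_own:
  assumes a: "a \<in> {1..N}"
  shows "avg words (\<lambda>w. (psi2 a w (w a))\<^sup>2) \<le> 200 * Theta"
proof -
  have V: "w a \<in> {1..n}" if "w \<in> words" for w using words_in_V[OF that] .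
  have v: "avg words (\<lambda>w. (\<Sum>j=1..N. of_bool (a < j) * hit j (j - s) w (w a))\<^sup>2) \<le> 2 * \<kappa>\<^sup>2 + 2 * (real N)\<^sup>2 * \<beta>" if s: "s \<le> 1" for s
  proof -
    have "avg words (\<lambda>w. (\<Sum>j=1..N. of_bool (a < j) * hit j (j - s) w (w a))\<^sup>2) \<le>
        avg words (\<lambda>w. (\<Sum>j=1..N. of_bool (w a \<in> w ` {..j}) * hit j (j - s) w (w a))\<^sup>2)"
      using hit_01(1) by (intro avg_mono power_mono sum_mono sum_nonneg) (auto simp: of_bool_def)
    also have "\<dots> \<le> 2 * \<kappa>\<^sup>2 + 2 * (real N)\<^sup>2 * \<beta>" by (rule hit_visited_sq[OF s V])
    finally show ?thesis .
  qed
  define S1 where "S1 = (\<lambda>w. (\<Sum>j=1..N. of_bool (a < j) * hit j (j - 0) w (w a))\<^sup>2)"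
  define S2 where "S2 = (\<lambda>w. (\<Sum>j=1..N. of_bool (a < j) * hit j (j - 1) w (w a))\<^sup>2)"
  define S3 where "S3 = (\<lambda>w. (\<Sum>j=1..N. avg {1..n} (\<lambda>y. avg words (\<lambda>Y. pr (mix j w Y) y (w a))))\<^sup>2)"
  define S4 where "S4 = (\<lambda>w. (\<Sum>j=1..N. of_bool (a < j) * hit (j - 1) j w (w a))\<^sup>2)"
  have "avg words (\<lambda>w. (psi2 a w (w a))\<^sup>2) \<le> avg words (\<lambda>w. 4 * (S1 w + S2 w + S3 w + S4 w))"
    unfolding S1_def S2_def S3_def S4_def by (intro avg_mono psi2_sq_le)
  also have "\<dots> = 4 * (avg words S1 + avg words S2 + avg words S3 + avg words S4)"
    by (simp only: avg_add avg_cmult)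
  finally have *: "avg words (\<lambda>w. (psi2 a w (w a))\<^sup>2) \<le> 4 * (avg words S1 + avg words S2 + avg words S3 + avg words S4)" .
  have b1: "avg words S1 \<le> 2 * \<kappa>\<^sup>2 + 2 * (real N)\<^sup>2 * \<beta>" unfolding S1_def by (rule v) simp
  have b2: "avg words S2 \<le> 2 * \<kappa>\<^sup>2 + 2 * (real N)\<^sup>2 * \<beta>" unfolding S2_def by (rule v) simp
  have b3: "avg words S3 \<le> 2 * \<kappa>\<^sup>2 + 2 * (real N)\<^sup>2 * \<beta>" unfolding S3_def by (rule hit_fresh_sq[OF V])
  have b4: "avg words S4 \<le> 2 * (\<kappa> + \<kappa>\<^sup>2) + 2 * (real N)\<^sup>2 * \<beta>"
    unfolding S4_def by (rule hit_future_sq[OF V]) simp_all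
  define K B where "K = \<kappa>\<^sup>2" and "B = (real N)\<^sup>2 * \<beta>"
  note bounds = * b1 b2 b3 b4 Theta_bounds(1,2,4) Theta1
  show ?thesis using bounds unfolding mult.assoc K_def[symmetric] B_def[symmetric] by argo
qed

text \<open>An independent letter \<open>c\<close> may or may not be visited at time
  \<open>j\<close>; the two cases are estimated separately.\<close>

lemma psi2_sq_ext:
  "avg words (\<lambda>w. avg {1..n} (\<lambda>c. (psi2 a w c)\<^sup>2)) \<le> 200 * Theta"
proof -
  have v: "avg words (\<lambda>w. avg {1..n} (\<lambda>c. (\<Sum>j=1..N. of_bool (a < j) * hit j (j - s) w c)\<^sup>2)) \<le>
      2 * (2 * \<kappa>\<^sup>2 + 2 * (real N)\<^sup>2 * \<beta>) + 2 * (2 * \<kappa>\<^sup>2 + 4 * real n * (real N)\<^sup>2 * \<beta>)" if s: "s \<le> 1" for s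
  proof -
    have "(\<Sum>j=1..N. of_bool (a < j) * hit j (j - s) w c)\<^sup>2 \<le>
        2 * (\<Sum>j=1..N. of_bool (c \<in> w ` {..j}) * hit j (j - s) w c)\<^sup>2 +
        2 * (\<Sum>j=1..N. of_bool (c \<notin> w ` {..j}) * hit j (j - s) w c)\<^sup>2" for w c
    proof (rule square_le_of_le_add)
      show "0 \<le> (\<Sum>j=1..N. of_bool (a < j) * hit j (j - s) w c)" using hit_01(1) by (intro sum_nonneg) auto
      show "(\<Sum>j=1..N. of_bool (a < j) * hit j (j - s) w c) \<le>
        (\<Sum>j=1..N. of_bool (c \<in> w ` {..j}) * hit j (j - s) w c) + (\<Sum>j=1..N. of_bool (c \<notin> w ` {..j}) * hit j (j - s) w c)"
        unfolding sum.distrib[symmetric] using hit_01(1) by (intro sum_mono) (simp add: of_bool_def)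
    qed
    then have "avg words (\<lambda>w. avg {1..n} (\<lambda>c. (\<Sum>j=1..N. of_bool (a < j) * hit j (j - s) w c)\<^sup>2)) \<le>
        avg words (\<lambda>w. avg {1..n} (\<lambda>c. 2 * (\<Sum>j=1..N. of_bool (c \<in> w ` {..j}) * hit j (j - s) w c)\<^sup>2 +
        2 * (\<Sum>j=1..N. of_bool (c \<notin> w ` {..j}) * hit j (j - s) w c)\<^sup>2))" by (intro avg_mono)
    also have "\<dots> = 2 * avg words (\<lambda>w. avg {1..n} (\<lambda>c. (\<Sum>j=1..N. of_bool (c \<in> w ` {..j}) * hit j (j - s) w c)\<^sup>2)) +
        2 * avg words (\<lambda>w. avg {1..n} (\<lambda>c. (\<Sum>j=1..N. of_bool (c \<notin> w ` {..j}) * hit j (j - s) w c)\<^sup>2))"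
      by (simp only: avg_add avg_cmult)
    finally have le: "avg words (\<lambda>w. avg {1..n} (\<lambda>c. (\<Sum>j=1..N. of_bool (a < j) * hit j (j - s) w c)\<^sup>2)) \<le>
        2 * avg words (\<lambda>w. avg {1..n} (\<lambda>c. (\<Sum>j=1..N. of_bool (c \<in> w ` {..j}) * hit j (j - s) w c)\<^sup>2)) +
        2 * avg words (\<lambda>w. avg {1..n} (\<lambda>c. (\<Sum>j=1..N. of_bool (c \<notin> w ` {..j}) * hit j (j - s) w c)\<^sup>2))" .
    have p1: "avg words (\<lambda>w. avg {1..n} (\<lambda>c. (\<Sum>j=1..N. of_bool (c \<in> w ` {..j}) * hit j (j - s) w c)\<^sup>2)) \<le>
        2 * \<kappa>\<^sup>2 + 2 * (real N)\<^sup>2 * \<beta>"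
      by (subst avg_swap, rule avg_le_const[OF finite_V V_nonempty], rule hit_visited_sq[OF s])
    show ?thesis by (rule order_trans[OF le add_mono[OF mult_left_mono[OF p1] mult_left_mono[OF hit_unvisited_sq[OF s]]]]) simp_all
  qed
  have f: "avg words (\<lambda>w. avg {1..n} (\<lambda>c. (\<Sum>j=1..N. avg {1..n} (\<lambda>y. avg words (\<lambda>Y. pr (mix j w Y) y c)))\<^sup>2)) \<le>
      2 * \<kappa>\<^sup>2 + 2 * (real N)\<^sup>2 * \<beta>"
    by (subst avg_swap, rule avg_le_const[OF finite_V V_nonempty], rule hit_fresh_sq)
  have g: "avg words (\<lambda>w. avg {1..n} (\<lambda>c. (\<Sum>j=1..N. of_bool (a < j) * hit (j - 1) j w c)\<^sup>2)) \<le>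
      2 * (\<kappa> + \<kappa>\<^sup>2) + 2 * (real N)\<^sup>2 * \<beta>"
    by (subst avg_swap, rule avg_le_const[OF finite_V V_nonempty], rule hit_future_sq) simp_all
  define S1 where "S1 = (\<lambda>w c. (\<Sum>j=1..N. of_bool (a < j) * hit j (j - 0) w c)\<^sup>2)"
  define S2 where "S2 = (\<lambda>w c. (\<Sum>j=1..N. of_bool (a < j) * hit j (j - 1) w c)\<^sup>2)"
  define S3 where "S3 = (\<lambda>w c. (\<Sum>j=1..N. avg {1..n} (\<lambda>y. avg words (\<lambda>Y. pr (mix j w Y) y c)))\<^sup>2)"
  define S4 where "S4 = (\<lambda>w c. (\<Sum>j=1..N. of_bool (a < j) * hit (j - 1) j w c)\<^sup>2)"
  let ?E = "\<lambda>S. avg words (\<lambda>w. avg {1..n} (\<lambda>c. S w c))"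
  have "avg words (\<lambda>w. avg {1..n} (\<lambda>c. (psi2 a w c)\<^sup>2)) \<le> avg words (\<lambda>w. avg {1..n} (\<lambda>c. 4 * (S1 w c + S2 w c + S3 w c + S4 w c)))"
    unfolding S1_def S2_def S3_def S4_def by (intro avg_mono psi2_sq_le)
  also have "\<dots> = 4 * (?E S1 + ?E S2 + ?E S3 + ?E S4)"
    by (simp only: avg_add avg_cmult)
  finally have *: "avg words (\<lambda>w. avg {1..n} (\<lambda>c. (psi2 a w c)\<^sup>2)) \<le> 4 * (?E S1 + ?E S2 + ?E S3 + ?E S4)" .
  have b1: "?E S1 \<le> 2 * (2 * \<kappa>\<^sup>2 + 2 * (real N)\<^sup>2 * \<beta>) + 2 * (2 * \<kappa>\<^sup>2 + 4 * real n * (real N)\<^sup>2 * \<beta>)"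
    unfolding S1_def by (rule v) simp
  have b2: "?E S2 \<le> 2 * (2 * \<kappa>\<^sup>2 + 2 * (real N)\<^sup>2 * \<beta>) + 2 * (2 * \<kappa>\<^sup>2 + 4 * real n * (real N)\<^sup>2 * \<beta>)"
    unfolding S2_def by (rule v) simp
  define K B D where "K = \<kappa>\<^sup>2" and "B = (real N)\<^sup>2 * \<beta>" and "D = real n * B"
  have b3: "?E S3 \<le> 2 * \<kappa>\<^sup>2 + 2 * (real N)\<^sup>2 * \<beta>" unfolding S3_def by (rule f)
  have b4: "?E S4 \<le> 2 * (\<kappa> + \<kappa>\<^sup>2) + 2 * (real N)\<^sup>2 * \<beta>" unfolding S4_def by (rule g)
  note bounds = * b1 b2 b3 b4 Theta_bounds Theta1
  show ?thesis using bounds unfolding mult.assoc K_def[symmetric] B_def[symmetric] D_def[symmetric] by argo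
qed

end

lemma abs_diff_prod_le: "\<bar>p * q - p' * q'\<bar> \<le> \<bar>p - p'\<bar> * \<bar>q\<bar> + \<bar>p'\<bar> * \<bar>q - q' :: real\<bar>"
proof -
  have "p * q - p' * q' = (p - p') * q + p' * (q - q')" by (simp add: algebra_simps)
  then show ?thesis using abs_triangle_ineq[of "(p - p') * q" "p' * (q - q')"] by (simp only: abs_mult)
qed

section \<open>Variances of the quadratic terms\<close>

locale local_parameter = ball_words +
  fixes F :: "graph \<Rightarrow> real" and \<alpha> \<rho> :: real
  assumes lip: "tree_lipschitz n \<alpha> F" and \<alpha>0: "0 \<le> \<alpha>" and sup: "superposable n \<rho> F"
    and R: "\<And>r. real r < \<rho> \<Longrightarrow> r + 2 \<le> R" "1 \<le> R"
begin

abbreviation f :: "(nat \<Rightarrow> nat) \<Rightarrow> real" where "f w \<equiv> F (tree w)"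

abbreviation A :: real where "A \<equiv> 3 * \<alpha>"

lemma dlt_bound: "w \<in> words \<Longrightarrow> j \<in> {1..N} \<Longrightarrow> y \<in> {1..n} \<Longrightarrow> \<bar>dlt f j w y\<bar> \<le> A"
  unfolding dlt_def by (rule lipschitz_words[OF lip \<alpha>0])

text \<open>The negation is the hypothesis \<open>far\<close> of
  \<open>second_difference\<close>.\<close>

definition close :: "(nat \<Rightarrow> nat) \<Rightarrow> nat \<Rightarrow> nat \<Rightarrow> nat \<Rightarrow> nat \<Rightarrow> bool" where
  "close w j y a c \<longleftrightarrow> (\<exists>\<sigma> \<tau>. \<exists>u\<in>{w j, y}. \<exists>v\<in>{w a, c}. near (tree (corner w j y a c \<sigma> \<tau>)) R u v)"

lemma dlt_dlt:
  assumes w: "w \<in> words" and j: "j \<in> {1..N}" and y: "y \<in> {1..n}"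
    and a: "a \<in> {1..N}" and c: "c \<in> {1..n}" and ja: "j \<noteq> a"
  shows "\<bar>dlt f j w y - dlt f j (w(a := c)) y\<bar> \<le> 2 * A * of_bool (close w j y a c)"
proof (cases "close w j y a c")
  case True
  then show ?thesis
    using dlt_bound[OF w j y] dlt_bound[OF upd_words[OF w a c] j y] by (simp del: fun_upd_apply)
next
  case False
  have "F (tree (w(a := c, j := y))) - F (tree (w(j := y))) - F (tree (w(a := c))) + F (tree w) = 0"
    using False by (intro second_difference[OF sup w j y a c ja R]) (auto simp: close_def)
  then show ?thesis using False by (simp add: dlt_def del: fun_upd_apply)
qed

text \<open>By \<open>near_upd_reduce\<close> only the two corners without the change at
  \<open>j\<close> remain. \<open>G\<close> is left open because the last case is counted
  differently for the word itself and after resampling.\<close>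

lemma close_le:
  assumes w: "w \<in> words" and j: "j \<in> {1..N}" and y: "y \<in> {1..n}"
    and a: "a \<in> {1..N}" and c: "c \<in> {1..n}" and ja: "j \<noteq> a"
    and G: "\<And>t b. t \<in> {w, w(a := c)} \<Longrightarrow> b \<in> {w a, c} \<Longrightarrow> 0 \<le> G t b"
    and H: "\<And>t b. t \<in> {w, w(a := c)} \<Longrightarrow> b \<in> {w a, c} \<Longrightarrow>
      near (tree t) R (t j) b \<or> near (tree t) R (t (j - 1)) b \<or> near (tree t) R y b \<or>
      first t (t j) = j \<and> near (tree t) R (par (t(j := y)) (t j)) b \<and> near (tree (t(j := y))) R (t j) b \<Longrightarrow> 1 \<le> G t b"
  shows "of_bool (close w j y a c) \<le> (G w (w a) + G w c) + (G (w(a := c)) (w a) + G (w(a := c)) c :: real)"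
proof (cases "close w j y a c")
  case True
  then obtain \<sigma> \<tau> u v where uv: "u \<in> {w j, y}" "v \<in> {w a, c}" "near (tree (corner w j y a c \<sigma> \<tau>)) R u v"
    unfolding close_def by blast
  define t where "t = (if \<tau> then w(a := c) else w)"
  have t: "t \<in> words" "t \<in> {w, w(a := c)}" "t j = w j" unfolding t_def using upd_words[OF w a c] w ja by auto
  have ct: "corner w j y a c \<sigma> \<tau> = (if \<sigma> then t(j := y) else t)" unfolding corner_def t_def Let_def by simp
  have "1 \<le> G t v"
  proof (rule H[OF t(2) uv(2)])
    show "near (tree t) R (t j) v \<or> near (tree t) R (t (j - 1)) v \<or> near (tree t) R y v \<or>
      first t (t j) = j \<and> near (tree t) R (par (t(j := y)) (t j)) v \<and> near (tree (t(j := y))) R (t j) v"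
    proof (cases \<sigma>)
      case True
      then have "near (tree (t(j := y))) R u v" using uv(3) ct by simp
      moreover have "u = t j \<or> u = y" using uv(1) t(3) by auto
      ultimately show ?thesis using near_upd_reduce[OF t(1) j y, of R u v] by blast
    next
      case False
      then show ?thesis using uv t(3) ct by auto
    qed
  qed
  then show ?thesis
    using True t(2) uv(2) G[of w "w a"] G[of w c] G[of "w(a := c)" "w a"] G[of "w(a := c)" c] by (auto simp del: fun_upd_apply)
next
  case False
  then show ?thesis
    using G[of w "w a"] G[of w c] G[of "w(a := c)" "w a"] G[of "w(a := c)" c] by (simp del: fun_upd_apply)
qed

definition tot :: "nat \<Rightarrow> (nat \<Rightarrow> nat) \<Rightarrow> nat \<Rightarrow> real" where
  "tot a w b = psi1 w b + psi2 a w b"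

lemma sum_close:
  assumes w: "w \<in> words" and a: "a \<in> {1..N}" and c: "c \<in> {1..n}"
  shows "(\<Sum>j\<in>{1..N} - {a}. avg {1..n} (\<lambda>y. of_bool (close w j y a c)) +
      of_bool (a < j) * avg {1..n} (\<lambda>y. avg words (\<lambda>Y. of_bool (close (mix j w Y) j y a c)))) \<le>
    (tot a w (w a) + tot a w c) + (tot a (w(a := c)) (w a) + tot a (w(a := c)) c)"
proof -
  define w' where "w' = w(a := c)"
  have w': "w' \<in> words" unfolding w'_def by (rule upd_words[OF w a c])
  define G1 where "G1 = (\<lambda>t j y b. pr t (t j) b + pr t (t (j - 1)) b + pr t y b +
     of_bool (first t (t j) = j \<and> near (tree t) R (par (t(j := y)) (t j)) b))"
  define G2 where "G2 = (\<lambda>t j y b. pr t (t j) b + pr t (t (j - 1)) b + pr t y b + pr (t(j := y)) (t j) b)"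
  have G0: "0 \<le> G1 t j y b" "0 \<le> G2 t j y b" for t j y b
    unfolding G1_def G2_def using pr_01(1) by (auto intro!: add_nonneg_nonneg)
  have c1: "of_bool (close w j y a c) \<le> (G1 w j y (w a) + G1 w j y c) + (G1 w' j y (w a) + G1 w' j y c)"
    if "j \<in> {1..N} - {a}" "y \<in> {1..n}" for j y
    unfolding w'_def
  proof (rule close_le[OF w _ that(2) a c, where G = "\<lambda>t b. G1 t j y b"])
    fix t b assume "near (tree t) R (t j) b \<or> near (tree t) R (t (j - 1)) b \<or> near (tree t) R y b \<or>
      first t (t j) = j \<and> near (tree t) R (par (t(j := y)) (t j)) b \<and> near (tree (t(j := y))) R (t j) b"
    then show "1 \<le> G1 t j y b" using pr_01(1)[of t] unfolding G1_def
      by (elim disjE) (simp_all add: pr_def del: fun_upd_apply)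
  qed (use that G0 in auto)
  have c2: "of_bool (close t j y a c) \<le> (G2 t j y (t a) + G2 t j y c) + (G2 (t(a := c)) j y (t a) + G2 (t(a := c)) j y c)"
    if "j \<in> {1..N} - {a}" "y \<in> {1..n}" "t \<in> words" for j y t
  proof (rule close_le[OF that(3) _ that(2) a c, where G = "\<lambda>t b. G2 t j y b"])
    fix t b assume "near (tree t) R (t j) b \<or> near (tree t) R (t (j - 1)) b \<or> near (tree t) R y b \<or>
      first t (t j) = j \<and> near (tree t) R (par (t(j := y)) (t j)) b \<and> near (tree (t(j := y))) R (t j) b"
    then show "1 \<le> G2 t j y b" using pr_01(1)[of t] pr_01(1)[of "t(j := y)"] unfolding G2_def
      by (elim disjE) (simp_all add: pr_def del: fun_upd_apply)
  qed (use that G0 in auto)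
  have p1: "(\<Sum>j=1..N. avg {1..n} (\<lambda>y. G1 t j y b)) = psi1 t b" for t b
    unfolding psi1_def G1_def ..
  have p2: "(\<Sum>j=1..N. of_bool (a < j) * avg {1..n} (\<lambda>y. avg words (\<lambda>Y. G2 (mix j t Y) j y b))) = psi2 a t b"
    if t: "t \<in> words" for t b
    unfolding psi2_def
  proof (intro sum.cong refl arg_cong2[where f = "(*)"])
    fix j assume j: "j \<in> {1..N}"
    \<comment> \<open>With both the tail and \<open>y\<close> averaged out, the word changed at
      \<open>j\<close> is a word resampled from \<open>j\<close> on.\<close>
    have "avg {1..n} (\<lambda>y. avg words (\<lambda>Y. pr ((mix j t Y)(j := y)) (t j) b)) = hit (j - 1) j t b"
    proof -
      have "(mix j t Y)(j := y) = mix (j - 1) t (Y(j := y))" for y Y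
        using j by (subst mix_upd_right[symmetric]) (auto simp: mix_upd_left)
      then have "avg {1..n} (\<lambda>y. avg words (\<lambda>Y. pr ((mix j t Y)(j := y)) (t j) b)) =
          avg words (\<lambda>Y. avg {1..n} (\<lambda>y. pr (mix (j - 1) t (Y(j := y))) (t j) b))"
        by (subst avg_swap) simp
      also have "\<dots> = hit (j - 1) j t b"
        unfolding hit_def using avg_resample1[OF j, of "\<lambda>Y. pr (mix (j - 1) t Y) (t j) b"] by simp
      finally show ?thesis .
    qed
    then show "avg {1..n} (\<lambda>y. avg words (\<lambda>Y. G2 (mix j t Y) j y b)) =
        hit j j t b + hit j (j - 1) t b + avg {1..n} (\<lambda>y. avg words (\<lambda>Y. pr (mix j t Y) y b)) + hit (j - 1) j t b"
      unfolding G2_def by (simp only: avg_add avgV_const mix_apply hit_def) (simp add: mix_apply avgV_const)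
  qed
  have "(\<Sum>j\<in>{1..N} - {a}. avg {1..n} (\<lambda>y. of_bool (close w j y a c)) +
      of_bool (a < j) * avg {1..n} (\<lambda>y. avg words (\<lambda>Y. of_bool (close (mix j w Y) j y a c)))) \<le>
    (\<Sum>j\<in>{1..N} - {a}. ((avg {1..n} (\<lambda>y. G1 w j y (w a)) + avg {1..n} (\<lambda>y. G1 w j y c)) + (avg {1..n} (\<lambda>y. G1 w' j y (w a)) + avg {1..n} (\<lambda>y. G1 w' j y c))) +
      of_bool (a < j) * ((avg {1..n} (\<lambda>y. avg words (\<lambda>Y. G2 (mix j w Y) j y (w a))) + avg {1..n} (\<lambda>y. avg words (\<lambda>Y. G2 (mix j w Y) j y c))) +
        (avg {1..n} (\<lambda>y. avg words (\<lambda>Y. G2 (mix j w' Y) j y (w a))) + avg {1..n} (\<lambda>y. avg words (\<lambda>Y. G2 (mix j w' Y) j y c)))))"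
  proof (intro sum_mono add_mono)
    fix j assume j: "j \<in> {1..N} - {a}"
    show "avg {1..n} (\<lambda>y. of_bool (close w j y a c)) \<le>
      (avg {1..n} (\<lambda>y. G1 w j y (w a)) + avg {1..n} (\<lambda>y. G1 w j y c)) + (avg {1..n} (\<lambda>y. G1 w' j y (w a)) + avg {1..n} (\<lambda>y. G1 w' j y c))"
      unfolding avg_add[symmetric] by (intro avg_mono c1 j)
    show "of_bool (a < j) * avg {1..n} (\<lambda>y. avg words (\<lambda>Y. of_bool (close (mix j w Y) j y a c))) \<le>
      of_bool (a < j) * ((avg {1..n} (\<lambda>y. avg words (\<lambda>Y. G2 (mix j w Y) j y (w a))) + avg {1..n} (\<lambda>y. avg words (\<lambda>Y. G2 (mix j w Y) j y c))) +
        (avg {1..n} (\<lambda>y. avg words (\<lambda>Y. G2 (mix j w' Y) j y (w a))) + avg {1..n} (\<lambda>y. avg words (\<lambda>Y. G2 (mix j w' Y) j y c))))"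
    proof (cases "a < j")
      case True
      have *: "of_bool (close (mix j w Y) j y a c) \<le> (G2 (mix j w Y) j y (w a) + G2 (mix j w Y) j y c) + (G2 (mix j w' Y) j y (w a) + G2 (mix j w' Y) j y c)"
        if y: "y \<in> {1..n}" and Y: "Y \<in> words" for y Y
        using c2[OF j y mix_words[OF w Y, of j]] True unfolding w'_def by (simp add: mix_upd_left mix_apply del: fun_upd_apply)
      have "avg {1..n} (\<lambda>y. avg words (\<lambda>Y. of_bool (close (mix j w Y) j y a c))) \<le>
        avg {1..n} (\<lambda>y. avg words (\<lambda>Y. (G2 (mix j w Y) j y (w a) + G2 (mix j w Y) j y c) + (G2 (mix j w' Y) j y (w a) + G2 (mix j w' Y) j y c)))"
        by (intro avg_mono *)
      then show ?thesis by (simp only: True avg_add of_bool_eq mult_1_left)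
    qed simp
  qed
  also have "\<dots> \<le> (\<Sum>j=1..N. ((avg {1..n} (\<lambda>y. G1 w j y (w a)) + avg {1..n} (\<lambda>y. G1 w j y c)) + (avg {1..n} (\<lambda>y. G1 w' j y (w a)) + avg {1..n} (\<lambda>y. G1 w' j y c))) +
      of_bool (a < j) * ((avg {1..n} (\<lambda>y. avg words (\<lambda>Y. G2 (mix j w Y) j y (w a))) + avg {1..n} (\<lambda>y. avg words (\<lambda>Y. G2 (mix j w Y) j y c))) +
        (avg {1..n} (\<lambda>y. avg words (\<lambda>Y. G2 (mix j w' Y) j y (w a))) + avg {1..n} (\<lambda>y. avg words (\<lambda>Y. G2 (mix j w' Y) j y c)))))"
    using G0 by (intro sum_mono2) (auto intro!: add_nonneg_nonneg mult_nonneg_nonneg avg_nonneg)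
  also have "\<dots> = (tot a w (w a) + tot a w c) + (tot a w' (w a) + tot a w' c)"
    unfolding tot_def p1[symmetric] p2[OF w, symmetric] p2[OF w', symmetric] sum.distrib[symmetric]
    by (intro sum.cong refl) (simp add: algebra_simps)
  finally show ?thesis unfolding w'_def .
qed

text \<open>The identity as \<open>h\<close> gives \<open>qvar\<close>, the absolute value gives \<open>qvar_abs\<close>.\<close>

definition qgen :: "(real \<Rightarrow> real) \<Rightarrow> (nat \<Rightarrow> nat) \<Rightarrow> real" where
  "qgen h w = (\<Sum>j=1..N. avg {1..n} (\<lambda>y. h (dpre f j w y) * dlt f j w y))"

text \<open>A product rule for the change of letter \<open>a\<close>: in the summand
  \<open>j\<close>, \<open>dlt\<close> changes only if the positions are close, and
  \<open>dpre\<close> by at most the conditional probability of this, up to the factor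
  \<open>2 * A\<close>, or not at all if \<open>j < a\<close>. The summand \<open>j = a\<close> is
  bounded trivially.\<close>

lemma qgen_diff:
  assumes h: "\<And>u v. \<bar>h u - h v\<bar> \<le> \<bar>u - v\<bar>" "\<And>u. \<bar>h u\<bar> \<le> \<bar>u\<bar>"
    and w: "w \<in> words" and a: "a \<in> {1..N}" and c: "c \<in> {1..n}"
  shows "\<bar>dlt (qgen h) a w c\<bar> \<le> 2 * A\<^sup>2 * (1 + ((tot a w (w a) + tot a w c) + (tot a (w(a := c)) (w a) + tot a (w(a := c)) c)))"
proof -
  define w' where "w' = w(a := c)"
  have w': "w' \<in> words" unfolding w'_def by (rule upd_words[OF w a c])
  define T where "T = (\<lambda>w j. avg {1..n} (\<lambda>y. h (dpre f j w y) * dlt f j w y))"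
  have A0: "0 \<le> A" using \<alpha>0 by simp
  have dp: "\<bar>dpre f j t y\<bar> \<le> A" if "t \<in> words" "j \<in> {1..N}" "y \<in> {1..n}" for t j y
    using that dlt_bound by (intro dpre_bound) auto
  have hd: "\<bar>h (dpre f j t y)\<bar> \<le> A" if "t \<in> words" "j \<in> {1..N}" "y \<in> {1..n}" for t j y
    using dp[OF that] h(2)[of "dpre f j t y"] by linarith
  have prod: "\<bar>h (dpre f j t y) * dlt f j t y\<bar> \<le> A\<^sup>2" if "t \<in> words" "j \<in> {1..N}" "y \<in> {1..n}" for t j y
    unfolding abs_mult power2_eq_square using hd[OF that] dlt_bound[OF that] A0 by (intro mult_mono) auto
  have Ta: "\<bar>T w a - T w' a\<bar> \<le> 2 * A\<^sup>2"
  proof -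
    have b: "\<bar>T t a\<bar> \<le> A\<^sup>2" if "t \<in> words" for t
      unfolding T_def using prod[OF that a]
      by (intro order_trans[OF avg_abs_le] avg_le_const finite_V V_nonempty) auto
    show ?thesis using b[OF w] b[OF w'] by linarith
  qed
  have Tj: "\<bar>T w j - T w' j\<bar> \<le> 2 * A\<^sup>2 * (avg {1..n} (\<lambda>y. of_bool (close w j y a c)) +
      of_bool (a < j) * avg {1..n} (\<lambda>y. avg words (\<lambda>Y. of_bool (close (mix j w Y) j y a c))))"
    if j: "j \<in> {1..N} - {a}" for j
  proof -
    have jN: "j \<in> {1..N}" and ja: "j \<noteq> a" using j by auto
    have d: "\<bar>dpre f j w y - dpre f j w' y\<bar> \<le> 2 * A * (of_bool (a < j) * avg words (\<lambda>Y. of_bool (close (mix j w Y) j y a c)))"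
      if y: "y \<in> {1..n}" for y
    proof (cases "a < j")
      case True
      have m: "mix j w' Y = (mix j w Y)(a := c)" for Y unfolding w'_def using True by (simp add: mix_upd_left)
      have "\<bar>dpre f j w y - dpre f j w' y\<bar> \<le> avg words (\<lambda>Y. 2 * A * of_bool (close (mix j w Y) j y a c))"
        unfolding dpre_eq_avg[OF jN] avg_diff[symmetric] m
        by (intro avg_abs_mono dlt_dlt[OF mix_words[OF w] jN y a c ja])
      then show ?thesis using True by (simp only: avg_cmult) simp
    next
      case False
      have "mix j w' Y = mix j w Y" for Y unfolding w'_def using False ja by (simp add: mix_upd_left')
      then show ?thesis using False by (simp add: dpre_eq_avg[OF jN])
    qed
    have "\<bar>h (dpre f j w y) * dlt f j w y - h (dpre f j w' y) * dlt f j w' y\<bar> \<le>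
        2 * A\<^sup>2 * (of_bool (close w j y a c) + of_bool (a < j) * avg words (\<lambda>Y. of_bool (close (mix j w Y) j y a c)))"
      if y: "y \<in> {1..n}" for y
    proof -
      let ?X = "of_bool (a < j) * avg words (\<lambda>Y. of_bool (close (mix j w Y) j y a c)) :: real"
      have "\<bar>h (dpre f j w y) * dlt f j w y - h (dpre f j w' y) * dlt f j w' y\<bar> \<le>
          \<bar>h (dpre f j w y) - h (dpre f j w' y)\<bar> * \<bar>dlt f j w y\<bar> + \<bar>h (dpre f j w' y)\<bar> * \<bar>dlt f j w y - dlt f j w' y\<bar>"
        by (rule abs_diff_prod_le)
      also have "\<dots> \<le> (2 * A * ?X) * A + A * (2 * A * of_bool (close w j y a c))"
      proof (intro add_mono mult_mono)
        show "\<bar>h (dpre f j w y) - h (dpre f j w' y)\<bar> \<le> 2 * A * ?X" using h(1) d[OF y] order_trans by blast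
        show "\<bar>dlt f j w y\<bar> \<le> A" by (rule dlt_bound[OF w jN y])
        show "\<bar>h (dpre f j w' y)\<bar> \<le> A" by (rule hd[OF w' jN y])
        show "\<bar>dlt f j w y - dlt f j w' y\<bar> \<le> 2 * A * of_bool (close w j y a c)"
          unfolding w'_def by (rule dlt_dlt[OF w jN y a c ja])
      qed (use A0 in \<open>auto intro!: mult_nonneg_nonneg avg_nonneg\<close>)
      also have "\<dots> = 2 * A\<^sup>2 * (of_bool (close w j y a c) + ?X)"
      proof -
        have "(2 * q * x) * q + q * (2 * q * z) = 2 * q\<^sup>2 * (z + x)" for q x z :: real
          by (simp add: power2_eq_square algebra_simps)
        then show ?thesis .
      qed
      finally show ?thesis .
    qed
    then have "\<bar>T w j - T w' j\<bar> \<le> avg {1..n} (\<lambda>y. 2 * A\<^sup>2 * (of_bool (close w j y a c) + of_bool (a < j) * avg words (\<lambda>Y. of_bool (close (mix j w Y) j y a c))))"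
      unfolding T_def avg_diff[symmetric] by (intro avg_abs_mono)
    then show ?thesis by (simp only: avg_cmult avg_add)
  qed
  have "dlt (qgen h) a w c = (\<Sum>j=1..N. T w j - T w' j)"
    unfolding dlt_def qgen_def T_def w'_def sum_subtractf ..
  then have e: "dlt (qgen h) a w c = (T w a - T w' a) + (\<Sum>j\<in>{1..N} - {a}. T w j - T w' j)"
    using a by (simp add: sum.remove)
  have "\<bar>dlt (qgen h) a w c\<bar> \<le> \<bar>T w a - T w' a\<bar> + (\<Sum>j\<in>{1..N} - {a}. \<bar>T w j - T w' j\<bar>)"
    unfolding e by (rule order_trans[OF abs_triangle_ineq add_left_mono[OF sum_abs]])
  also have "\<dots> \<le> 2 * A\<^sup>2 + (\<Sum>j\<in>{1..N} - {a}. 2 * A\<^sup>2 * (avg {1..n} (\<lambda>y. of_bool (close w j y a c)) +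
      of_bool (a < j) * avg {1..n} (\<lambda>y. avg words (\<lambda>Y. of_bool (close (mix j w Y) j y a c)))))"
    by (intro add_mono Ta sum_mono Tj)
  also have "\<dots> = 2 * A\<^sup>2 * (1 + (\<Sum>j\<in>{1..N} - {a}. avg {1..n} (\<lambda>y. of_bool (close w j y a c)) +
      of_bool (a < j) * avg {1..n} (\<lambda>y. avg words (\<lambda>Y. of_bool (close (mix j w Y) j y a c)))))"
    by (simp only: sum_distrib_left[symmetric]) (simp only: distrib_left[of _ 1] mult_1_right)
  also have "\<dots> \<le> 2 * A\<^sup>2 * (1 + ((tot a w (w a) + tot a w c) + (tot a (w(a := c)) (w a) + tot a (w(a := c)) c)))"
    by (intro mult_left_mono add_left_mono sum_close[OF w a c]) simp
  finally show ?thesis .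
qed

lemma tot_sq:
  assumes a: "a \<in> {1..N}"
  shows "avg words (\<lambda>w. avg {1..n} (\<lambda>c. (tot a w (w a))\<^sup>2)) \<le> 800 * Theta"
    "avg words (\<lambda>w. avg {1..n} (\<lambda>c. (tot a w c)\<^sup>2)) \<le> 800 * Theta"
proof -
  have le: "(tot a w b)\<^sup>2 \<le> 2 * (psi1 w b)\<^sup>2 + 2 * (psi2 a w b)\<^sup>2" for w b
    unfolding tot_def by (rule square_add_le)
  have V: "w a \<in> {1..n}" if "w \<in> words" for w using words_in_V[OF that] .
  have "avg words (\<lambda>w. (tot a w (w a))\<^sup>2) \<le> avg words (\<lambda>w. 2 * (psi1 w (w a))\<^sup>2 + 2 * (psi2 a w (w a))\<^sup>2)"
    by (intro avg_mono le)
  also have "\<dots> = 2 * avg words (\<lambda>w. (psi1 w (w a))\<^sup>2) + 2 * avg words (\<lambda>w. (psi2 a w (w a))\<^sup>2)"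
    by (simp only: avg_add avg_cmult)
  also have "\<dots> \<le> 2 * (200 * Theta) + 2 * (200 * Theta)"
    by (intro add_mono mult_left_mono psi1_sq psi2_sq_own V a) simp_all
  finally show "avg words (\<lambda>w. avg {1..n} (\<lambda>c. (tot a w (w a))\<^sup>2)) \<le> 800 * Theta" by (simp add: avgV_const)
  have "avg words (\<lambda>w. avg {1..n} (\<lambda>c. (tot a w c)\<^sup>2)) \<le> avg words (\<lambda>w. avg {1..n} (\<lambda>c. 2 * (psi1 w c)\<^sup>2 + 2 * (psi2 a w c)\<^sup>2))"
    by (intro avg_mono le)
  also have "\<dots> = 2 * avg words (\<lambda>w. avg {1..n} (\<lambda>c. (psi1 w c)\<^sup>2)) + 2 * avg words (\<lambda>w. avg {1..n} (\<lambda>c. (psi2 a w c)\<^sup>2))"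
    by (simp only: avg_add avg_cmult)
  finally have *: "avg words (\<lambda>w. avg {1..n} (\<lambda>c. (tot a w c)\<^sup>2)) \<le>
    2 * avg words (\<lambda>w. avg {1..n} (\<lambda>c. (psi1 w c)\<^sup>2)) + 2 * avg words (\<lambda>w. avg {1..n} (\<lambda>c. (psi2 a w c)\<^sup>2))" .
  have "avg words (\<lambda>w. avg {1..n} (\<lambda>c. (psi1 w c)\<^sup>2)) \<le> 200 * Theta"
    by (subst avg_swap, rule avg_le_const[OF finite_V V_nonempty], rule psi1_sq)
  then show "avg words (\<lambda>w. avg {1..n} (\<lambda>c. (tot a w c)\<^sup>2)) \<le> 800 * Theta"
    using * psi2_sq_ext[of a] by argo
qed

lemma qgen_variance:
  assumes h: "\<And>u v. \<bar>h u - h v\<bar> \<le> \<bar>u - v\<bar>" "\<And>u. \<bar>h u\<bar> \<le> \<bar>u\<bar>"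
  shows "avg words (\<lambda>w. (qgen h w - avg words (qgen h))\<^sup>2) \<le> real N * 60000 * A ^ 4 * Theta"
proof -
  have sq: "avg words (\<lambda>w. avg {1..n} (\<lambda>c. (dlt (qgen h) a w c)\<^sup>2)) \<le> 120000 * A ^ 4 * Theta"
    if a: "a \<in> {1..N}" for a
  proof -
    let ?E = "\<lambda>S. avg words (\<lambda>w. avg {1..n} (\<lambda>c. S w c))"
    let ?S1 = "\<lambda>w c. (tot a w (w a))\<^sup>2" and ?S2 = "\<lambda>w c. (tot a w c)\<^sup>2"
    let ?S3 = "\<lambda>w c. (tot a (w(a := c)) (w a))\<^sup>2" and ?S4 = "\<lambda>w c. (tot a (w(a := c)) c)\<^sup>2"
    \<comment> \<open>Exchanging \<open>w a\<close> and \<open>c\<close> turns the changed word into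
      the original one and swaps the roles of own and independent letter.\<close>
    have E3: "?E ?S3 = ?E ?S2" by (subst (2) avg_resample[OF a]) simp
    have E4: "?E ?S4 = ?E ?S1" by (subst (2) avg_resample[OF a]) simp
    have pw: "(dlt (qgen h) a w c)\<^sup>2 \<le> 4 * A ^ 4 * (2 + 8 * (((?S1 w c + ?S2 w c) + ?S3 w c) + ?S4 w c))"
      if w: "w \<in> words" and c: "c \<in> {1..n}" for w c
    proof -
      let ?t = "(tot a w (w a) + tot a w c) + (tot a (w(a := c)) (w a) + tot a (w(a := c)) c)"
      have "(dlt (qgen h) a w c)\<^sup>2 \<le> (2 * A\<^sup>2 * (1 + ?t))\<^sup>2"
        using qgen_diff[OF h w a c] by (intro abs_le_square_iff[THEN iffD1] order_trans[OF _ abs_ge_self])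
      also have "\<dots> = 4 * A ^ 4 * (1 + ?t)\<^sup>2" by (simp add: power_mult_distrib)
      also have "\<dots> \<le> 4 * A ^ 4 * (2 + 8 * (((?S1 w c + ?S2 w c) + ?S3 w c) + ?S4 w c))"
      proof (rule mult_left_mono)
        show "(1 + ?t)\<^sup>2 \<le> 2 + 8 * (((?S1 w c + ?S2 w c) + ?S3 w c) + ?S4 w c)"
          using square_add_le[of 1 ?t] square_sum4_le[of "tot a w (w a)" "tot a w c" "tot a (w(a := c)) (w a)" "tot a (w(a := c)) c"]
          by (simp add: add.assoc del: fun_upd_apply)
      qed simp
      finally show ?thesis .
    qed
    have "?E (\<lambda>w c. (dlt (qgen h) a w c)\<^sup>2) \<le> ?E (\<lambda>w c. 4 * A ^ 4 * (2 + 8 * (((?S1 w c + ?S2 w c) + ?S3 w c) + ?S4 w c)))"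
      by (intro avg_mono pw)
    also have "\<dots> = 4 * A ^ 4 * (2 + 8 * (((?E ?S1 + ?E ?S2) + ?E ?S3) + ?E ?S4))"
      by (simp only: avg_cmult avg_add avgV_const avgW_const)
    also have "\<dots> \<le> 4 * A ^ 4 * (2 * Theta + 8 * (((800 * Theta + 800 * Theta) + 800 * Theta) + 800 * Theta))"
      unfolding E3 E4 using tot_sq[OF a] Theta1 by (intro mult_left_mono add_mono) auto
    \<comment> \<open>The constant is \<open>4 * (2 + 8 * 3200) = 102408\<close>, rounded
      up.\<close>
    also have "\<dots> \<le> 120000 * A ^ 4 * Theta"
      using Theta1 by (simp add: algebra_simps) 
    finally show ?thesis .
  qed
  have "avg words (\<lambda>w. (qgen h w - avg words (qgen h))\<^sup>2) \<le> (\<Sum>a=1..N. avg words (\<lambda>w. avg {1..n} (\<lambda>c. (dlt (qgen h) a w c)\<^sup>2))) / 2"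
    by (rule efron_stein)
  also have "\<dots> \<le> (\<Sum>a=1..N. 120000 * A ^ 4 * Theta) / 2"
    by (intro divide_right_mono sum_mono sq) auto
  finally show ?thesis by simp
qed

lemma qvar_variance:
  "avg words (\<lambda>w. (qvar f w - avg words (qvar f))\<^sup>2) \<le> real N * 60000 * A ^ 4 * Theta"
  "avg words (\<lambda>w. (qvar_abs f w)\<^sup>2) \<le> real N * 60000 * A ^ 4 * Theta"
proof -
  have "qgen (\<lambda>u. u) = qvar f" "qgen abs = qvar_abs f"
    by (simp_all add: fun_eq_iff qgen_def qvar_def qvar_abs_def)
  then show "avg words (\<lambda>w. (qvar f w - avg words (qvar f))\<^sup>2) \<le> real N * 60000 * A ^ 4 * Theta"
    "avg words (\<lambda>w. (qvar_abs f w)\<^sup>2) \<le> real N * 60000 * A ^ 4 * Theta"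
    using qgen_variance[of "\<lambda>u. u"] qgen_variance[of abs] avg_qvar_abs[of f] by (simp_all add: abs_triangle_ineq3)
qed

end

section \<open>The probability of bad words\<close>

lemma prod_of_bool: "finite K \<Longrightarrow> (\<Prod>k\<in>K. of_bool (P k) :: real) = of_bool (\<forall>k\<in>K. P k)"
  by (induction K rule: finite_induct) auto

lemma of_bool_ex_le_sum: "finite I \<Longrightarrow> of_bool (\<exists>i\<in>I. P i) \<le> (\<Sum>i\<in>I. of_bool (P i) :: real)"
proof (cases "\<exists>i\<in>I. P i")
  case True
  assume "finite I"
  obtain i where i: "i \<in> I" "P i" using True by blast
  have "of_bool (P i) \<le> (\<Sum>i\<in>I. of_bool (P i) :: real)" using i \<open>finite I\<close> by (intro member_le_sum) auto
  then show ?thesis using i by auto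
qed (auto intro: sum_nonneg)

lemma power_le_exp_neg: "0 \<le> 1 - x \<Longrightarrow> (1 - x) ^ k \<le> exp (- (real k * x :: real))"
  using power_mono[OF exp_ge_add_one_self[of "- x"], of k] by (simp add: exp_of_nat_mult[symmetric])

context tree_words
begin

lemma avg_avoid:
  assumes "v \<in> {1..n}" "K \<subseteq> {1..N}"
  shows "avg words (\<lambda>w. of_bool (\<forall>k\<in>K. w k \<noteq> v)) = (1 - 1 / real n) ^ card K"
proof -
  have fin: "finite K" using assms(2) finite_subset by blast
  have "(\<Sum>x\<in>{1..n}. of_bool (x \<noteq> v) :: real) = (\<Sum>x\<in>{1..n} - {v}. 1)"
    by (intro sum.mono_neutral_cong_right) auto
  also have "\<dots> = real n - 1" using assms(1) by (simp add: of_nat_diff)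
  finally have "avg {1..n} (\<lambda>x. of_bool (x \<noteq> v)) = 1 - 1 / real n"
    using n_pos by (simp add: avg_def diff_divide_distrib)
  then show ?thesis
    using avg_prod[OF fin assms(2), of "\<lambda>x. of_bool (x \<noteq> v)"] by (simp add: prod_of_bool[OF fin])
qed

lemma avg_avoid_le:
  assumes v: "v \<in> {1..n}" and K: "K \<subseteq> {1..N}"
  shows "avg words (\<lambda>w. of_bool (\<forall>k\<in>K. w k \<noteq> v)) \<le> exp (- (real (card K) / real n))"
proof -
  have "(1 - 1 / real n) ^ card K \<le> exp (- (real (card K) * (1 / real n)))"
    using n_pos by (intro power_le_exp_neg) simp
  then show ?thesis unfolding avg_avoid[OF v K] by simp
qed

lemma avg_uncovered: "avg words (\<lambda>w. of_bool (\<not> {1..n} \<subseteq> range w)) \<le> real n * exp (- (real N / real n))"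
proof -
  have "avg words (\<lambda>w. of_bool (\<not> {1..n} \<subseteq> range w)) \<le> avg words (\<lambda>w. \<Sum>v\<in>{1..n}. of_bool (\<forall>k\<in>{1..N}. w k \<noteq> v))"
  proof (intro avg_mono)
    fix w
    have "of_bool (\<not> {1..n} \<subseteq> range w) \<le> (of_bool (\<exists>v\<in>{1..n}. \<forall>k\<in>{1..N}. w k \<noteq> v) :: real)"
      by (simp add: of_bool_def) (metis rangeI subsetI)
    also have "\<dots> \<le> (\<Sum>v\<in>{1..n}. of_bool (\<forall>k\<in>{1..N}. w k \<noteq> v))" by (rule of_bool_ex_le_sum) simp
    finally show "of_bool (\<not> {1..n} \<subseteq> range w) \<le> (\<Sum>v\<in>{1..n}. of_bool (\<forall>k\<in>{1..N}. w k \<noteq> v) :: real)" .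
  qed
  also have "\<dots> \<le> (\<Sum>v\<in>{1..n}. exp (- (real N / real n)))"
    unfolding avg_sum using avg_avoid_le[of _ "{1..N}"] by (intro sum_mono) simp
  finally show ?thesis by simp
qed

text \<open>Markov's inequality for a product that doubles at each occurrence of \<open>v\<close>.
  The factor 2 accounts for position 0, whose letter is fixed.\<close>

lemma avg_multiplicity:
  assumes v: "v \<in> {1..n}"
  shows "avg words (\<lambda>w. of_bool (card {k. k \<le> N \<and> w k = v} > \<mu>)) \<le> 2 * exp (real N / real n) / 2 ^ \<mu>"
proof -
  define h where "h = (\<lambda>x. if x = v then 2 else 1 :: real)"
  have "of_bool (card {k. k \<le> N \<and> w k = v} > \<mu>) \<le> (\<Prod>k\<in>{1..N}. h (w k)) * (2 / 2 ^ \<mu>)" for w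
  proof (cases "card {k. k \<le> N \<and> w k = v} > \<mu>")
    case True
    have "(\<Prod>k\<in>{1..N}. h (w k)) = (\<Prod>k\<in>{k\<in>{1..N}. w k = v}. 2)"
      unfolding h_def by (intro prod.mono_neutral_cong_right) auto
    then have p: "(\<Prod>k\<in>{1..N}. h (w k)) = 2 ^ card {k\<in>{1..N}. w k = v}" by simp
    have "{k. k \<le> N \<and> w k = v} \<subseteq> insert 0 {k\<in>{1..N}. w k = v}" by auto
    then have "card {k. k \<le> N \<and> w k = v} \<le> card (insert 0 {k\<in>{1..N}. w k = v})" by (intro card_mono) auto
    also have "\<dots> \<le> Suc (card {k\<in>{1..N}. w k = v})" by (rule card_insert_le_m1) auto
    finally have "\<mu> \<le> card {k\<in>{1..N}. w k = v}" using True by simp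
    then have "(2::real) ^ \<mu> \<le> 2 ^ card {k\<in>{1..N}. w k = v}" by (intro power_increasing) auto
    also have "\<dots> \<le> 2 ^ card {k\<in>{1..N}. w k = v} * 2" by simp
    finally have "1 \<le> 2 ^ card {k\<in>{1..N}. w k = v} * 2 / (2::real) ^ \<mu>" by (simp only: le_divide_eq_1_pos zero_less_power zero_less_numeral)
    then show ?thesis using True unfolding p by simp
  next
    case False
    moreover have "0 \<le> (\<Prod>k\<in>{1..N}. h (w k))" by (intro prod_nonneg) (auto simp: h_def)
    ultimately show ?thesis by simp
  qed
  then have "avg words (\<lambda>w. of_bool (card {k. k \<le> N \<and> w k = v} > \<mu>)) \<le> avg words (\<lambda>w. (\<Prod>k\<in>{1..N}. h (w k)) * (2 / 2 ^ \<mu>))"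
    by (intro avg_mono)
  also have "\<dots> = avg {1..n} h ^ N * (2 / 2 ^ \<mu>)"
    unfolding avg_multc using avg_prod[of "{1..N}" h] by simp
  also have "avg {1..n} h = 1 + 1 / real n"
  proof -
    have "(\<Sum>x\<in>{1..n}. h x) = (\<Sum>x\<in>{1..n}. 1 + (if x = v then 1 else 0))"
      unfolding h_def by (intro sum.cong) auto
    also have "\<dots> = real n + 1" using v by (simp add: sum.distrib)
    finally show ?thesis using n_pos by (simp add: avg_def add_divide_distrib)
  qed
  also have "(1 + 1 / real n) ^ N * (2 / 2 ^ \<mu>) \<le> exp (1 / real n) ^ N * (2 / 2 ^ \<mu>)"
    using n_pos by (intro mult_right_mono power_mono) auto
  also have "exp (1 / real n) ^ N = exp (real N / real n)" by (simp add: exp_of_nat_mult[symmetric])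
  finally show ?thesis by (simp add: mult.commute)
qed

text \<open>With the tree rooted at \<open>b\<close>, the ball is dominated by
  \<open>reach_count\<close>, and Markov's inequality applies to its \<open>k\<close>-th
  power.\<close>

lemma avg_big_ball:
  assumes m: "0 < m"
  shows "avg (trees n) (\<lambda>T. of_bool (\<exists>b\<in>{1..n}. m < card {u \<in> {1..n}. near T R u b})) \<le>
    real n * (real (1 + k * R) ^ (k + 1) * real (R + 1) ^ k) / real m ^ k"
proof -
  let ?X = "\<lambda>b T. of_bool (m < card {u \<in> {1..n}. near T R u b}) :: real"
  have X: "avg (trees n) (?X b) \<le> (real (1 + k * R) ^ (k + 1) * real (R + 1) ^ k) / real m ^ k"
    if b: "b \<in> {1..n}" for b
  proof -
    have "?X b (edges g) \<le> real (reach_count {1..n} R {b} g) ^ k / real m ^ k" if g: "g \<in> forest {1..n} {b}" for g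
    proof (cases "m < card {u \<in> {1..n}. near (edges g) R u b}")
      case True
      have "g b = b" using g by (auto simp: forest_def)
      then have "card {u \<in> {1..n}. near (edges g) R u b} \<le> reach_count {1..n} R {b} g"
        unfolding reach_count_def using near_forest by (intro card_mono) auto
      then have "real m ^ k \<le> real (reach_count {1..n} R {b} g) ^ k" using True by (intro power_mono) auto
      then show ?thesis using True m by simp
    qed simp
    then have "avg (trees n) (?X b) \<le> avg (forest {1..n} {b}) (\<lambda>g. real (reach_count {1..n} R {b} g) ^ k / real m ^ k)"
      unfolding avg_trees_forest[OF b] by (intro avg_mono)
    also have "\<dots> = (\<Sum>g\<in>forest {1..n} {b}. real (reach_count {1..n} R {b} g) ^ k) / real (card (forest {1..n} {b})) / real m ^ k"
      by (simp add: avg_def sum_divide_distrib[symmetric])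
    also have "\<dots> \<le> (real (1 + k * R) ^ (k + 1) * real (R + 1) ^ k) / real m ^ k"
    proof (rule divide_right_mono)
      have "(\<Sum>g\<in>forest {1..n} {b}. real (reach_count {1..n} R {b} g) ^ k) \<le>
          real (card (forest {1..n} {b})) * (real (1 + k * R) ^ (k + 1) * real (R + 1) ^ k)"
        using forest_moment[of "{1..n}" "{b}" R k] b n_pos by simp
      then show "(\<Sum>g\<in>forest {1..n} {b}. real (reach_count {1..n} R {b} g) ^ k) / real (card (forest {1..n} {b})) \<le>
          real (1 + k * R) ^ (k + 1) * real (R + 1) ^ k"
        by (cases "card (forest {1..n} {b}) = 0") (auto simp: field_simps)
    qed simp
    finally show ?thesis .
  qed
  have "avg (trees n) (\<lambda>T. of_bool (\<exists>b\<in>{1..n}. m < card {u \<in> {1..n}. near T R u b})) \<le> avg (trees n) (\<lambda>T. \<Sum>b\<in>{1..n}. ?X b T)"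
    by (intro avg_mono of_bool_ex_le_sum) simp
  also have "\<dots> \<le> (\<Sum>b\<in>{1..n}. (real (1 + k * R) ^ (k + 1) * real (R + 1) ^ k) / real m ^ k)"
    unfolding avg_sum by (intro sum_mono X)
  finally show ?thesis by simp
qed

text \<open>Moving the parents to 1 one by one turns any tree into the star at 1 in at most
  \<open>n\<close> perturbations.\<close>

lemma lipschitz_range:
  assumes F: "tree_lipschitz n \<alpha> F" "0 \<le> \<alpha>" and T: "T \<in> trees n" "T' \<in> trees n"
  shows "\<bar>F T - F T'\<bar> \<le> 2 * real n * \<alpha>"
proof -
  have star: "\<bar>F (edges g) - F (edges (\<lambda>v. if v \<in> {1..n} then 1 else v))\<bar> \<le> real n * \<alpha>"
    if g: "g \<in> forest {1..n} {1}" for g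
  proof -
    define c where "c = (\<lambda>K v. if v \<in> K then 1 else g v)"
    have "K \<subseteq> {1..n} \<Longrightarrow> finite K \<Longrightarrow> c K \<in> forest {1..n} {1} \<and> \<bar>F (edges g) - F (edges (c K))\<bar> \<le> real (card K) * \<alpha>" for K
    proof (induction K rule: infinite_finite_induct)
      case empty then show ?case using g by (simp add: c_def)
    next
      case (insert i K)
      have cK: "c (insert i K) = (c K)(i := 1)" by (auto simp: c_def)
      have in_forest: "c (insert i K) \<in> forest {1..n} {1}"
      proof (rule forestI_rank[where rk = "depth g {1}"])
        fix v assume v: "v \<in> {1..n}" "v \<notin> {1}"
        have "depth g {1} 1 = 0" by (simp add: depth_def)
        then show "c (insert i K) v \<in> {1..n} \<and> depth g {1} (c (insert i K) v) < depth g {1} v"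
          using forest_rank(1)[OF g v] g v n_pos by (auto simp: c_def forest_def)
      qed (use g insert.prems n_pos in \<open>auto simp: c_def forest_def\<close>)
      have IH: "c K \<in> forest {1..n} {1}" "\<bar>F (edges g) - F (edges (c K))\<bar> \<le> real (card K) * \<alpha>"
        using insert by auto
      have "\<bar>F (edges (c K)) - F (edges ((c K)(i := 1)))\<bar> \<le> \<alpha>"
        using in_forest unfolding cK by (intro lipschitz_forest[OF F IH(1)])
      then have "\<bar>F (edges g) - F (edges ((c K)(i := 1)))\<bar> \<le> real (card K) * \<alpha> + \<alpha>" using IH(2) by linarith
      then show ?case using in_forest insert.hyps unfolding cK by (simp add: algebra_simps del: fun_upd_apply)
    qed simp
    from this[of "{1..n}"] have *: "\<bar>F (edges g) - F (edges (c {1..n}))\<bar> \<le> real n * \<alpha>" by simp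
    have "c {1..n} = (\<lambda>v. if v \<in> {1..n} then 1 else v)" using g by (auto simp: c_def forest_def fun_eq_iff)
    then show ?thesis using * by simp
  qed
  obtain g where g: "g \<in> forest {1..n} {1}" "edges g = T" using trees_eq_edges[OF T(1), of 1] n_pos by auto
  obtain g' where g': "g' \<in> forest {1..n} {1}" "edges g' = T'" using trees_eq_edges[OF T(2), of 1] n_pos by auto
  show ?thesis using star[OF g(1)] star[OF g'(1)] unfolding g(2) g'(2) by (simp add: algebra_simps abs_le_iff) 
qed

lemma trees_nonempty: "trees n \<noteq> {}"
  using edges_in_trees[OF par_in_forest] words_nonempty by blast

end

context ball_words
begin

text \<open>The multiplicity bound \<open>exp L / 2 ^ (4 * L)\<close> is at most
  \<open>exp (- L)\<close> as \<open>exp 2 \<le> 16\<close>. Avoiding a letter everywhere except at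
  \<open>j\<close> loses a factor \<open>exp 1 \<le> 3\<close>, summed over \<open>N + 1\<close>
  values of \<open>j\<close>, where 0 stands for every \<open>j\<close> outside the word. Taking the
  minimum with \<open>n\<close> is harmless since no ball exceeds \<open>n\<close>.\<close>

lemma beta_le:
  fixes L m' :: nat
  assumes N: "N = n * L" and \<mu>: "\<mu> = 4 * L" and m': "m = min n m'" "1 \<le> m'"
  shows "\<beta> \<le> real n * (real (1 + k * R) ^ (k + 1) * real (R + 1) ^ k) / real m' ^ k + real n * (3 * real N + 6) * exp (- real L)"
proof -
  let ?E = "exp (- real L)"
  have NL: "real N / real n = real L" using N n_pos by simp
  define X1 where "X1 = (\<lambda>T. of_bool (\<exists>b\<in>{1..n}. m' < card {u \<in> {1..n}. near T R u b}) :: real)"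
  define X2 where "X2 = (\<lambda>v (w :: nat \<Rightarrow> nat). of_bool (card {k. k \<le> N \<and> w k = v} > \<mu>) :: real)"
  define X3 where "X3 = (\<lambda>v j (w :: nat \<Rightarrow> nat). of_bool (\<forall>k\<in>{1..N} - {j}. w k \<noteq> v) :: real)"
  have "bad w \<le> X1 (tree w) + (\<Sum>v\<in>{1..n}. X2 v w) + (\<Sum>v\<in>{1..n}. \<Sum>j\<in>{0..N}. X3 v j w)" for w
  proof (cases "good w")
    case True
    then show ?thesis unfolding X1_def X2_def X3_def by (auto intro!: add_nonneg_nonneg sum_nonneg)
  next
    case False
    have n2: "0 \<le> (\<Sum>v\<in>{1..n}. X2 v w)" "0 \<le> (\<Sum>v\<in>{1..n}. \<Sum>j\<in>{0..N}. X3 v j w)" "0 \<le> X1 (tree w)"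
      unfolding X1_def X2_def X3_def by (auto intro!: sum_nonneg)
    from False consider b where "b \<in> {1..n}" "m < card (ball w b)" | v where "v \<in> {1..n}" "\<mu> < card {k. k \<le> N \<and> w k = v}"
      | v j where "v \<in> {1..n}" "\<forall>k\<in>{1..N}. k = j \<or> w k \<noteq> v"
      unfolding good_def by (auto simp: not_le)
    then have "1 \<le> X1 (tree w) \<or> 1 \<le> (\<Sum>v\<in>{1..n}. X2 v w) \<or> 1 \<le> (\<Sum>v\<in>{1..n}. \<Sum>j\<in>{0..N}. X3 v j w)"
    proof cases
      case 1
      then have "m' < card (ball w b)" using m'(1) card_ball_le[of w b] by (auto simp: min_def split: if_splits)
      then show ?thesis using 1 unfolding X1_def ball_def by auto
    next
      case 2
      then have "1 \<le> X2 v w" by (simp add: X2_def)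
      also have "\<dots> \<le> (\<Sum>v\<in>{1..n}. X2 v w)" using 2 by (intro member_le_sum) (auto simp: X2_def)
      finally show ?thesis by blast
    next
      case 3
      define j' where "j' = (if j \<le> N then j else 0)"
      have "1 \<le> X3 v j' w" using 3 by (auto simp: X3_def j'_def)
      also have "\<dots> \<le> (\<Sum>j\<in>{0..N}. X3 v j w)" by (intro member_le_sum) (auto simp: X3_def j'_def)
      also have "\<dots> \<le> (\<Sum>v\<in>{1..n}. \<Sum>j\<in>{0..N}. X3 v j w)"
        using 3 by (intro member_le_sum[where f = "\<lambda>v. \<Sum>j\<in>{0..N}. X3 v j w"]) (auto simp: X3_def intro!: sum_nonneg)
      finally show ?thesis by blast
    qed
    then show ?thesis using False n2 by auto
  qed
  then have "\<beta> \<le> avg words (\<lambda>w. X1 (tree w) + (\<Sum>v\<in>{1..n}. X2 v w) + (\<Sum>v\<in>{1..n}. \<Sum>j\<in>{0..N}. X3 v j w))"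
    unfolding \<beta>_def by (intro avg_mono)
  also have "\<dots> = avg words (\<lambda>w. X1 (tree w)) + (\<Sum>v\<in>{1..n}. avg words (X2 v)) + (\<Sum>v\<in>{1..n}. \<Sum>j\<in>{0..N}. avg words (X3 v j))"
    by (simp only: avg_add avg_sum)
  also have "\<dots> \<le> (real n * (real (1 + k * R) ^ (k + 1) * real (R + 1) ^ k) / real m' ^ k + real n * ?E) +
      (\<Sum>v\<in>{1..n}. 2 * ?E) + (\<Sum>v\<in>{1..n}. \<Sum>j\<in>{0..N}. 3 * ?E)"
  proof (intro add_mono sum_mono)
    have "\<bar>avg words (\<lambda>w. X1 (tree w)) - avg (trees n) X1\<bar> \<le> 1 * avg words (\<lambda>w. of_bool (\<not> {1..n} \<subseteq> range w))"
      by (rule law_of_tree) (auto simp: X1_def)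
    also have "\<dots> \<le> real n * ?E" using avg_uncovered by (simp add: NL)
    finally show "avg words (\<lambda>w. X1 (tree w)) \<le> real n * (real (1 + k * R) ^ (k + 1) * real (R + 1) ^ k) / real m' ^ k + real n * ?E"
      using avg_big_ball[of m' R k] m' unfolding X1_def by linarith
  next
    fix v assume v: "v \<in> {1..n}"
    have e2: "exp (2::real) \<le> 16"
    proof -
      have "exp (2::real) = exp 1 * exp 1" by (simp flip: exp_add)
      also have "\<dots> \<le> 3 * 3" using exp_le by (intro mult_mono) auto
      finally show ?thesis by simp
    qed
    have "avg words (X2 v) \<le> 2 * exp (real L) / 2 ^ \<mu>"
      using avg_multiplicity[OF v, of \<mu>] unfolding X2_def NL .
    also have "(2::real) ^ \<mu> = 16 ^ L" by (simp add: \<mu> power_mult)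
    also have "2 * exp (real L) / 16 ^ L \<le> 2 * exp (real L) / exp 2 ^ L"
      using e2 by (intro divide_left_mono power_mono) auto
    also have "exp (2::real) ^ L = exp (real L) * exp (real L)"
      by (simp add: exp_of_nat_mult[symmetric] exp_add[symmetric])
    also have "2 * exp (real L) / (exp (real L) * exp (real L)) = 2 * ?E" by (simp add: exp_minus field_simps)
    finally show "avg words (X2 v) \<le> 2 * ?E" .
  next
    fix v j assume v: "v \<in> {1..n}" and "j \<in> {0..N}"
    have "avg words (X3 v j) \<le> exp (- (real (card ({1..N} - {j})) / real n))"
      unfolding X3_def by (rule avg_avoid_le[OF v]) auto
    also have "\<dots> \<le> exp (1 - real L)"
    proof -
      have "N \<le> card ({1..N} - {j}) + 1" by (simp add: card_Diff_singleton_if)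
      then have "real N \<le> real (card ({1..N} - {j})) + real n" using n_pos by linarith
      then have "real N / real n \<le> real (card ({1..N} - {j})) / real n + 1" using n_pos by (simp add: field_simps)
      then show ?thesis using NL by simp
    qed
    also have "\<dots> = exp 1 * ?E" by (simp add: exp_diff exp_minus field_simps)
    also have "\<dots> \<le> 3 * ?E" using exp_le by (intro mult_right_mono) auto
    finally show "avg words (X3 v j) \<le> 3 * ?E" .
  qed
  also have "\<dots> = real n * (real (1 + k * R) ^ (k + 1) * real (R + 1) ^ k) / real m' ^ k + real n * (3 * real N + 6) * ?E"
    by (simp add: algebra_simps)
  finally show ?thesis .
qed

end

section \<open>From words back to the uniform tree\<close>

lemma expectation_uniform_tree: "1 \<le> n \<Longrightarrow> measure_pmf.expectation (uniform_tree n) f = avg (trees n) f"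
  and prob_uniform_tree: "1 \<le> n \<Longrightarrow> measure_pmf.prob (uniform_tree n) {T. P T} = avg (trees n) (\<lambda>T. of_bool (P T))"
proof -
  assume n: "1 \<le> n"
  interpret tree_words n 0 by unfold_locales (use n in simp)
  note * = trees_nonempty finite_trees[of n]
  show "measure_pmf.expectation (uniform_tree n) f = avg (trees n) f"
    unfolding uniform_tree_def avg_def by (rule integral_pmf_of_set[OF *])
  have "measure_pmf.prob (uniform_tree n) {T. P T} = real (card (trees n \<inter> {T. P T})) / real (card (trees n))"
    unfolding uniform_tree_def by (rule measure_pmf_of_set[OF *])
  also have "real (card (trees n \<inter> {T. P T})) = (\<Sum>T\<in>trees n. of_bool (P T))"
    using finite_trees by (simp add: Int_def)
  finally show "measure_pmf.prob (uniform_tree n) {T. P T} = avg (trees n) (\<lambda>T. of_bool (P T))"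
    unfolding avg_def .
qed

lemma lipschitz_mean_dist:
  assumes n: "1 \<le> n" and lip: "tree_lipschitz n \<alpha> F" and \<alpha>: "0 \<le> \<alpha>" and T: "T \<in> trees n"
  shows "\<bar>F T - avg (trees n) F\<bar> \<le> 2 * real n * \<alpha>"
proof -
  interpret tree_words n 0 by unfold_locales (use n in simp)
  have "F T - avg (trees n) F = avg (trees n) (\<lambda>T'. F T - F T')"
    by (simp add: avg_diff avg_const[OF finite_trees trees_nonempty])
  also have "\<bar>\<dots>\<bar> \<le> avg (trees n) (\<lambda>T'. 2 * real n * \<alpha>)"
    by (intro avg_abs_mono lipschitz_range[OF lip \<alpha> T])
  finally show ?thesis by (simp add: avg_const[OF finite_trees trees_nonempty])
qed

lemma variance_uniform_tree_le:
  assumes n: "1 \<le> n" and lip: "tree_lipschitz n \<alpha> F" and \<alpha>: "0 \<le> \<alpha>"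
  shows "measure_pmf.variance (uniform_tree n) F \<le> (2 * real n * \<alpha>)\<^sup>2"
proof -
  interpret tree_words n 0 by unfold_locales (use n in simp)
  have "avg (trees n) (\<lambda>T. (F T - avg (trees n) F)\<^sup>2) \<le> avg (trees n) (\<lambda>_. (2 * real n * \<alpha>)\<^sup>2)"
    using lipschitz_mean_dist[OF assms] \<alpha> by (intro avg_mono) (simp add: abs_le_square_iff[symmetric])
  then show ?thesis
    using expectation_uniform_tree[OF n] avg_const[OF finite_trees trees_nonempty] by simp
qed

lemma kolmogorov_dist_nonneg: "0 \<le> kolmogorov_dist (measure_pmf p) X"
proof -
  have "\<bar>measure (measure_pmf p) A - cdf std_normal_distribution t\<bar> \<le> 1" for A and t :: real
  proof -
    have "0 \<le> cdf std_normal_distribution t" "cdf std_normal_distribution t \<le> 1"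
      by (rule std_normal.cdf_nonneg std_normal.cdf_bounded_prob)+
    moreover have "0 \<le> measure (measure_pmf p) A" "measure (measure_pmf p) A \<le> 1"
      by (auto intro: measure_pmf.prob_le_1)
    ultimately show ?thesis by linarith
  qed
  then show ?thesis
    unfolding kolmogorov_dist_def by (intro cSUP_upper2[where x = 0] bdd_aboveI2[where M = 1]) auto
qed

text \<open>After standardising, \<open>a\<close> is the Lipschitz constant. Replacing tree averages
  by word averages costs \<open>\<eta>\<close>, the bound for missing a letter, times the range of
  the quantity. The 5 rounds up \<open>7 / 2 + 1\<close> from the two quadratic terms, and 13 is
  \<open>6 + 7\<close> because the mean modulus is at most 1 up to such an error.\<close>

lemma kolmogorov_bound:
  fixes F :: "graph \<Rightarrow> real" and \<alpha> \<rho> :: real and n L k R m' :: nat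
  assumes n: "4 \<le> n" and L: "1 \<le> L" and m': "1 \<le> m'"
    and lip: "tree_lipschitz n \<alpha> F" and \<alpha>: "0 < \<alpha>" and sup: "superposable n \<rho> F"
    and R: "\<And>r. real r < \<rho> \<Longrightarrow> r + 2 \<le> R" "1 \<le> R"
    and var: "0 < measure_pmf.variance (uniform_tree n) F"
    and B: "real n * (real (1 + k * R) ^ (k + 1) * real (R + 1) ^ k) / real m' ^ k +
      real n * (3 * real (n * L) + 6) * exp (- real L) \<le> B"
  defines "a \<equiv> \<alpha> / sqrt (measure_pmf.variance (uniform_tree n) F)"
    and "\<eta> \<equiv> real n * exp (- real L)"
  shows "kolmogorov_dist (measure_pmf (uniform_tree n)) F \<le> \<eta> + 6 * (2 * real n * a * \<eta>) +
    7 * (8 * (real n * a)\<^sup>2 * \<eta> + (2 * real n * a * \<eta>)\<^sup>2) +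
    5 * sqrt (real (n * L) * 60000 * (3 * a) ^ 4 * ((real (min n m') * real (4 * L))\<^sup>2 + real n * (real (n * L))\<^sup>2 * B)) +
    real (n * L) * (3 * a) ^ 3 * (13 + 7 * (8 * (real n * a)\<^sup>2 * \<eta>))"
proof -
  have n1: "1 \<le> n" using n by simp
  define \<mu> where "\<mu> = measure_pmf.expectation (uniform_tree n) F"
  define s where "s = sqrt (measure_pmf.variance (uniform_tree n) F)"
  have s: "0 < s" "s\<^sup>2 = measure_pmf.variance (uniform_tree n) F" using var by (simp_all add: s_def)
  have a0: "0 < a" unfolding a_def using \<alpha> s(1) by (simp add: s_def)
  define F' where "F' = (\<lambda>T. (F T - \<mu>) / s)"
  have F'_diff: "F' T - F' T' = (F T - F T') / s" for T T' by (simp add: F'_def diff_divide_distrib)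
  have lip': "tree_lipschitz n a F'"
    using lip s unfolding tree_lipschitz_def F'_diff a_def s_def[symmetric] by (simp add: divide_right_mono)
  have sup': "superposable n \<rho> F'"
    using sup unfolding superposable_def F'_diff add_divide_distrib[symmetric] by metis
  let ?N = "n * L" and ?m = "min n m'" and ?\<mu> = "4 * L"
  interpret local_parameter n ?N R ?m ?\<mu> F' a \<rho>
    using n L m' a0 lip' sup' R by unfold_locales (auto simp: mult_le_mono)
  define g where "g = (\<lambda>w. F' (tree w))"
  have mean0: "avg (trees n) F' = 0"
    unfolding F'_def divide_inverse avg_multc avg_diff avg_const[OF finite_trees trees_nonempty]
    using expectation_uniform_tree[OF n1, of F] by (simp add: \<mu>_def)
  have var1: "avg (trees n) (\<lambda>T. (F' T)\<^sup>2) = 1"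
  proof -
    have "avg (trees n) (\<lambda>T. (F' T)\<^sup>2) = avg (trees n) (\<lambda>T. (F T - \<mu>)\<^sup>2) * inverse (s\<^sup>2)"
      unfolding F'_def avg_multc[symmetric] by (simp add: power_mult_distrib power_inverse divide_inverse)
    also have "avg (trees n) (\<lambda>T. (F T - \<mu>)\<^sup>2) = s\<^sup>2"
      unfolding s(2) using expectation_uniform_tree[OF n1, of "\<lambda>T. (F T - \<mu>)\<^sup>2"] by (simp add: \<mu>_def)
    finally show ?thesis using s(1) by simp
  qed
  have range: "\<bar>F' T - F' T'\<bar> \<le> 2 * real n * a" if "T \<in> trees n" "T' \<in> trees n" for T T'
    by (rule lipschitz_range[OF lip' _ that]) (use a0 in simp)
  have bound: "\<bar>F' T\<bar> \<le> 2 * real n * a" if T: "T \<in> trees n" for T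
    using lipschitz_mean_dist[OF n1 lip' _ T] a0 by (simp add: mean0)
  have range2: "\<bar>(F' T)\<^sup>2 - (F' T')\<^sup>2\<bar> \<le> 8 * (real n * a)\<^sup>2" if T: "T \<in> trees n" "T' \<in> trees n" for T T'
  proof -
    have "(F' T)\<^sup>2 - (F' T')\<^sup>2 = (F' T - F' T') * (F' T + F' T')" by (simp add: power2_eq_square algebra_simps)
    then have "\<bar>(F' T)\<^sup>2 - (F' T')\<^sup>2\<bar> = \<bar>F' T - F' T'\<bar> * \<bar>F' T + F' T'\<bar>" by (simp add: abs_mult)
    also have "\<dots> \<le> (2 * real n * a) * (4 * real n * a)"
      using range[OF T] bound[OF T(1)] bound[OF T(2)] a0 by (intro mult_mono) auto
    finally show ?thesis by (simp add: power2_eq_square)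
  qed
  define u where "u = avg words (\<lambda>w. of_bool (\<not> {1..n} \<subseteq> range w) :: real)"
  have u: "0 \<le> u" "u \<le> \<eta>"
    using avg_uncovered n1 unfolding u_def \<eta>_def by (auto intro: avg_nonneg)
  have e1: "\<bar>avg words g\<bar> \<le> 2 * real n * a * \<eta>"
  proof -
    have "\<bar>avg words g\<bar> \<le> 2 * real n * a * u"
      using law_of_tree[of F', OF range] unfolding mean0 g_def u_def by simp
    also have "\<dots> \<le> 2 * real n * a * \<eta>" using u a0 by (intro mult_left_mono) auto
    finally show ?thesis .
  qed
  define e2 where "e2 = 8 * (real n * a)\<^sup>2 * \<eta>"
  have \<eta>0: "0 \<le> \<eta>" using u by linarith
  have e20: "0 \<le> e2" unfolding e2_def using \<eta>0 by simp
  have e2: "\<bar>avg words (\<lambda>w. g w * g w) - 1\<bar> \<le> e2"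
  proof -
    have "\<bar>avg words (\<lambda>w. (F' (tree w))\<^sup>2) - 1\<bar> \<le> 8 * (real n * a)\<^sup>2 * u"
      using law_of_tree[of "\<lambda>T. (F' T)\<^sup>2", OF range2] unfolding var1 u_def .
    also have "\<dots> \<le> e2" unfolding e2_def using u by (intro mult_left_mono) auto
    finally show ?thesis by (simp add: g_def power2_eq_square)
  qed
  define W where "W = real (n * L) * 60000 * (3 * a) ^ 4 * ((real (min n m') * real (4 * L))\<^sup>2 + real n * (real (n * L))\<^sup>2 * B)"
  have \<beta>B: "\<beta> \<le> B" using beta_le[of L m' k] m' B by (simp add: order_trans)
  have "Theta \<le> (real (min n m') * real (4 * L))\<^sup>2 + real n * (real (n * L))\<^sup>2 * B"
    unfolding Theta_def \<kappa>_def using \<beta>B by (intro add_mono mult_left_mono) auto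
  then have VW: "real ?N * 60000 * (3 * a) ^ 4 * Theta \<le> W"
    unfolding W_def using a0 by (intro mult_left_mono) auto
  have v1: "avg words (\<lambda>w. \<bar>qvar g w - avg words (qvar g)\<bar>) \<le> sqrt W"
    by (rule order_trans[OF avg_abs_le_sqrt[OF finite_words words_nonempty]])
      (use qvar_variance(1) VW in \<open>auto simp: g_def intro: order_trans\<close>)
  have v2: "avg words (\<lambda>w. \<bar>qvar_abs g w\<bar>) \<le> sqrt W"
    by (rule order_trans[OF avg_abs_le_sqrt[OF finite_words words_nonempty]])
      (use qvar_variance(2) VW in \<open>auto simp: g_def intro: order_trans\<close>)
  have q1: "avg words (\<lambda>w. \<bar>1 - qvar g w / 2\<bar>) \<le> (e2 + (2 * real n * a * \<eta>)\<^sup>2) + sqrt W / 2"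
  proof -
    let ?Q = "avg words (qvar g)"
    have "avg words (\<lambda>w. \<bar>1 - qvar g w / 2\<bar>) \<le> avg words (\<lambda>w. \<bar>1 - ?Q / 2\<bar> + \<bar>qvar g w - ?Q\<bar> * (1/2))"
      by (intro avg_mono) (simp add: abs_if field_simps split: if_splits)
    also have "\<dots> = \<bar>1 - ?Q / 2\<bar> + avg words (\<lambda>w. \<bar>qvar g w - ?Q\<bar>) * (1/2)"
      by (simp only: avg_add avg_multc avgW_const)
    also have "\<dots> \<le> (e2 + (2 * real n * a * \<eta>)\<^sup>2) + sqrt W * (1/2)"
    proof (intro add_mono mult_right_mono v1)
      have "avg words g * avg words g \<le> (2 * real n * a * \<eta>)\<^sup>2"
        using power_mono[OF e1, of 2] by (simp add: power2_eq_square)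
      then show "\<bar>1 - ?Q / 2\<bar> \<le> e2 + (2 * real n * a * \<eta>)\<^sup>2"
        using e2 zero_le_square[of "avg words g"] zero_le_power2[of "2 * real n * a * \<eta>"]
        unfolding avg_qvar abs_le_iff diff_divide_distrib by (simp del: zero_le_square zero_le_power2) argo
    qed simp
    finally show ?thesis by simp
  qed
  have g1: "avg words (\<lambda>w. \<bar>g w\<bar>) \<le> 1 + e2"
  proof -
    have "avg words (\<lambda>w. (g w)\<^sup>2) \<le> 1 + e2"
      using e2 by (simp add: power2_eq_square abs_le_iff)
    also have "\<dots> \<le> (1 + e2)\<^sup>2" using e20 by (intro self_le_power) auto
    finally have "sqrt (avg words (\<lambda>w. (g w)\<^sup>2)) \<le> 1 + e2" using e20 by (intro real_le_lsqrt) auto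
    then show ?thesis by (rule order_trans[OF avg_abs_le_sqrt[OF finite_words words_nonempty]])
  qed
  have bnd: "\<bar>measure (measure_pmf (uniform_tree n)) {T. F T - \<mu> \<le> t * s} - Phi t\<bar> \<le>
    \<eta> + 6 * (2 * real n * a * \<eta>) + 7 * (e2 + (2 * real n * a * \<eta>)\<^sup>2) + 5 * sqrt W + real ?N * (3 * a) ^ 3 * (13 + 7 * e2)" for t
  proof -
    have "{T. F T - \<mu> \<le> t * s} = {T. F' T \<le> t}" unfolding F'_def using s(1) by (simp add: pos_divide_le_eq)
    then have m: "measure (measure_pmf (uniform_tree n)) {T. F T - \<mu> \<le> t * s} = avg (trees n) (\<lambda>T. of_bool (F' T \<le> t))"
      using prob_uniform_tree[OF n1] by simp
    have "\<bar>avg words (\<lambda>w. of_bool (F' (tree w) \<le> t)) - avg (trees n) (\<lambda>T. of_bool (F' T \<le> t))\<bar> \<le> 1 * u"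
      unfolding u_def by (rule law_of_tree) auto
    then have l: "\<bar>avg words (\<lambda>w. of_bool (g w \<le> t)) - avg (trees n) (\<lambda>T. of_bool (F' T \<le> t))\<bar> \<le> \<eta>"
      using u unfolding g_def by linarith
    have "\<bar>avg words (\<lambda>w. of_bool (g w \<le> t)) - Phi t\<bar> \<le>
      6 * \<bar>avg words g\<bar> + 7 * avg words (\<lambda>w. \<bar>1 - qvar g w / 2\<bar>) + avg words (\<lambda>w. \<bar>qvar_abs g w\<bar>) +
      real ?N * (3 * a) ^ 3 * (6 + 7 * avg words (\<lambda>w. \<bar>g w\<bar>))"
      unfolding g_def by (rule normal_approximation[OF dlt_bound])
    moreover have "real ?N * (3 * a) ^ 3 * (6 + 7 * avg words (\<lambda>w. \<bar>g w\<bar>)) \<le> real ?N * (3 * a) ^ 3 * (13 + 7 * e2)"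
      using g1 a0 by (intro mult_left_mono) auto
    moreover have "0 \<le> sqrt W" using v2 by (meson abs_ge_zero avg_nonneg order_trans)
    ultimately have "\<bar>avg words (\<lambda>w. of_bool (g w \<le> t)) - Phi t\<bar> \<le>
      6 * (2 * real n * a * \<eta>) + 7 * (e2 + (2 * real n * a * \<eta>)\<^sup>2) + 5 * sqrt W + real ?N * (3 * a) ^ 3 * (13 + 7 * e2)"
      using e1 q1 v2 by argo
    then show ?thesis unfolding m using l by argo
  qed
  show ?thesis
    unfolding kolmogorov_dist_def e2_def[symmetric] W_def[symmetric]
    using bnd unfolding \<mu>_def s_def by (intro cSUP_least) auto
qed

section \<open>Asymptotics\<close>

lemma powr_bigo_mult:
  assumes "f \<in> O(\<lambda>n. real n powr p)" "g \<in> O(\<lambda>n. real n powr q)"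
  shows "(\<lambda>n. f n * g n) \<in> O(\<lambda>n. real n powr (p + q))"
  using landau_o.big.mult[OF assms] by (simp add: powr_add)

lemma powr_bigo_weaken:
  assumes "f \<in> O(\<lambda>n. real n powr p)" "p \<le> q"
  shows "f \<in> O(\<lambda>n. real n powr q)"
proof -
  have "(\<lambda>n. real n powr p) \<in> O(\<lambda>n. real n powr q)"
    using assms(2) by (intro bigoI[of _ 1] eventually_mono[OF eventually_ge_at_top[of 1]]) (auto intro: powr_mono)
  then show ?thesis by (rule landau_o.big_trans[OF assms(1)])
qed

lemma powr_bigo_power:
  assumes "f \<in> O(\<lambda>n. real n powr p)"
  shows "(\<lambda>n. f n ^ k) \<in> O(\<lambda>n. real n powr (real k * p))"
proof (induction k)
  case (Suc k)
  from powr_bigo_mult[OF assms this] show ?case by (simp add: algebra_simps)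
qed (auto intro!: bigoI[of _ 1] eventually_mono[OF eventually_ge_at_top[of 1]])

lemma powr_bigo_const: "(\<lambda>n. c) \<in> O(\<lambda>n. real n powr 0)"
  by (intro bigoI[of _ "norm c"] eventually_mono[OF eventually_ge_at_top[of 1]]) auto

lemma powr_bigo_ident: "real \<in> O(\<lambda>n. real n powr 1)"
  by (intro bigoI[of _ 1]) auto

lemma powr_bigo_cmult: "f \<in> O(\<lambda>n. real n powr p) \<Longrightarrow> (\<lambda>n. c * f n) \<in> O(\<lambda>n. real n powr p)" for c :: real
  using powr_bigo_mult[OF powr_bigo_const[of c], of f p] by simp

lemma powr_bigo_sqrt:
  assumes "f \<in> O(\<lambda>n. real n powr p)" "\<And>n. 0 \<le> f n"
  shows "(\<lambda>n. sqrt (f n)) \<in> O(\<lambda>n. real n powr (p / 2))"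
proof -
  have "(\<lambda>n. f n powr (1/2)) \<in> O(\<lambda>n. (real n powr p) powr (1/2))"
    using assms by (intro bigo_powr_nonneg) auto
  then show ?thesis using assms(2) by (simp add: powr_half_sqrt powr_powr)
qed

lemma bigo_mono:
  fixes f g :: "nat \<Rightarrow> real"
  assumes "g \<in> O(h)" "\<forall>\<^sub>F n in sequentially. 0 \<le> f n \<and> f n \<le> g n"
  shows "f \<in> O(h)"
  by (rule landau_o.big_trans[OF _ assms(1)]) (rule bigoI[of _ 1], use assms(2) in eventually_elim, auto)

text \<open>From \<open>x \<le> exp x\<close> at \<open>x = L / k\<close>. It brings the covering
  error to the same form as the moment error.\<close>

lemma exp_minus_le_power:
  assumes "1 \<le> k" "1 \<le> L"
  shows "exp (- real L) \<le> real k ^ k * (1 / real L) ^ k"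
proof -
  have "real L / real k \<le> exp (real L / real k)" using exp_ge_add_one_self[of "real L / real k"] by linarith
  then have "(real L / real k) ^ k \<le> exp (real L / real k) ^ k" using assms by (intro power_mono) auto
  also have "\<dots> = exp (real L)" using assms by (simp add: exp_of_nat_mult[symmetric])
  finally have "inverse (exp (real L)) \<le> inverse ((real L / real k) ^ k)"
    using assms by (intro le_imp_inverse_le) auto
  then show ?thesis by (simp add: exp_minus power_mult_distrib divide_inverse power_inverse mult.commute)
qed

lemma kolmogorov_rate:
  fixes F :: "nat \<Rightarrow> graph \<Rightarrow> real" and \<alpha> \<rho> :: "nat \<Rightarrow> real" and \<epsilon> \<epsilon>' :: real
  assumes \<alpha>: "\<And>n. n \<ge> 1 \<Longrightarrow> \<alpha> n > 0"
    and \<rho>: "\<And>n. n \<ge> 1 \<Longrightarrow> \<rho> n \<ge> 1"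
    and lip: "\<And>n. n \<ge> 1 \<Longrightarrow> tree_lipschitz n (\<alpha> n) (F n)"
    and sup: "\<And>n. n \<ge> 1 \<Longrightarrow> superposable n (\<rho> n) (F n)"
    and var: "\<forall>\<^sub>F n in sequentially. measure_pmf.variance (uniform_tree n) (F n) > 0"
    and O: "(\<lambda>n. real n * \<alpha> n ^ 3 / measure_pmf.variance (uniform_tree n) (F n) powr (3/2) +
              real n powr (1/4) * \<alpha> n * \<rho> n / measure_pmf.variance (uniform_tree n) (F n) powr (1/2))
         \<in> O(\<lambda>n. real n powr (-\<epsilon>))"
    and \<epsilon>': "0 < \<epsilon>'" "\<epsilon>' < \<epsilon>"
  shows "(\<lambda>n. kolmogorov_dist (measure_pmf (uniform_tree n)) (F n)) \<in> O(\<lambda>n. real n powr (-\<epsilon>'))"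
proof -
  define \<sigma> where "\<sigma> n = sqrt (measure_pmf.variance (uniform_tree n) (F n))" for n
  define a where "a n = \<alpha> n / \<sigma> n" for n
  have good: "\<forall>\<^sub>F n in sequentially. 4 \<le> n \<and> 0 < \<sigma> n"
    using var eventually_ge_at_top[of 4] by eventually_elim (simp add: \<sigma>_def)
  have var_powr: "measure_pmf.variance (uniform_tree n) (F n) powr (1/2) = \<sigma> n"
    "measure_pmf.variance (uniform_tree n) (F n) powr (3/2) = \<sigma> n ^ 3" if "0 < \<sigma> n" for n
  proof -
    have v: "0 < measure_pmf.variance (uniform_tree n) (F n)" using that by (simp add: \<sigma>_def)
    then show h: "measure_pmf.variance (uniform_tree n) (F n) powr (1/2) = \<sigma> n"
      by (simp add: powr_half_sqrt \<sigma>_def)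
    have "measure_pmf.variance (uniform_tree n) (F n) powr (3/2) = (measure_pmf.variance (uniform_tree n) (F n) powr (1/2)) powr 3"
      by (simp add: powr_powr)
    then show "measure_pmf.variance (uniform_tree n) (F n) powr (3/2) = \<sigma> n ^ 3"
      unfolding h using that powr_realpow[of "\<sigma> n" 3] by simp
  qed
  have a_pos: "0 < a n" if "1 \<le> n" "0 < \<sigma> n" for n unfolding a_def using \<alpha>[OF that(1)] that(2) by simp
  have O1: "(\<lambda>n. real n * a n ^ 3) \<in> O(\<lambda>n. real n powr (-\<epsilon>))"
    and O2: "(\<lambda>n. real n powr (1/4) * (a n * \<rho> n)) \<in> O(\<lambda>n. real n powr (-\<epsilon>))"
  proof -
    have "\<forall>\<^sub>F n in sequentially. 0 \<le> real n * a n ^ 3 \<and> real n * a n ^ 3 \<le>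
        real n * \<alpha> n ^ 3 / measure_pmf.variance (uniform_tree n) (F n) powr (3/2) +
        real n powr (1/4) * \<alpha> n * \<rho> n / measure_pmf.variance (uniform_tree n) (F n) powr (1/2)"
      using good
    proof eventually_elim
      case (elim n)
      then show ?case using \<alpha>[of n] \<rho>[of n] var_powr[of n] by (simp add: a_def power_divide)
    qed
    then show "(\<lambda>n. real n * a n ^ 3) \<in> O(\<lambda>n. real n powr (-\<epsilon>))" by (rule bigo_mono[OF O])
    have "\<forall>\<^sub>F n in sequentially. 0 \<le> real n powr (1/4) * (a n * \<rho> n) \<and> real n powr (1/4) * (a n * \<rho> n) \<le>
        real n * \<alpha> n ^ 3 / measure_pmf.variance (uniform_tree n) (F n) powr (3/2) +
        real n powr (1/4) * \<alpha> n * \<rho> n / measure_pmf.variance (uniform_tree n) (F n) powr (1/2)"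
      using good
    proof eventually_elim
      case (elim n)
      then show ?case using \<alpha>[of n] \<rho>[of n] var_powr[of n] by (simp add: a_def mult.assoc)
    qed
    then show "(\<lambda>n. real n powr (1/4) * (a n * \<rho> n)) \<in> O(\<lambda>n. real n powr (-\<epsilon>))" by (rule bigo_mono[OF O])
  qed
  have Oa3: "(\<lambda>n. a n ^ 3) \<in> O(\<lambda>n. real n powr (-1 - \<epsilon>))"
  proof (rule bigo_mono)
    have "(\<lambda>n. real n powr (-1)) \<in> O(\<lambda>n. real n powr (-1))" by simp
    from powr_bigo_mult[OF this O1]
    show "(\<lambda>n. real n powr (-1) * (real n * a n ^ 3)) \<in> O(\<lambda>n. real n powr (-1 - \<epsilon>))" by simp
    show "\<forall>\<^sub>F n in sequentially. 0 \<le> a n ^ 3 \<and> a n ^ 3 \<le> real n powr (-1) * (real n * a n ^ 3)"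
      using good
    proof eventually_elim
      case (elim n)
      then show ?case using a_pos[of n] by (simp add: powr_minus)
    qed
  qed
  have Oar: "(\<lambda>n. a n * \<rho> n) \<in> O(\<lambda>n. real n powr (-1/4 - \<epsilon>))"
  proof (rule bigo_mono)
    have "(\<lambda>n. real n powr (-1/4)) \<in> O(\<lambda>n. real n powr (-1/4))" by simp
    from powr_bigo_mult[OF this O2]
    show "(\<lambda>n. real n powr (-1/4) * (real n powr (1/4) * (a n * \<rho> n))) \<in> O(\<lambda>n. real n powr (-1/4 - \<epsilon>))" by simp
    show "\<forall>\<^sub>F n in sequentially. 0 \<le> a n * \<rho> n \<and> a n * \<rho> n \<le> real n powr (-1/4) * (real n powr (1/4) * (a n * \<rho> n))"
      using good
    proof eventually_elim
      case (elim n)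
      have "real n powr (-1/4) * real n powr (1/4) = 1" using elim by (simp flip: powr_add)
      then show ?case using a_pos[of n] \<rho>[of n] elim by (simp flip: mult.assoc)
    qed
  qed
  have Oa: "a \<in> O(\<lambda>n. real n powr 0)"
  proof (rule bigo_mono)
    show "(\<lambda>n. a n * \<rho> n) \<in> O(\<lambda>n. real n powr 0)" by (rule powr_bigo_weaken[OF Oar]) (use \<epsilon>' in simp)
    show "\<forall>\<^sub>F n in sequentially. 0 \<le> a n \<and> a n \<le> a n * \<rho> n"
      using good
    proof eventually_elim
      case (elim n)
      then show ?case using a_pos[of n] \<rho>[of n] by simp
    qed
  qed
  \<comment> \<open>A Lipschitz parameter has standard deviation at most \<open>2 n \<alpha>\<close>, which bounds \<open>\<rho>\<close> from above.\<close>
  have Or: "\<rho> \<in> O(\<lambda>n. real n powr 1)"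
  proof (rule bigo_mono)
    have "(\<lambda>n. 2 * (real n * (a n * \<rho> n))) \<in> O(\<lambda>n. real n powr (1 + (-1/4 - \<epsilon>)))"
      by (intro powr_bigo_cmult powr_bigo_mult powr_bigo_ident Oar)
    then show "(\<lambda>n. 2 * (real n * (a n * \<rho> n))) \<in> O(\<lambda>n. real n powr 1)"
      by (rule powr_bigo_weaken) (use \<epsilon>' in simp)
    show "\<forall>\<^sub>F n in sequentially. 0 \<le> \<rho> n \<and> \<rho> n \<le> 2 * (real n * (a n * \<rho> n))"
      using good
    proof eventually_elim
      case (elim n)
      have "\<sigma> n \<le> sqrt ((2 * real n * \<alpha> n)\<^sup>2)"
        unfolding \<sigma>_def using elim \<alpha>[of n] by (intro real_sqrt_le_mono variance_uniform_tree_le lip) auto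
      then have "1 \<le> 2 * real n * a n" using elim \<alpha>[of n] by (simp add: a_def)
      then show ?case using \<rho>[of n] elim mult_right_mono[of 1 "2 * real n * a n" "\<rho> n"] by (simp add: mult.assoc)
    qed
  qed
  \<comment> \<open>Words of length about \<open>n\<^sup>1\<^sup>+\<^sup>\<delta>\<close> leave a vertex unvisited with probability smaller than any power
    of \<open>n\<close>, and a sufficiently high moment of the ball sizes makes \<open>B\<close> negligible.\<close>
  define \<delta> where "\<delta> = min 1 ((\<epsilon> - \<epsilon>') / 3)"
  \<comment> \<open>The cubic term spends one \<open>\<delta>\<close>. Under the root,
    \<open>N\<close> and four powers of \<open>L\<close> spend \<open>5 * \<delta>\<close>, to be
    covered by \<open>4 * \<epsilon> - 2 * \<epsilon>'\<close>.\<close>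
  have \<delta>: "0 < \<delta>" "\<delta> \<le> 1" "3 * \<delta> \<le> \<epsilon> - \<epsilon>'" using \<epsilon>' by (auto simp: \<delta>_def min_def)
  \<comment> \<open>The 20 is generous room for the powers of \<open>n\<close> multiplying the small
    probabilities: up to \<open>n^3\<close> inside \<open>B\<close> and \<open>n^5\<close> in front
    of it. The \<open>2 * \<epsilon>\<close> keeps the result below the square of the rate, as it
    stands under a root.\<close>
  define k where "k = nat \<lceil>(20 + 2 * \<epsilon>) / \<delta>\<rceil> + 1"
  have "(20 + 2 * \<epsilon>) / \<delta> \<le> real k" unfolding k_def by linarith
  then have k: "20 + 2 * \<epsilon> \<le> real k * \<delta>" "1 \<le> k" using \<delta> by (auto simp: pos_divide_le_eq k_def)
  define L where "L n = nat \<lceil>real n powr \<delta>\<rceil>" for n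
  define R where "R n = nat \<lceil>\<rho> n\<rceil> + 2" for n
  \<comment> \<open>Dividing the moment bound of order \<open>R ^ (2 * k + 1)\<close> by
    \<open>m' ^ k\<close> leaves \<open>R / L ^ k\<close>.\<close>
  define m' where "m' n = (R n)\<^sup>2 * L n" for n
  define B where "B n = real n * (real (1 + k * R n) ^ (k + 1) * real (R n + 1) ^ k) / real (m' n) ^ k +
      real n * (3 * real (n * L n) + 6) * exp (- real (L n))" for n
  define \<eta> where "\<eta> n = real n * exp (- real (L n))" for n
  have L_ge: "real n powr \<delta> \<le> real (L n)" for n unfolding L_def by linarith
  have L1: "1 \<le> L n" if "1 \<le> n" for n
  proof -
    have "1 \<le> real n powr \<delta>" using that \<delta>(1) by (simp add: ge_one_powr_ge_zero)
    with L_ge[of n] show ?thesis by simp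
  qed
  have OL: "(\<lambda>n. real (L n)) \<in> O(\<lambda>n. real n powr \<delta>)"
  proof (rule bigoI[of _ 2], use good in eventually_elim)
    case (elim n)
    have "1 \<le> real n powr \<delta>" using elim \<delta>(1) by (simp add: ge_one_powr_ge_zero)
    moreover have "real (L n) \<le> real n powr \<delta> + 1" using powr_ge_zero[of "real n" \<delta>] unfolding L_def by linarith
    ultimately show ?case by simp
  qed
  have OL1: "(\<lambda>n. real (L n)) \<in> O(\<lambda>n. real n powr 1)" by (rule powr_bigo_weaken[OF OL \<delta>(2)])
  have OLinv: "(\<lambda>n. (1 / real (L n)) ^ k) \<in> O(\<lambda>n. real n powr - (20 + 2 * \<epsilon>))"
  proof -
    have "(\<lambda>n. 1 / real (L n)) \<in> O(\<lambda>n. real n powr - \<delta>)"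
    proof (rule bigoI[of _ 1], use good in eventually_elim)
      case (elim n)
      then show ?case using L_ge[of n] by (simp add: powr_minus divide_inverse le_imp_inverse_le)
    qed
    from powr_bigo_power[OF this, of k] show ?thesis by (rule powr_bigo_weaken) (use k in simp)
  qed
  have Oexp: "(\<lambda>n. exp (- real (L n))) \<in> O(\<lambda>n. real n powr - (20 + 2 * \<epsilon>))"
    by (rule bigo_mono[OF powr_bigo_cmult[OF OLinv, of "real k ^ k"]], use good in eventually_elim)
      (use exp_minus_le_power[OF k(2) L1] in auto)
  have R: "real (R n) \<le> 4 * \<rho> n" "1 \<le> R n" "\<And>r. real r < \<rho> n \<Longrightarrow> r + 2 \<le> R n" if "1 \<le> n" for n
  proof -
    show "real (R n) \<le> 4 * \<rho> n" unfolding R_def using \<rho>[OF that] by linarith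
    show "1 \<le> R n" by (simp add: R_def)
    show "r + 2 \<le> R n" if "real r < \<rho> n" for r unfolding R_def using that by linarith
  qed
  have OR: "(\<lambda>n. real (R n)) \<in> O(\<lambda>n. real n powr 1)"
    by (rule bigo_mono[OF powr_bigo_cmult[OF Or, of 4]], use good in eventually_elim) (use R in auto)
  have OaR: "(\<lambda>n. a n * real (R n)) \<in> O(\<lambda>n. real n powr (-1/4 - \<epsilon>))"
  proof (rule bigo_mono[OF powr_bigo_cmult[OF Oar, of 4]], use good in eventually_elim)
    case (elim n)
    then show ?case using a_pos[of n] R(1)[of n] by simp
  qed
  have ON: "(\<lambda>n. real (n * L n)) \<in> O(\<lambda>n. real n powr (1 + \<delta>))"
    using powr_bigo_mult[OF powr_bigo_ident OL] by simp
  have ON2: "(\<lambda>n. real (n * L n)) \<in> O(\<lambda>n. real n powr 2)" by (rule powr_bigo_weaken[OF ON]) (use \<delta> in simp)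
  have O\<eta>: "\<eta> \<in> O(\<lambda>n. real n powr (-19 - 2 * \<epsilon>))"
    using powr_bigo_mult[OF powr_bigo_ident Oexp] by (simp add: \<eta>_def[abs_def])
  have OB: "B \<in> O(\<lambda>n. real n powr (-17 - 2 * \<epsilon>))"
  proof -
    have 1: "(\<lambda>n. real n * (real (1 + k * R n) ^ (k + 1) * real (R n + 1) ^ k) / real (m' n) ^ k)
        \<in> O(\<lambda>n. real n powr (-17 - 2 * \<epsilon>))"
    proof (rule bigo_mono)
      have "(\<lambda>n. real (1 + k) ^ (k + 1) * 2 ^ k * (real n * (real (R n) * (1 / real (L n)) ^ k)))
          \<in> O(\<lambda>n. real n powr (1 + (1 + - (20 + 2 * \<epsilon>))))"
        by (intro powr_bigo_cmult powr_bigo_mult powr_bigo_ident OR OLinv)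
      then show "(\<lambda>n. real (1 + k) ^ (k + 1) * 2 ^ k * (real n * (real (R n) * (1 / real (L n)) ^ k)))
          \<in> O(\<lambda>n. real n powr (-17 - 2 * \<epsilon>))" by (rule powr_bigo_weaken) simp
      show "\<forall>\<^sub>F n in sequentially. 0 \<le> real n * (real (1 + k * R n) ^ (k + 1) * real (R n + 1) ^ k) / real (m' n) ^ k \<and>
          real n * (real (1 + k * R n) ^ (k + 1) * real (R n + 1) ^ k) / real (m' n) ^ k \<le>
          real (1 + k) ^ (k + 1) * 2 ^ k * (real n * (real (R n) * (1 / real (L n)) ^ k))"
        using good
      proof eventually_elim
        case (elim n)
        have R1: "1 \<le> R n" using R elim by simp
        have "real (1 + k * R n) \<le> real (1 + k) * real (R n)" "real (R n + 1) \<le> 2 * real (R n)"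
          using R1 by (auto simp: algebra_simps)
        then have "real (1 + k * R n) ^ (k + 1) * real (R n + 1) ^ k \<le> (real (1 + k) * real (R n)) ^ (k + 1) * (2 * real (R n)) ^ k"
          by (intro mult_mono power_mono) auto
        then have "real n * (real (1 + k * R n) ^ (k + 1) * real (R n + 1) ^ k) / real (m' n) ^ k \<le>
            real n * ((real (1 + k) * real (R n)) ^ (k + 1) * (2 * real (R n)) ^ k) / real (m' n) ^ k"
          by (intro divide_right_mono mult_left_mono) auto
        also have "\<dots> = real (1 + k) ^ (k + 1) * 2 ^ k * (real n * (real (R n) * (1 / real (L n)) ^ k))"
          using R1 by (simp add: m'_def power_mult_distrib power_divide power2_eq_square power_add del: of_nat_add)
        finally show ?case by simp
      qed
    qed
    have "(\<lambda>n. 3 * real (n * L n) + 6) \<in> O(\<lambda>n. real n powr 2)"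
      by (intro sum_in_bigo powr_bigo_cmult ON2 powr_bigo_weaken[OF powr_bigo_const]) auto
    then have "(\<lambda>n. real n * (3 * real (n * L n) + 6) * exp (- real (L n))) \<in> O(\<lambda>n. real n powr (1 + 2 + - (20 + 2 * \<epsilon>)))"
      by (intro powr_bigo_mult powr_bigo_ident Oexp)
    then have 2: "(\<lambda>n. real n * (3 * real (n * L n) + 6) * exp (- real (L n))) \<in> O(\<lambda>n. real n powr (-17 - 2 * \<epsilon>))"
      by (rule powr_bigo_weaken) simp
    show ?thesis unfolding B_def[abs_def] by (rule sum_in_bigo(1)[OF 1 2])
  qed
  have Ona\<eta>: "(\<lambda>n. 2 * real n * a n * \<eta> n) \<in> O(\<lambda>n. real n powr (-18 - 2 * \<epsilon>))"
    using powr_bigo_mult[OF powr_bigo_mult[OF powr_bigo_cmult[OF powr_bigo_ident, of 2] Oa] O\<eta>] by simp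
  have Oe2: "(\<lambda>n. 8 * (real n * a n)\<^sup>2 * \<eta> n) \<in> O(\<lambda>n. real n powr (-17 - 2 * \<epsilon>))"
    using powr_bigo_mult[OF powr_bigo_cmult[OF powr_bigo_power[OF powr_bigo_mult[OF powr_bigo_ident Oa], of 2], of 8] O\<eta>] by simp
  have t1: "\<eta> \<in> O(\<lambda>n. real n powr (-\<epsilon>'))" by (rule powr_bigo_weaken[OF O\<eta>]) (use \<epsilon>' in simp)
  have t2: "(\<lambda>n. 6 * (2 * real n * a n * \<eta> n)) \<in> O(\<lambda>n. real n powr (-\<epsilon>'))"
    by (rule powr_bigo_weaken[OF powr_bigo_cmult[OF Ona\<eta>]]) (use \<epsilon>' in simp)
  have t3: "(\<lambda>n. 7 * (8 * (real n * a n)\<^sup>2 * \<eta> n + (2 * real n * a n * \<eta> n)\<^sup>2)) \<in> O(\<lambda>n. real n powr (-\<epsilon>'))"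
    by (intro powr_bigo_cmult sum_in_bigo powr_bigo_weaken[OF Oe2] powr_bigo_weaken[OF powr_bigo_power[OF Ona\<eta>, of 2]])
      (use \<epsilon>' in auto)
  have t5: "(\<lambda>n. real (n * L n) * (3 * a n) ^ 3 * (13 + 7 * (8 * (real n * a n)\<^sup>2 * \<eta> n))) \<in> O(\<lambda>n. real n powr (-\<epsilon>'))"
  proof (rule powr_bigo_weaken)
    have "(\<lambda>n. 13 + 7 * (8 * (real n * a n)\<^sup>2 * \<eta> n)) \<in> O(\<lambda>n. real n powr 0)"
      by (intro sum_in_bigo powr_bigo_const powr_bigo_cmult powr_bigo_weaken[OF Oe2]) (use \<epsilon>' in auto)
    moreover have "(\<lambda>n. (3 * a n) ^ 3) \<in> O(\<lambda>n. real n powr (-1 - \<epsilon>))"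
      using powr_bigo_cmult[OF Oa3, of "3 ^ 3"] by (simp add: power_mult_distrib)
    ultimately show "(\<lambda>n. real (n * L n) * (3 * a n) ^ 3 * (13 + 7 * (8 * (real n * a n)\<^sup>2 * \<eta> n)))
        \<in> O(\<lambda>n. real n powr (1 + \<delta> + (-1 - \<epsilon>) + 0))"
      by (intro powr_bigo_mult ON)
  qed (use \<delta> in simp)
  define \<kappa> where "\<kappa> n = real (min n (m' n)) * real (4 * L n)" for n
  have t4: "(\<lambda>n. 5 * sqrt (real (n * L n) * 60000 * (3 * a n) ^ 4 * ((\<kappa> n)\<^sup>2 + real n * (real (n * L n))\<^sup>2 * B n)))
      \<in> O(\<lambda>n. real n powr (-\<epsilon>'))"
  proof -
    have B0: "0 \<le> B n" for n unfolding B_def by simp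
    \<comment> \<open>As \<open>\<kappa> n\<close> is at most \<open>4 * R^2 * L^2\<close>, the
      fourth power of \<open>a * R\<close> appears. Its decay
      \<open>n powr (-1/4 - \<epsilon>)\<close> then produces the \<open>n powr -1\<close> that
      cancels the factor \<open>n\<close> in the word length.\<close>
    have "(\<lambda>n. a n ^ 4 * (\<kappa> n)\<^sup>2) \<in> O(\<lambda>n. real n powr (-1 - 2 * \<epsilon>' - \<delta>))"
    proof (rule bigo_mono)
      have "(\<lambda>n. 16 * ((a n * real (R n)) ^ 4 * real (L n) ^ 4)) \<in>
          O(\<lambda>n. real n powr (real 4 * (-1/4 - \<epsilon>) + real 4 * \<delta>))"
        by (intro powr_bigo_cmult powr_bigo_mult powr_bigo_power OaR OL)
      then show "(\<lambda>n. 16 * ((a n * real (R n)) ^ 4 * real (L n) ^ 4)) \<in> O(\<lambda>n. real n powr (-1 - 2 * \<epsilon>' - \<delta>))"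
        by (rule powr_bigo_weaken) (use \<delta> \<epsilon>' in simp)
      have "a n ^ 4 * (\<kappa> n)\<^sup>2 \<le> 16 * ((a n * real (R n)) ^ 4 * real (L n) ^ 4)" for n
      proof -
        have "\<kappa> n \<le> real (m' n) * real (4 * L n)" unfolding \<kappa>_def by (intro mult_right_mono) auto
        also have "\<dots> = 4 * (real (R n))\<^sup>2 * (real (L n))\<^sup>2" by (simp add: m'_def power2_eq_square)
        finally have "(\<kappa> n)\<^sup>2 \<le> (4 * (real (R n))\<^sup>2 * (real (L n))\<^sup>2)\<^sup>2" by (intro power_mono) (auto simp: \<kappa>_def)
        then have "a n ^ 4 * (\<kappa> n)\<^sup>2 \<le> a n ^ 4 * (4 * (real (R n))\<^sup>2 * (real (L n))\<^sup>2)\<^sup>2" by (intro mult_left_mono) auto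
        then show ?thesis by (simp add: power_mult_distrib flip: power_mult)
      qed
      then show "\<forall>\<^sub>F n in sequentially. 0 \<le> a n ^ 4 * (\<kappa> n)\<^sup>2 \<and> a n ^ 4 * (\<kappa> n)\<^sup>2 \<le> 16 * ((a n * real (R n)) ^ 4 * real (L n) ^ 4)"
        by (intro always_eventually) simp
    qed
    moreover have "(\<lambda>n. a n ^ 4 * (real n * (real (n * L n))\<^sup>2 * B n)) \<in> O(\<lambda>n. real n powr (-1 - 2 * \<epsilon>' - \<delta>))"
    proof (rule powr_bigo_weaken)
      show "(\<lambda>n. a n ^ 4 * (real n * (real (n * L n))\<^sup>2 * B n)) \<in>
          O(\<lambda>n. real n powr (real 4 * 0 + (1 + real 2 * 2 + (-17 - 2 * \<epsilon>))))"
        by (intro powr_bigo_mult powr_bigo_power Oa powr_bigo_ident ON2 OB)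
    qed (use \<delta> \<epsilon>' in simp)
    ultimately have "(\<lambda>n. a n ^ 4 * (\<kappa> n)\<^sup>2 + a n ^ 4 * (real n * (real (n * L n))\<^sup>2 * B n)) \<in> O(\<lambda>n. real n powr (-1 - 2 * \<epsilon>' - \<delta>))"
      by (rule sum_in_bigo(1))
    from powr_bigo_cmult[OF powr_bigo_mult[OF ON this], of "60000 * 81"]
    have "(\<lambda>n. real (n * L n) * 60000 * (3 * a n) ^ 4 * ((\<kappa> n)\<^sup>2 + real n * (real (n * L n))\<^sup>2 * B n)) \<in> O(\<lambda>n. real n powr (- 2 * \<epsilon>'))"
      by (simp add: algebra_simps power_mult_distrib)
    from powr_bigo_sqrt[OF this]
    show ?thesis using B0 by (intro powr_bigo_cmult) simp
  qed
  have "\<forall>\<^sub>F n in sequentially. 0 \<le> kolmogorov_dist (measure_pmf (uniform_tree n)) (F n) \<and>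
    kolmogorov_dist (measure_pmf (uniform_tree n)) (F n) \<le> \<eta> n + 6 * (2 * real n * a n * \<eta> n) +
    7 * (8 * (real n * a n)\<^sup>2 * \<eta> n + (2 * real n * a n * \<eta> n)\<^sup>2) +
    5 * sqrt (real (n * L n) * 60000 * (3 * a n) ^ 4 * ((\<kappa> n)\<^sup>2 + real n * (real (n * L n))\<^sup>2 * B n)) +
    real (n * L n) * (3 * a n) ^ 3 * (13 + 7 * (8 * (real n * a n)\<^sup>2 * \<eta> n))"
    using good
  proof eventually_elim
    case (elim n)
    have m'1: "1 \<le> m' n" using mult_le_mono[OF one_le_power[OF R(2)[of n], of 2] L1[of n]] elim by (simp add: m'_def)
    have v: "0 < measure_pmf.variance (uniform_tree n) (F n)" using elim by (simp add: \<sigma>_def)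
    have n1: "1 \<le> n" using elim by simp
    show ?case
      using kolmogorov_bound[OF _ L1[OF n1] m'1 lip[OF n1] \<alpha>[OF n1] sup[OF n1] R(3)[OF n1] R(2)[OF n1] v, of k "B n"] elim
        kolmogorov_dist_nonneg
      by (simp add: B_def a_def \<sigma>_def \<eta>_def \<kappa>_def)
  qed
  then show ?thesis by (rule bigo_mono[rotated]) (intro sum_in_bigo t1 t2 t3 t4 t5)
qed

text \<open>Eventual positivity of the variance is implicit in the quotients of the informal
  statement; since division by 0 gives 0 here, it has to be stated. Convergence follows from the
  rate for \<open>\<epsilon> / 2\<close>.\<close>

theorem theorem1p1:
  fixes F :: "nat \<Rightarrow> graph \<Rightarrow> real" and \<alpha> \<rho> :: "nat \<Rightarrow> real" and \<epsilon> :: real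
  assumes "\<And>n. n \<ge> 1 \<Longrightarrow> \<alpha> n > 0"
    and "\<And>n. n \<ge> 1 \<Longrightarrow> \<rho> n \<ge> 1"
    and "\<And>n. n \<ge> 1 \<Longrightarrow> tree_lipschitz n (\<alpha> n) (F n)"
    and "\<And>n. n \<ge> 1 \<Longrightarrow> superposable n (\<rho> n) (F n)"
    and "\<epsilon> > 0"
    and "\<forall>\<^sub>F n in sequentially. measure_pmf.variance (uniform_tree n) (F n) > 0"
    and "(\<lambda>n. real n * \<alpha> n ^ 3 / measure_pmf.variance (uniform_tree n) (F n) powr (3/2) +
              real n powr (1/4) * \<alpha> n * \<rho> n / measure_pmf.variance (uniform_tree n) (F n) powr (1/2))
         \<in> O[sequentially](\<lambda>n. real n powr (-\<epsilon>))"
  shows "asymptotically_normal (\<lambda>n. measure_pmf (uniform_tree n)) F \<and>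
    (\<forall>\<epsilon>'\<in>{0<..<\<epsilon>}. (\<lambda>n. kolmogorov_dist (measure_pmf (uniform_tree n)) (F n))
       \<in> O[sequentially](\<lambda>n. real n powr (-\<epsilon>')))"
proof -
  note rate = kolmogorov_rate[OF assms(1-4,6,7)]
  have "(\<lambda>n. real n powr (- (\<epsilon> / 2))) \<longlonglongrightarrow> 0"
    using assms(5) by (intro tendsto_neg_powr filterlim_real_sequentially) simp
  then have "(\<lambda>n. real n powr (- (\<epsilon> / 2))) \<in> o(\<lambda>_. 1)" by (intro smalloI_tendsto) auto
  then have "(\<lambda>n. kolmogorov_dist (measure_pmf (uniform_tree n)) (F n)) \<in> o(\<lambda>_. 1)"
    using landau_o.big_small_trans[OF rate[of "\<epsilon> / 2"]] assms(5) by simp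
  then have "asymptotically_normal (\<lambda>n. measure_pmf (uniform_tree n)) F"
    unfolding asymptotically_normal_def using smalloD_tendsto by fastforce
  with rate show ?thesis by simp
qed

end
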